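(* Let $d\ge2$, $1<p<d$, $\gamma=\frac{d-p}{p-1}$. Let $0<\delta<\min\{1/2,1/(2\gamma)\}$, $0<\varepsilon<\delta/10$, $\tau_1\in(0,\infty)$, and $0<\alpha<\min\{1/80,\tau_1\varepsilon^{1/\gamma}\}$. Let $S\subset\mathbb S^{d-1}$ be a finite set with Euclidean distance at least $\varepsilon$ between any two distinct points. For $\zeta>0$ let $\Omega_\zeta=B(0,1+\delta)\setminus\bigcup_{s\in S}\bar B(s,\zeta\varepsilon)$. Let $w:\bar B(0,1+\delta)\to[0,1]$ be the Perron solution of $\Delta_pw=0$ in $\Omega_\alpha$, $w=0$ on $\partial B(0,1+\delta)$, $w=1$ on $\bigcup_{s\in S}\partial B(s,\alpha\varepsilon)$. Then there is $C=C(d,p)$ such that $$\sup_{z\in\Omega_{1/10}}|w(z)|\le C\tau_1^\gamma\delta.$$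
   Context: Perron solution in the sense of nonlinear potential theory (infimum of the upper class of $p$-superharmonic functions dominating the boundary data; here it coincides with the lower Perron solution). *)

theory Defs
  imports "HOL-Analysis.Analysis"
begin

text \<open>C^1 test functions with compact support in the open set U; g is the (classical) gradient.
  By density, C^1_c test functions give the same weak notions as C^\<infinity>_c ones.\<close>
definition test_fun :: "'a::euclidean_space set \<Rightarrow> ('a \<Rightarrow> real) \<Rightarrow> ('a \<Rightarrow> 'a) \<Rightarrow> bool" where
  "test_fun U \<phi> g \<longleftrightarrow>
     (\<forall>x. (\<phi> has_derivative (\<lambda>h. g x \<bullet> h)) (at x)) \<and> continuous_on UNIV g \<and>
     compact (closure {x. \<phi> x \<noteq> 0}) \<and> closure {x. \<phi> x \<noteq> 0} \<subseteq> U"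

definition loc_Lp :: "real \<Rightarrow> 'a::euclidean_space set \<Rightarrow> ('a \<Rightarrow> 'b::real_normed_vector) \<Rightarrow> bool" where
  "loc_Lp p U f \<longleftrightarrow> set_borel_measurable lebesgue U f \<and>
     (\<forall>K. compact K \<and> K \<subseteq> U \<longrightarrow> set_integrable lebesgue K (\<lambda>x. norm (f x) powr p))"

definition weak_gradient :: "'a::euclidean_space set \<Rightarrow> ('a \<Rightarrow> real) \<Rightarrow> ('a \<Rightarrow> 'a) \<Rightarrow> bool" where
  "weak_gradient U u G \<longleftrightarrow>
     (\<forall>\<phi> g. test_fun U \<phi> g \<longrightarrow>
        (LINT x:U|lebesgue. u x *\<^sub>R g x) = - (LINT x:U|lebesgue. \<phi> x *\<^sub>R G x))"

definition W1p_loc :: "real \<Rightarrow> 'a::euclidean_space set \<Rightarrow> ('a \<Rightarrow> real) \<Rightarrow> ('a \<Rightarrow> 'a) \<Rightarrow> bool" where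
  "W1p_loc p U u G \<longleftrightarrow> loc_Lp p U u \<and> loc_Lp p U G \<and> weak_gradient U u G"

definition p_harmonic :: "real \<Rightarrow> 'a::euclidean_space set \<Rightarrow> ('a \<Rightarrow> real) \<Rightarrow> bool" where
  "p_harmonic p U h \<longleftrightarrow> continuous_on U h \<and>
     (\<exists>G. W1p_loc p U h G \<and>
        (\<forall>\<phi> g. test_fun U \<phi> g \<longrightarrow>
           (LINT x:U|lebesgue. norm (G x) powr (p - 2) * (G x \<bullet> g x)) = 0))"

text \<open>p-superharmonic (Heinonen-Kilpelainen-Martio / Lindqvist): values in (-\<infinity>,\<infinity>],
  lower semicontinuous, not identically \<infinity> in any component, and obeying the comparison
  principle with p-harmonic functions on relatively compact open subsets.\<close>
definition p_superharmonic :: "real \<Rightarrow> 'a::euclidean_space set \<Rightarrow> ('a \<Rightarrow> ereal) \<Rightarrow> bool" where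
  "p_superharmonic p \<Omega> u \<longleftrightarrow>
     (\<forall>x\<in>\<Omega>. u x \<noteq> -\<infinity>) \<and>
     (\<forall>x\<in>\<Omega>. u x \<le> Liminf (at x within \<Omega>) u) \<and>
     (\<forall>C\<in>components \<Omega>. \<exists>x\<in>C. u x \<noteq> \<infinity>) \<and>
     (\<forall>D h. open D \<and> compact (closure D) \<and> closure D \<subseteq> \<Omega> \<and>
        continuous_on (closure D) h \<and> p_harmonic p D h \<and>
        (\<forall>x\<in>frontier D. ereal (h x) \<le> u x) \<longrightarrow> (\<forall>x\<in>D. ereal (h x) \<le> u x))"

definition upper_class :: "real \<Rightarrow> 'a::euclidean_space set \<Rightarrow> ('a \<Rightarrow> real) \<Rightarrow> ('a \<Rightarrow> ereal) set" where
  "upper_class p \<Omega> f = {u. p_superharmonic p \<Omega> u \<and> (\<exists>M::real. \<forall>x\<in>\<Omega>. ereal M \<le> u x) \<and>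
       (\<forall>\<xi>\<in>frontier \<Omega>. ereal (f \<xi>) \<le> Liminf (at \<xi> within \<Omega>) u)}"

definition perron :: "real \<Rightarrow> 'a::euclidean_space set \<Rightarrow> ('a \<Rightarrow> real) \<Rightarrow> 'a \<Rightarrow> ereal" where
  "perron p \<Omega> f x = Inf {u x | u. u \<in> upper_class p \<Omega> f}"

definition Omega_dom :: "real \<Rightarrow> real \<Rightarrow> 'a::euclidean_space set \<Rightarrow> real \<Rightarrow> 'a set" where
  "Omega_dom \<delta> \<epsilon> S \<zeta> = ball 0 (1 + \<delta>) - (\<Union>s\<in>S. cball s (\<zeta> * \<epsilon>))"

end

theory Submission
  imports Defs
begin

text \<open>The lower bound is the minimum principle, by comparison with constants. The upper bound comes from an
  explicit member of the upper class. Far from \<open>S\<close> it is a concave decreasing function of \<open>|x|\<close>, strongly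
  concave in a shell of width comparable to \<open>\<epsilon>\<close> around the unit sphere, plus a spherical bump at each point
  of \<open>S\<close>; the flux leaving the holes is thereby spread over the sphere and leaves with gradient of order
  \<open>\<tau>\<^sub>1 powr \<gamma>\<close> through a layer of width \<open>\<delta>\<close>. Very close to a point of \<open>S\<close> the barrier is a
  fundamental solution, glued in by a minimum, so no superposition of singular solutions is needed.
  Superharmonicity of the barrier is checked pointwise: it is touched from above by strict \<open>C\<^sup>2\<close>
  supersolutions, and weak \<open>p\<close>-harmonic functions are viscosity subsolutions.\<close>

subsection \<open>Integration by parts and the minimum principle\<close>

text \<open>For p \<noteq> 2 the operator depends on the direction of the gradient, and the gradient
  of \<open>base\<close> plus a bump points in no controlled direction and may vanish. Every piece
  other than the fundamental solution is therefore estimated for all vectors \<open>n\<close> with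
  \<open>norm n \<le> 1\<close> at once; for fixed \<open>n\<close> the operator is linear in the
  Hessian, so such bounds add. The fundamental solution is controlled only along its own gradient,
  hence it is never added to a bump. Scaling gives the final bound: all lengths near
  \<open>S\<close> are \<epsilon> times constants, so at radius \<alpha> \<epsilon> the pole is a
  constant times \<epsilon> \<alpha>^(-\<gamma>). As \<alpha>^\<gamma> < \<tau>1^\<gamma>
  \<epsilon>, a constant multiple of \<tau>1^\<gamma> lifts it above 1 on the holes, while the
  unscaled barrier is O(\<delta>) on the region of the supremum. On the weak side the equation
  supplies only an L^p gradient, whereas test functions must be C^1; this forces a mollification
  whose error is measured against the size of the flux.\<close>

lemma integrable_continuous_compact_support:
  fixes f :: "'a::euclidean_space \<Rightarrow> 'b::euclidean_space"
  assumes "continuous_on UNIV f" "compact K" "\<And>x. x \<notin> K \<Longrightarrow> f x = 0"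
  shows "integrable lborel f" "integrable lebesgue f"
proof -
  have "integrable lborel (\<lambda>x. indicator K x *\<^sub>R f x)"
    using assms by (intro borel_integrable_compact) (auto intro: continuous_on_subset)
  moreover have "(\<lambda>x. indicator K x *\<^sub>R f x) = f"
    using assms(3) by (auto simp: indicator_def)
  ultimately show i: "integrable lborel f" by simp
  then show "integrable lebesgue f"
    by (simp add: integrable_completion borel_measurable_integrable)
qed

lemma integral_lborel_translation:
  fixes f :: "'a::euclidean_space \<Rightarrow> 'b::euclidean_space"
  assumes "f \<in> borel_measurable borel"
  shows "(LINT x|lborel. f (x + c)) = (LINT x|lborel. f x)"
proof -
  have "(LINT x|lborel. f x) = (LINT x|distr lborel borel ((+) c). f x)"
    by (simp add: lborel_distr_plus)
  also have "\<dots> = (LINT x|lborel. f (c + x))"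
    using assms by (intro integral_distr) auto
  finally show ?thesis by (simp add: add.commute)
qed

lemma integral_cbox_eq_lborel:
  fixes f :: "'a::euclidean_space \<Rightarrow> 'b::euclidean_space"
  assumes "continuous_on UNIV f" "\<And>x. x \<notin> cbox a b \<Longrightarrow> f x = 0"
  shows "integral (cbox a b) f = (LINT x|lborel. f x)"
proof -
  have "integral (cbox a b) f = integral UNIV (\<lambda>x. if x \<in> cbox a b then f x else 0)"
    by (simp add: integral_restrict_UNIV)
  also have "(\<lambda>x. if x \<in> cbox a b then f x else 0) = f" using assms(2) by auto
  finally show ?thesis
    using integral_lborel[OF integrable_continuous_compact_support(1)[OF assms(1) compact_cbox assms(2)]]
    by simp
qed

lemma has_derivative_imp_continuous_on:
  assumes "\<And>x. x \<in> S \<Longrightarrow> (f has_derivative f' x) (at x)"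
  shows "continuous_on S f"
  by (rule has_derivative_continuous_on[where f' = f']) (rule has_derivative_at_withinI, rule assms)

lemma derivative_vanishes_off_support:
  assumes "\<And>x. (\<psi> has_derivative g x) (at x)" "closed K"
    "\<And>x. x \<notin> K \<Longrightarrow> \<psi> x = 0" "x \<notin> K"
  shows "g x = (\<lambda>_. 0)"
proof -
  have "((\<lambda>_. 0) has_derivative g x) (at x)"
    by (rule has_derivative_transform_within_open[OF assms(1), of "- K"])
      (use assms in auto)
  then show ?thesis
    using has_derivative_unique has_derivative_const by metis
qed

lemma gradient_vanishes_off_support:
  fixes g :: "'a::euclidean_space \<Rightarrow> 'a"
  assumes "\<And>x. (\<psi> has_derivative (\<lambda>h. g x \<bullet> h)) (at x)" "closed K"
    "\<And>x. x \<notin> K \<Longrightarrow> \<psi> x = 0" "x \<notin> K"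
  shows "g x = 0"
proof -
  have "g x \<bullet> g x = 0"
    using derivative_vanishes_off_support[OF assms] by metis
  then show ?thesis by simp
qed

text \<open>Translation invariance makes the integral of \<open>\<psi> (x + t *\<^sub>R b)\<close>
  independent of \<open>t\<close>; its derivative at \<open>t = 0\<close>, taken under the integral
  sign, is the integral in question.\<close>

lemma integral_directional_derivative_zero:
  fixes \<psi> :: "'a::euclidean_space \<Rightarrow> real"
  assumes \<psi>: "\<And>x. (\<psi> has_derivative g x) (at x)" and g: "continuous_on UNIV (\<lambda>x. g x b)"
    and K: "compact K" "\<And>x. x \<notin> K \<Longrightarrow> \<psi> x = 0"
  shows "(LINT x|lebesgue. g x b) = 0"
proof -
  have c\<psi>: "continuous_on UNIV \<psi>"
    by (rule has_derivative_imp_continuous_on[OF \<psi>])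
  have g0: "g x = (\<lambda>_. 0)" if "x \<notin> K" for x
    using derivative_vanishes_off_support[OF \<psi> compact_imp_closed[OF K(1)] K(2) that] .
  \<comment> \<open>One box containing all shifts of \<open>K\<close> with \<bar>t\<bar> \<le> 1
    turns the whole-space integrals into integrals over a fixed compact domain, where the Leibniz
    rule applies.\<close>
  have "compact ((\<lambda>(x, t). x - t *\<^sub>R b) ` (K \<times> {-1..1}))"
    by (intro compact_continuous_image compact_Times K)
      (auto simp: case_prod_beta intro!: continuous_intros)
  then obtain c where c: "(\<lambda>(x, t). x - t *\<^sub>R b) ` (K \<times> {-1..1}) \<subseteq> cbox (-c) c"
    by (meson bounded_subset_cbox_symmetric compact_imp_bounded)
  have out: "x + t *\<^sub>R b \<notin> K" if "x \<notin> cbox (-c) c" "t \<in> {-1..1}" for x t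
  proof
    assume "x + t *\<^sub>R b \<in> K"
    then have "(\<lambda>(x, t). x - t *\<^sub>R b) (x + t *\<^sub>R b, t) \<in> cbox (-c) c"
      using c that by blast
    then show False using that by simp
  qed
  define F where "F t = integral (cbox (-c) c) (\<lambda>x. \<psi> (x + t *\<^sub>R b))" for t
  have F_const: "F t = (LINT x|lborel. \<psi> x)" if "t \<in> {-1..1}" for t
  proof -
    have "F t = (LINT x|lborel. \<psi> (x + t *\<^sub>R b))"
      unfolding F_def
      by (rule integral_cbox_eq_lborel)
        (use out that K(2) in \<open>auto intro!: continuous_intros continuous_on_compose2[OF c\<psi>]\<close>)
    also have "\<dots> = (LINT x|lborel. \<psi> x)"
      using borel_measurable_continuous_onI[OF c\<psi>] by (rule integral_lborel_translation)
    finally show ?thesis .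
  qed
  have "(F has_field_derivative integral (cbox (-c) c) (\<lambda>x. g (x + 0 *\<^sub>R b) b)) (at 0 within {-1..1})"
    unfolding F_def
  proof (rule leibniz_rule_field_derivative[where U = "{-1..1}" and fx = "\<lambda>t x. g (x + t *\<^sub>R b) b"])
    show "((\<lambda>t. \<psi> (x + t *\<^sub>R b)) has_field_derivative g (x + t *\<^sub>R b) b) (at t within {-1..1})" for x t
    proof -
      have "((\<lambda>t. \<psi> (x + t *\<^sub>R b)) has_derivative (\<lambda>h. g (x + t *\<^sub>R b) (h *\<^sub>R b))) (at t within {-1..1})"
        by (rule has_derivative_compose[of "\<lambda>t. x + t *\<^sub>R b" "\<lambda>h. h *\<^sub>R b", OF _ \<psi>])
          (auto intro!: derivative_eq_intros)
      moreover have "(\<lambda>h. g (x + t *\<^sub>R b) (h *\<^sub>R b)) = (*) (g (x + t *\<^sub>R b) b)"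
        using linear_scale[OF has_derivative_linear[OF \<psi>]] by (auto simp: mult.commute)
      ultimately show ?thesis
        by (simp add: has_field_derivative_def)
    qed
    show "(\<lambda>x. \<psi> (x + t *\<^sub>R b)) integrable_on cbox (-c) c" for t
      by (intro integrable_continuous continuous_on_compose2[OF c\<psi>]) (auto intro!: continuous_intros)
    show "continuous_on ({-1..1} \<times> cbox (-c) c) (\<lambda>(t, x). g (x + t *\<^sub>R b) b)"
      by (auto simp: case_prod_beta intro!: continuous_intros continuous_on_compose2[OF g, of _ "\<lambda>z. snd z + fst z *\<^sub>R b"])
  qed auto
  then have d: "(F has_field_derivative integral (cbox (-c) c) (\<lambda>x. g x b)) (at 0)"
    using at_within_Icc_at[of "-1" "0::real" 1] by simp
  have "(F has_field_derivative 0) (at 0)"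
    by (rule DERIV_cong_ev[THEN iffD2, OF refl _ refl DERIV_const])
      (auto simp: eventually_nhds F_const intro!: exI[of _ "{-1<..<1}"])
  with d have "integral (cbox (-c) c) (\<lambda>x. g x b) = 0"
    using DERIV_unique by blast
  moreover have "x \<notin> K" if "x \<notin> cbox (-c) c" for x
    using out[OF that, of 0] by simp
  ultimately have "(LINT x|lborel. g x b) = 0"
    using g0 by (subst integral_cbox_eq_lborel[symmetric]) (auto intro!: continuous_intros g)
  then show ?thesis
    using g by (subst integral_completion) (auto intro!: borel_measurable_continuous_onI continuous_intros)
qed

lemma integral_gradient_zero:
  fixes g :: "'a::euclidean_space \<Rightarrow> 'a"
  assumes \<psi>: "\<And>x. (\<psi> has_derivative (\<lambda>h. g x \<bullet> h)) (at x)" and g: "continuous_on UNIV g"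
    and K: "compact K" "\<And>x. x \<notin> K \<Longrightarrow> \<psi> x = 0"
  shows "(LINT x|lebesgue. g x \<bullet> b) = 0"
  by (rule integral_directional_derivative_zero[OF \<psi> _ K]) (intro continuous_intros g)

lemma test_funD:
  assumes "test_fun U \<phi> g"
  shows "(\<phi> has_derivative (\<lambda>h. g x \<bullet> h)) (at x)" "continuous_on UNIV g" "continuous_on UNIV \<phi>"
    "\<exists>K. compact K \<and> K \<subseteq> U \<and> (\<forall>x. x \<notin> K \<longrightarrow> \<phi> x = 0 \<and> g x = 0)"
proof -
  have d: "\<And>x. (\<phi> has_derivative (\<lambda>h. g x \<bullet> h)) (at x)"
    and K: "compact (closure {x. \<phi> x \<noteq> 0})" "closure {x. \<phi> x \<noteq> 0} \<subseteq> U"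
    and g: "continuous_on UNIV g"
    using assms by (auto simp: test_fun_def)
  show "(\<phi> has_derivative (\<lambda>h. g x \<bullet> h)) (at x)" "continuous_on UNIV g" by fact+
  show "continuous_on UNIV \<phi>"
    by (rule has_derivative_imp_continuous_on[OF d])
  have z: "\<phi> x = 0" if "x \<notin> closure {x. \<phi> x \<noteq> 0}" for x
    using that closure_subset[of "{x. \<phi> x \<noteq> 0}"] by auto
  show "\<exists>K. compact K \<and> K \<subseteq> U \<and> (\<forall>x. x \<notin> K \<longrightarrow> \<phi> x = 0 \<and> g x = 0)"
    using K z gradient_vanishes_off_support[OF d closed_closure z] by blast
qed

lemma set_integral_eq_integral_vanishing:
  assumes "\<And>x. x \<notin> U \<Longrightarrow> f x = 0"
  shows "(LINT x:U|M. f x) = (LINT x|M. f x)"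
  unfolding set_lebesgue_integral_def
  by (rule Bochner_Integration.integral_cong) (use assms in \<open>auto simp: indicator_def\<close>)

lemma loc_Lp_const:
  fixes U :: "'a::euclidean_space set" and v :: "'b::euclidean_space"
  assumes "open U"
  shows "loc_Lp p U (\<lambda>_. v)"
  unfolding loc_Lp_def set_borel_measurable_def
proof (intro conjI allI impI)
  have "U \<in> sets lebesgue" using assms by (auto intro: sets_completionI_sets)
  then show "(\<lambda>x. indicator U x *\<^sub>R v) \<in> borel_measurable lebesgue" by simp
  fix K :: "'a set" assume "compact K \<and> K \<subseteq> U"
  then have "K \<in> lmeasurable" by (simp add: lmeasurable_compact)
  then show "set_integrable lebesgue K (\<lambda>x. norm v powr p)"
    by (auto simp: set_integrable_def fmeasurable_def intro!: integrable_real_indicator)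
qed

text \<open>Constants are the comparison functions of the minimum principle. The weak gradient 0 is
  admissible because test gradients integrate to zero.\<close>

lemma p_harmonic_const:
  fixes U :: "'a::euclidean_space set"
  assumes "open U"
  shows "p_harmonic p U (\<lambda>_. c)"
proof -
  have "weak_gradient U (\<lambda>_. c) (\<lambda>_. 0)"
    unfolding weak_gradient_def
  proof (intro allI impI)
    fix \<phi> g assume t: "test_fun U \<phi> g"
    then obtain K where K: "compact K" "K \<subseteq> U" "\<And>x. x \<notin> K \<Longrightarrow> \<phi> x = 0 \<and> g x = 0"
      using test_funD(4) by metis
    have i: "integrable lebesgue (\<lambda>x. c *\<^sub>R g x)"
      by (rule integrable_continuous_compact_support(2)[OF _ K(1)])
        (use K test_funD(2)[OF t] in \<open>auto intro!: continuous_intros\<close>)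
    have "(LINT x|lebesgue. c *\<^sub>R g x) \<bullet> b = 0" for b
    proof -
      have "(LINT x|lebesgue. c *\<^sub>R g x) \<bullet> b = (LINT x|lebesgue. g x \<bullet> (c *\<^sub>R b))"
        using integral_inner_left[OF i, of b] by auto
      also have "\<dots> = 0"
        using integral_gradient_zero[OF test_funD(1,2)[OF t] K(1)] K(3) by blast
      finally show ?thesis .
    qed
    then have "(LINT x|lebesgue. c *\<^sub>R g x) = 0" by (metis inner_eq_zero_iff)
    moreover have "(LINT x:U|lebesgue. c *\<^sub>R g x) = (LINT x|lebesgue. c *\<^sub>R g x)"
      by (rule set_integral_eq_integral_vanishing) (use K in auto)
    moreover have "(LINT x:U|lebesgue. \<phi> x *\<^sub>R (0::'a)) = 0"
      by (simp add: set_lebesgue_integral_def)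
    ultimately show "(LINT x:U|lebesgue. c *\<^sub>R g x) = - (LINT x:U|lebesgue. \<phi> x *\<^sub>R (0::'a))"
      by (simp only: minus_zero)
  qed
  then show ?thesis
    using assms unfolding p_harmonic_def W1p_loc_def
    by (auto simp: loc_Lp_const intro!: exI[of _ "\<lambda>_. 0"])
qed

text \<open>If \<open>u\<close> dropped below some level c < 0, the set where u \<le> c would be
  compact in \<Omega>: lower semicontinuity closes it inside, and the boundary condition keeps it
  off the frontier. A neighbourhood of it is then admissible for comparison with the constant
  c.\<close>

lemma upper_class_nonneg:
  fixes \<Omega> :: "'a::euclidean_space set"
  assumes "open \<Omega>" "bounded \<Omega>" and f: "\<And>\<xi>. \<xi> \<in> frontier \<Omega> \<Longrightarrow> 0 \<le> f \<xi>"
    and u: "u \<in> upper_class p \<Omega> f" and z: "z \<in> \<Omega>"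
  shows "0 \<le> u z"
proof (rule ccontr)
  assume "\<not> 0 \<le> u z"
  \<comment> \<open>\<open>c < 0\<close> separates the sublevel set from the frontier, and the
    strict \<open>u z < c\<close> is what the comparison contradicts in the end.\<close>
  then obtain c :: real where c: "c < 0" "u z < ereal c"
    by (metis ereal_dense2 ereal_less(2) less_ereal.simps(1) linorder_not_le zero_ereal_def)
  have lsc: "\<And>x. x \<in> \<Omega> \<Longrightarrow> u x \<le> Liminf (at x within \<Omega>) u"
    and comp: "\<And>D h. open D \<Longrightarrow> compact (closure D) \<Longrightarrow> closure D \<subseteq> \<Omega> \<Longrightarrow>
        continuous_on (closure D) h \<Longrightarrow> p_harmonic p D h \<Longrightarrow>
        (\<forall>x\<in>frontier D. ereal (h x) \<le> u x) \<Longrightarrow> (\<forall>x\<in>D. ereal (h x) \<le> u x)"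
    and bd: "\<And>\<xi>. \<xi> \<in> frontier \<Omega> \<Longrightarrow> ereal (f \<xi>) \<le> Liminf (at \<xi> within \<Omega>) u"
    using u by (auto simp: upper_class_def p_superharmonic_def)
  define K where "K = {x \<in> \<Omega>. u x \<le> ereal c}"
  have "closed K"
  proof (rule closed_limpt[THEN iffD2], intro allI impI)
    fix x assume x: "x islimpt K"
    show "x \<in> K"
    proof (rule ccontr)
      assume n: "x \<notin> K"
      have "x \<in> closure \<Omega>"
        using x by (metis (no_types, lifting) K_def closure_def UnI2 islimpt_subset mem_Collect_eq subsetI)
      then have "ereal c < Liminf (at x within \<Omega>) u"
      proof (cases "x \<in> \<Omega>")
        case True
        then show ?thesis using lsc[OF True] n by (auto simp: K_def)
      next
        case False
        then have "x \<in> frontier \<Omega>" using \<open>x \<in> closure \<Omega>\<close> assms(1) by (simp add: frontier_def interior_open)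
        moreover have "ereal c < ereal (f x)" using f[OF calculation] c by simp
        ultimately show ?thesis using bd by (meson order_less_le_trans)
      qed
      then have "\<forall>\<^sub>F y in at x within \<Omega>. ereal c < u y"
        by (rule less_LiminfD)
      then obtain e where "e > 0" "\<And>y. y \<in> \<Omega> \<Longrightarrow> y \<noteq> x \<Longrightarrow> dist y x < e \<Longrightarrow> ereal c < u y"
        by (auto simp: eventually_at)
      moreover obtain y where "y \<in> K" "y \<noteq> x" "dist y x < e"
        using x \<open>e > 0\<close> by (auto simp: islimpt_approachable)
      ultimately show False by (fastforce simp: K_def)
    qed
  qed
  then have "compact K"
    using assms(2) by (auto simp: K_def compact_eq_bounded_closed intro: bounded_subset)
  moreover have "closed (- \<Omega>)" "K \<inter> - \<Omega> = {}" using assms(1) by (auto simp: K_def)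
  \<comment> \<open>By normality the closure of \<open>D\<close> stays in \<Omega>. Frontier points
    of the open set \<open>D\<close> are not in \<open>K\<close>, so \<open>u\<close> exceeds
    \<open>c\<close> there.\<close>
  ultimately obtain D V where D: "open D" "open V" "K \<subseteq> D" "- \<Omega> \<subseteq> V" "D \<inter> V = {}"
    using separation_normal[of K "- \<Omega>"] compact_imp_closed by metis
  then have clD: "closure D \<subseteq> \<Omega>"
    using closure_minimal[of D "- V"] by auto
  then have "compact (closure D)"
    using assms(2) by (metis bounded_subset closed_closure compact_eq_bounded_closed)
  then have "\<forall>x\<in>D. ereal c \<le> u x"
  proof (rule comp[OF D(1) _ clD continuous_on_const p_harmonic_const[OF D(1)]])
    show "\<forall>x\<in>frontier D. ereal c \<le> u x"
    proof
      fix x assume "x \<in> frontier D"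
      then have "x \<in> \<Omega>" "x \<notin> K"
        using clD D by (auto simp: frontier_def interior_open)
      then show "ereal c \<le> u x" by (auto simp: K_def)
    qed
  qed
  moreover have "z \<in> D" using D(3) z c by (auto simp: K_def)
  ultimately show False using c by (meson not_le)
qed

subsection \<open>Mollification in local Sobolev spaces\<close>

lemma powr_add_le:
  fixes a b p :: real
  assumes "0 \<le> a" "0 \<le> b" "0 \<le> p"
  shows "(a + b) powr p \<le> 2 powr p * (a powr p + b powr p)"
proof -
  have "(a + b) powr p \<le> (2 * max a b) powr p"
    using assms by (intro powr_mono2) auto
  also have "\<dots> = 2 powr p * (max a b) powr p"
    using assms by (simp add: powr_mult)
  also have "\<dots> \<le> 2 powr p * (a powr p + b powr p)"
    by (intro mult_left_mono) (auto simp: max_def)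
  finally show ?thesis .
qed

text \<open>Young's inequality with a free weight and crude constants, by comparing \<open>b\<close>
  with \<open>l * a\<close>. A small \<open>l\<close> makes the first term harmless; the large
  factor \<open>l powr (1 - p)\<close> falls on a term that a later approximation makes
  small.\<close>

lemma powr_mult_le_weighted:
  fixes a b p :: real
  assumes "0 \<le> a" "0 \<le> b" "0 < l" "1 < p"
  shows "a powr (p - 1) * b \<le> l * a powr p + l powr (1 - p) * b powr p"
proof (cases "b \<le> l * a")
  case True
  have "a powr (p - 1) * b \<le> a powr (p - 1) * (l * a)"
    by (intro mult_left_mono True) auto
  also have "\<dots> = l * a powr p"
    using assms by (cases "a = 0") (simp_all add: powr_diff field_simps)
  finally show ?thesis by (smt (verit) powr_ge_zero mult_nonneg_nonneg)
next
  case False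
  then have "a \<le> b / l" "b > 0" using assms by (auto simp: field_simps, smt (verit) mult_nonneg_nonneg)
  then have "a powr (p - 1) * b \<le> (b / l) powr (p - 1) * b"
    using assms by (intro mult_right_mono powr_mono2) auto
  also have "\<dots> = l powr (1 - p) * b powr p"
    using assms \<open>b > 0\<close> by (simp add: powr_divide powr_diff field_simps)
  finally show ?thesis using assms by (smt (verit) powr_ge_zero mult_nonneg_nonneg)
qed

text \<open>For \<open>N > 0\<close> the projection onto the closed ball of radius \<open>N\<close>,
  in a form without case distinction whose continuity is immediate.\<close>

definition radial_truncation :: "real \<Rightarrow> 'a::real_normed_vector \<Rightarrow> 'a" where
  "radial_truncation N v = (N / max N (norm v)) *\<^sub>R v"

lemma radial_truncation:
  assumes "0 < N"
  shows "norm (radial_truncation N v) \<le> N" "norm v \<le> N \<Longrightarrow> radial_truncation N v = v"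
    "norm (v - radial_truncation N v) \<le> norm v" "continuous_on A (radial_truncation N)"
proof -
  have "N * norm v \<le> N * max N (norm v)" using assms by (intro mult_left_mono) auto
  then show "norm (radial_truncation N v) \<le> N"
    using assms by (simp add: radial_truncation_def field_simps max_def)
  show "norm v \<le> N \<Longrightarrow> radial_truncation N v = v"
    using assms by (simp add: radial_truncation_def max_absorb1)
  have "v - radial_truncation N v = (1 - N / max N (norm v)) *\<^sub>R v"
    by (simp add: radial_truncation_def algebra_simps)
  moreover have "0 \<le> N / max N (norm v)" "N / max N (norm v) \<le> 1"
    using assms by (auto simp: divide_simps)
  then have "\<bar>1 - N / max N (norm v)\<bar> \<le> 1" by linarith
  ultimately show "norm (v - radial_truncation N v) \<le> norm v"
    by (simp add: mult_left_le_one_le)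
  show "continuous_on A (radial_truncation N)"
    unfolding radial_truncation_def using assms
    by (intro continuous_intros) (auto simp: max_def split: if_splits)
qed

text \<open>Continuous functions converging almost everywhere are at hand, but convergence in L^p
  needs domination, which truncation of the values provides. The level \<open>c\<close> is chosen
  first, so that truncating \<open>G\<close> costs less than \<open>e\<close>; the truncated
  continuous functions then converge to the truncated \<open>G\<close>.\<close>

lemma Lp_continuous_approximation:
  fixes G :: "'a::euclidean_space \<Rightarrow> 'b::euclidean_space"
  assumes meas: "set_borel_measurable lebesgue K G" and K: "K \<in> lmeasurable"
    and int: "set_integrable lebesgue K (\<lambda>x. norm (G x) powr p)" and p: "0 < p" and e: "0 < e"
  shows "\<exists>g. continuous_on UNIV g \<and> set_integrable lebesgue K (\<lambda>x. norm (G x - g x) powr p) \<and>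
     (LINT x:K|lebesgue. norm (G x - g x) powr p) < e"
proof -
  have [measurable]: "K \<in> sets lebesgue" using K by auto
  define H where "H x = indicator K x *\<^sub>R G x" for x
  have [measurable]: "H \<in> borel_measurable lebesgue"
    using meas by (simp add: set_borel_measurable_def H_def[abs_def])
  have HG: "H x = G x" if "x \<in> K" for x using that by (simp add: H_def)
  have Hint: "integrable lebesgue (\<lambda>x. norm (H x) powr p)"
  proof -
    have "(\<lambda>x. norm (H x) powr p) = (\<lambda>x. indicator K x *\<^sub>R norm (G x) powr p)"
      by (auto simp: H_def indicator_def)
    then show ?thesis using int by (simp add: set_integrable_def)
  qed
  have "H measurable_on UNIV" by (intro lebesgue_measurable_imp_measurable_on) auto
  then obtain N g where N: "negligible N" and g: "\<And>n. continuous_on UNIV (g n)"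
      "\<And>x. x \<notin> N \<Longrightarrow> (\<lambda>n. g n x) \<longlonglongrightarrow> H x"
    unfolding measurable_on_def by auto
  have [measurable]: "g n \<in> borel_measurable lebesgue" for n
    using g(1)[of n] by (intro measurable_completion) (simp add: borel_measurable_continuous_onI)
  have AEN: "AE x in lebesgue. x \<notin> N"
    using N by (simp add: negligible_iff_null_sets AE_not_in)
  have tr_meas[measurable]: "radial_truncation c \<in> borel_measurable borel" if "c > 0" for c :: real
    using radial_truncation(4)[OF that] by (intro borel_measurable_continuous_onI) auto
  have "(\<lambda>n. LINT x|lebesgue. norm (H x - radial_truncation (real (Suc n)) (H x)) powr p)
      \<longlonglongrightarrow> (LINT x::'a|lebesgue. 0)"
  proof (rule integral_dominated_convergence[where w = "\<lambda>x. norm (H x) powr p"])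
    show "AE x in lebesgue. (\<lambda>n. norm (H x - radial_truncation (real (Suc n)) (H x)) powr p) \<longlonglongrightarrow> 0"
    proof (rule AE_I2)
      fix x
      obtain n0 where "norm (H x) \<le> real n0" using real_arch_simple by blast
      then have "\<forall>\<^sub>F n in sequentially. norm (H x - radial_truncation (real (Suc n)) (H x)) powr p = 0"
        by (intro eventually_sequentiallyI[of n0]) (simp add: radial_truncation(2))
      then show "(\<lambda>n. norm (H x - radial_truncation (real (Suc n)) (H x)) powr p) \<longlonglongrightarrow> 0"
        by (rule tendsto_eventually)
    qed
    show "AE x in lebesgue. norm (norm (H x - radial_truncation (real (Suc n)) (H x)) powr p) \<le> norm (H x) powr p" for n
      using radial_truncation(3)[of "real (Suc n)"] p by (auto intro!: powr_mono2 AE_I2)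
  qed (use Hint in auto)
  then have "\<forall>\<^sub>F n in sequentially. (LINT x|lebesgue. norm (H x - radial_truncation (real (Suc n)) (H x)) powr p) < e"
    using e by (auto dest: order_tendstoD(2))
  then obtain n where "(LINT x|lebesgue. norm (H x - radial_truncation (real (Suc n)) (H x)) powr p) < e"
    by (auto simp: eventually_sequentially)
  then obtain c where c: "c > 0" "(LINT x|lebesgue. norm (H x - radial_truncation c (H x)) powr p) < e"
    by (metis of_nat_0_less_iff zero_less_Suc)
  note [measurable] = tr_meas[OF c(1)]
  define w where "w x = indicator K x * (2 powr p * (norm (H x) powr p + c powr p))" for x
  have w: "integrable lebesgue w"
  proof -
    have "integrable lebesgue (\<lambda>x. 2 powr p * (norm (H x) powr p) + (2 powr p * c powr p) * indicat_real K x)"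
      using Hint K by (auto simp: fmeasurable_def intro!: integrable_real_indicator)
    also have "(\<lambda>x. 2 powr p * (norm (H x) powr p) + (2 powr p * c powr p) * indicat_real K x) = w"
      by (auto simp: w_def H_def indicator_def algebra_simps)
    finally show ?thesis .
  qed
  have le_w: "indicator K x * norm (H x - radial_truncation c v) powr p \<le> w x" for x v
  proof -
    have "norm (H x - radial_truncation c v) powr p \<le> (norm (H x) + c) powr p"
      using norm_triangle_ineq4[of "H x" "radial_truncation c v"] radial_truncation(1)[OF c(1), of v] p
      by (intro powr_mono2) auto
    also have "\<dots> \<le> 2 powr p * (norm (H x) powr p + c powr p)"
      using c p by (intro powr_add_le) auto
    finally show ?thesis by (simp add: w_def indicator_def)
  qed
  have "(\<lambda>n. LINT x|lebesgue. indicator K x * norm (H x - radial_truncation c (g n x)) powr p)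
     \<longlonglongrightarrow> (LINT x|lebesgue. indicator K x * norm (H x - radial_truncation c (H x)) powr p)"
  proof (rule integral_dominated_convergence[OF _ _ w])
    show "AE x in lebesgue. (\<lambda>n. indicator K x * norm (H x - radial_truncation c (g n x)) powr p)
      \<longlonglongrightarrow> indicator K x * norm (H x - radial_truncation c (H x)) powr p"
    proof (rule AE_mp[OF AEN], rule AE_I2, rule impI)
      fix x assume "x \<notin> N"
      then have "(\<lambda>n. radial_truncation c (g n x)) \<longlonglongrightarrow> radial_truncation c (H x)"
        using continuous_on_tendsto_compose[OF radial_truncation(4)[OF c(1), of UNIV] g(2)] by simp
      then show "(\<lambda>n. indicator K x * norm (H x - radial_truncation c (g n x)) powr p)
        \<longlonglongrightarrow> indicator K x * norm (H x - radial_truncation c (H x)) powr p"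
        using p by (intro tendsto_intros tendsto_powr') auto
    qed
    show "AE x in lebesgue. norm (indicator K x * norm (H x - radial_truncation c (g n x)) powr p) \<le> w x" for n
      using le_w by (simp add: abs_mult)
  qed measurable
  \<comment> \<open>\<open>H\<close> and its truncation vanish off \<open>K\<close>, so this limit
    is exactly the truncation error already known to be below \<open>e\<close>.\<close>
  moreover have "(\<lambda>x. indicator K x * norm (H x - radial_truncation c (H x)) powr p)
      = (\<lambda>x. norm (H x - radial_truncation c (H x)) powr p)"
    by (auto simp: H_def indicator_def radial_truncation_def)
  ultimately have "\<forall>\<^sub>F n in sequentially.
      (LINT x|lebesgue. indicator K x * norm (H x - radial_truncation c (g n x)) powr p) < e"
    using c(2) by (auto dest: order_tendstoD(2))
  then obtain n where n: "(LINT x|lebesgue. indicator K x * norm (H x - radial_truncation c (g n x)) powr p) < e"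
    by (auto simp: eventually_sequentially)
  have eq: "(\<lambda>x. indicator K x *\<^sub>R norm (G x - radial_truncation c (g n x)) powr p) =
      (\<lambda>x. indicator K x * norm (H x - radial_truncation c (g n x)) powr p)"
    by (auto simp: HG indicator_def)
  show ?thesis
  proof (intro exI conjI)
    show "continuous_on UNIV (\<lambda>x. radial_truncation c (g n x))"
      by (rule continuous_on_compose2[OF radial_truncation(4)[OF c(1), of UNIV] g(1)]) auto
    show "set_integrable lebesgue K (\<lambda>x. norm (G x - radial_truncation c (g n x)) powr p)"
      unfolding set_integrable_def eq
      by (rule Bochner_Integration.integrable_bound[OF w]) (use le_w in \<open>auto intro!: AE_I2 intro: order_trans[OF le_w]\<close>)
    show "(LINT x:K|lebesgue. norm (G x - radial_truncation c (g n x)) powr p) < e"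
      unfolding set_lebesgue_integral_def eq by (rule n)
  qed
qed

section \<open>Averaging against a mollifier\<close>

lemma nn_integral_translation:
  fixes f :: "'a::euclidean_space \<Rightarrow> ennreal"
  assumes "f \<in> borel_measurable borel"
  shows "(\<integral>\<^sup>+x. f (x - c) \<partial>lborel) = (\<integral>\<^sup>+x. f x \<partial>lborel)"
proof -
  have "(\<integral>\<^sup>+x. f x \<partial>lborel) = (\<integral>\<^sup>+x. f x \<partial>distr lborel borel ((+) (- c)))"
    by (simp add: lborel_distr_plus)
  also have "\<dots> = (\<integral>\<^sup>+x. f (- c + x) \<partial>lborel)"
    using assms by (intro nn_integral_distr) auto
  finally show ?thesis by simp
qed

text \<open>The kernel has mass one in each variable separately, so after a pointwise Young
  inequality under the double integral each term loses one of its two integrations. This replaces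
  the L^p bound for convolutions.\<close>

lemma nn_integral_mollified_pairing:
  fixes \<rho> E W :: "'a::euclidean_space \<Rightarrow> real"
  assumes \<rho>: "continuous_on UNIV \<rho>" "\<And>x. 0 \<le> \<rho> x" "\<And>x. \<rho> (- x) = \<rho> x" "(\<integral>\<^sup>+x. \<rho> x \<partial>lborel) = 1"
    and E: "E \<in> borel_measurable lebesgue" "\<And>x. 0 \<le> E x"
    and W: "W \<in> borel_measurable lebesgue" "\<And>x. 0 \<le> W x"
    and p: "1 < p" and l: "0 < l"
  shows "(\<integral>\<^sup>+x. ennreal (E x powr (p - 1)) * (\<integral>\<^sup>+y. ennreal (\<rho> (x - y) * W y) \<partial>lebesgue) \<partial>lebesgue)
    \<le> ennreal l * (\<integral>\<^sup>+x. ennreal (E x powr p) \<partial>lebesgue)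
      + ennreal (l powr (1 - p)) * (\<integral>\<^sup>+x. ennreal (W x powr p) \<partial>lebesgue)"
proof -
  have [measurable]: "\<rho> \<in> borel_measurable borel"
    using \<rho>(1) by (rule borel_measurable_continuous_onI)
  \<comment> \<open>Exchanging the integrals requires Borel functions; the Lebesgue measurable data
    are replaced by Borel representatives, with absolute values to keep them nonnegative
    everywhere.\<close>
  obtain E' where E'[measurable]: "E' \<in> borel_measurable lborel" and EE: "AE x in lborel. E x = E' x"
    using completion_ex_borel_measurable_real[OF E(1)] by auto
  obtain W' where W'[measurable]: "W' \<in> borel_measurable lborel" and WW: "AE x in lborel. W x = W' x"
    using completion_ex_borel_measurable_real[OF W(1)] by auto
  define A where "A x = \<bar>E' x\<bar>" for x
  define B where "B x = \<bar>W' x\<bar>" for x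
  have [measurable]: "A \<in> borel_measurable borel" "B \<in> borel_measurable borel"
    using E' W' unfolding A_def B_def by simp_all
  have EA: "AE x in lebesgue. E x = A x"
    using AE_completion[OF EE] by eventually_elim (metis A_def E(2) abs_of_nonneg)
  have WB: "AE x in lebesgue. W x = B x"
    using AE_completion[OF WW] by eventually_elim (metis B_def W(2) abs_of_nonneg)
  have inner: "(\<integral>\<^sup>+y. ennreal (\<rho> (x - y) * W y) \<partial>lebesgue) = (\<integral>\<^sup>+y. ennreal (\<rho> (x - y) * B y) \<partial>lborel)" for x
  proof -
    have "(\<integral>\<^sup>+y. ennreal (\<rho> (x - y) * W y) \<partial>lebesgue) = (\<integral>\<^sup>+y. ennreal (\<rho> (x - y) * B y) \<partial>lebesgue)"
      by (rule nn_integral_cong_AE) (use WB in eventually_elim, simp)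
    then show ?thesis by (simp add: nn_integral_completion)
  qed
  have one: "(\<integral>\<^sup>+x. \<rho> (x - y) \<partial>lborel) = 1" for y
    using nn_integral_translation[of "\<lambda>x. ennreal (\<rho> x)" y] \<rho>(4) by simp
  have one': "(\<integral>\<^sup>+y. \<rho> (x - y) \<partial>lborel) = 1" for x
    using one[of x] \<rho>(3) by (metis (no_types, lifting) minus_diff_eq nn_integral_cong)
  have AE': "(\<integral>\<^sup>+x. ennreal (A x powr p) \<partial>lborel) = (\<integral>\<^sup>+x. ennreal (E x powr p) \<partial>lebesgue)"
  proof -
    have "(\<integral>\<^sup>+x. ennreal (E x powr p) \<partial>lebesgue) = (\<integral>\<^sup>+x. ennreal (A x powr p) \<partial>lebesgue)"
      by (rule nn_integral_cong_AE) (use EA in eventually_elim, simp)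
    then show ?thesis by (simp add: nn_integral_completion)
  qed
  have BW': "(\<integral>\<^sup>+x. ennreal (B x powr p) \<partial>lborel) = (\<integral>\<^sup>+x. ennreal (W x powr p) \<partial>lebesgue)"
  proof -
    have "(\<integral>\<^sup>+x. ennreal (W x powr p) \<partial>lebesgue) = (\<integral>\<^sup>+x. ennreal (B x powr p) \<partial>lebesgue)"
      by (rule nn_integral_cong_AE) (use WB in eventually_elim, simp)
    then show ?thesis by (simp add: nn_integral_completion)
  qed
  have pt: "ennreal (A x powr (p - 1)) * ennreal (\<rho> (x - y) * B y) \<le>
      ennreal l * ennreal (A x powr p) * ennreal (\<rho> (x - y))
        + ennreal (l powr (1 - p)) * (ennreal (B y powr p) * ennreal (\<rho> (x - y)))" for x y
  proof -
    have "A x powr (p - 1) * B y \<le> l * A x powr p + l powr (1 - p) * B y powr p"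
      using l p by (intro powr_mult_le_weighted) (auto simp: A_def B_def)
    then have "\<rho> (x - y) * (A x powr (p - 1) * B y) \<le> \<rho> (x - y) * (l * A x powr p + l powr (1 - p) * B y powr p)"
      using \<rho>(2) by (rule mult_left_mono)
    then have "A x powr (p - 1) * (\<rho> (x - y) * B y) \<le> l * A x powr p * \<rho> (x - y) + l powr (1 - p) * (B y powr p * \<rho> (x - y))"
      by (simp add: algebra_simps)
    then show ?thesis
      using \<rho>(2) l by (simp add: ennreal_mult[symmetric] ennreal_plus[symmetric] B_def del: ennreal_plus)
  qed
  have "(\<integral>\<^sup>+x. ennreal (E x powr (p - 1)) * (\<integral>\<^sup>+y. ennreal (\<rho> (x - y) * W y) \<partial>lebesgue) \<partial>lebesgue)
     = (\<integral>\<^sup>+x. ennreal (A x powr (p - 1)) * (\<integral>\<^sup>+y. ennreal (\<rho> (x - y) * B y) \<partial>lborel) \<partial>lebesgue)"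
    unfolding inner by (rule nn_integral_cong_AE) (use EA in eventually_elim, simp)
  also have "\<dots> = (\<integral>\<^sup>+x. ennreal (A x powr (p - 1)) * (\<integral>\<^sup>+y. ennreal (\<rho> (x - y) * B y) \<partial>lborel) \<partial>lborel)"
    by (simp add: nn_integral_completion)
  also have "\<dots> = (\<integral>\<^sup>+x. \<integral>\<^sup>+y. ennreal (A x powr (p - 1)) * ennreal (\<rho> (x - y) * B y) \<partial>lborel \<partial>lborel)"
    by (simp add: nn_integral_cmult)
  also have "\<dots> \<le> (\<integral>\<^sup>+x. \<integral>\<^sup>+y. ennreal l * ennreal (A x powr p) * ennreal (\<rho> (x - y))
        + ennreal (l powr (1 - p)) * (ennreal (B y powr p) * ennreal (\<rho> (x - y))) \<partial>lborel \<partial>lborel)"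
    by (intro nn_integral_mono pt)
  also have "\<dots> = (\<integral>\<^sup>+x. ennreal l * ennreal (A x powr p)
      + ennreal (l powr (1 - p)) * (\<integral>\<^sup>+y. ennreal (B y powr p) * ennreal (\<rho> (x - y)) \<partial>lborel) \<partial>lborel)"
    by (simp add: nn_integral_add nn_integral_cmult one')
  also have "\<dots> = ennreal l * (\<integral>\<^sup>+x. ennreal (A x powr p) \<partial>lborel)
      + ennreal (l powr (1 - p)) * (\<integral>\<^sup>+x. \<integral>\<^sup>+y. ennreal (B y powr p) * ennreal (\<rho> (x - y)) \<partial>lborel \<partial>lborel)"
    by (simp add: nn_integral_add nn_integral_cmult)
  also have "(\<integral>\<^sup>+x. \<integral>\<^sup>+y. ennreal (B y powr p) * ennreal (\<rho> (x - y)) \<partial>lborel \<partial>lborel)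
      = (\<integral>\<^sup>+y. \<integral>\<^sup>+x. ennreal (B y powr p) * ennreal (\<rho> (x - y)) \<partial>lborel \<partial>lborel)"
    by (rule lborel_pair.Fubini') measurable
  also have "\<dots> = (\<integral>\<^sup>+y. ennreal (B y powr p) \<partial>lborel)"
    by (simp add: nn_integral_cmult one)
  finally show ?thesis unfolding AE' BW' .
qed

lemma DERIV_max0_square: "((\<lambda>t. (max 0 t)\<^sup>2) has_field_derivative 2 * max 0 t) (at (t::real))"
proof -
  consider "t < 0" | "t = 0" | "t > 0" by linarith
  then show ?thesis
  proof cases
    case 1
    then have "((\<lambda>_. 0) has_field_derivative 2 * max 0 t) (at t)" by simp
    then show ?thesis
      by (rule has_field_derivative_transform_within_open[of _ _ _ "{..<0}"]) (use 1 in auto)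
  next
    case 2
    have "((\<lambda>h. (max 0 h)\<^sup>2 / h) \<longlongrightarrow> 0) (at (0::real))"
    proof (rule Lim_null_comparison[of _ "\<lambda>h. \<bar>h\<bar>"])
      show "\<forall>\<^sub>F h in at 0. norm ((max 0 h)\<^sup>2 / h) \<le> \<bar>h::real\<bar>"
        by (rule always_eventually) (auto simp: max_def power2_eq_square)
    qed (auto intro!: tendsto_eq_intros)
    then show ?thesis using 2 by (simp add: DERIV_def)
  next
    case 3
    then have "((\<lambda>t. t\<^sup>2) has_field_derivative 2 * max 0 t) (at t)"
      by (auto intro!: derivative_eq_intros)
    then show ?thesis
      by (rule has_field_derivative_transform_within_open[of _ _ _ "{0<..}"]) (use 3 in auto)
  qed
qed

lemma has_derivative_max0_square:
  assumes "(u has_derivative (\<lambda>h. q \<bullet> h)) (at x)"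
  shows "((\<lambda>x. (max 0 (u x))\<^sup>2) has_derivative (\<lambda>h. ((2 * max 0 (u x)) *\<^sub>R q) \<bullet> h)) (at x)"
  using has_derivative_compose[OF assms DERIV_max0_square[unfolded has_field_derivative_def]]
  by simp

text \<open>The kernel is the normalised square of the positive part of
  \<open>k\<^sup>2 - x \<bullet> x\<close>. It is only C^1, which is the regularity asked of a test
  function.\<close>

lemma mollifier_exists:
  fixes k :: real
  assumes "0 < k"
  shows "\<exists>(\<rho> :: 'a::euclidean_space \<Rightarrow> real) \<rho>'. (\<forall>x. 0 \<le> \<rho> x) \<and> (\<forall>x. \<rho> (- x) = \<rho> x) \<and>
    (\<forall>x. k \<le> norm x \<longrightarrow> \<rho> x = 0) \<and> (\<forall>x. (\<rho> has_derivative (\<lambda>h. \<rho>' x \<bullet> h)) (at x)) \<and>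
    continuous_on UNIV \<rho> \<and> continuous_on UNIV \<rho>' \<and> (\<integral>\<^sup>+x. \<rho> x \<partial>lborel) = 1"
proof -
  define r :: "'a \<Rightarrow> real" where "r x = (max 0 (k\<^sup>2 - x \<bullet> x))\<^sup>2" for x
  define r' :: "'a \<Rightarrow> 'a" where "r' x = (2 * max 0 (k\<^sup>2 - x \<bullet> x)) *\<^sub>R ((-2) *\<^sub>R x)" for x
  have r': "(r has_derivative (\<lambda>h. r' x \<bullet> h)) (at x)" for x
    unfolding r_def r'_def
    by (rule has_derivative_max0_square) (auto intro!: derivative_eq_intros simp: inner_commute)
  have cr: "continuous_on UNIV r" unfolding r_def by (intro continuous_intros)
  have cr': "continuous_on UNIV r'" unfolding r'_def by (intro continuous_intros)
  have r0: "r x = 0" if "k \<le> norm x" for x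
    using power_mono[OF that, of 2] assms by (simp add: r_def power2_norm_eq_inner)
  have int: "integrable lborel r"
    by (rule integrable_continuous_compact_support(1)[OF cr compact_cball[of 0 k]]) (use r0 in auto)
  define Z where "Z = (LINT x|lborel. r x)"
  have "Z > 0"
  proof -
    have "Z \<noteq> 0"
    proof
      assume "Z = 0"
      then have "AE x in lborel. r x = 0"
        using integral_nonneg_eq_0_iff_AE[OF int] unfolding Z_def by (auto simp: r_def[abs_def])
      moreover have "{x. r x \<noteq> 0} \<in> sets borel"
        using borel_measurable_continuous_onI[OF cr] by measurable
      ultimately have "emeasure lborel {x. r x \<noteq> 0} = 0"
        by (simp add: AE_iff_measurable[OF _ refl])
      moreover have "ball 0 k \<subseteq> {x. r x \<noteq> 0}"
        using assms by (auto simp: r_def power2_norm_eq_inner[symmetric] abs_square_less_1 max_def power_strict_mono)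
      ultimately have "emeasure lborel (ball (0::'a) k) = 0"
        using \<open>{x. r x \<noteq> 0} \<in> sets borel\<close> by (metis emeasure_mono le_zero_eq sets_lborel)
      moreover have "emeasure lborel (ball (0::'a) k) > 0"
        using open_not_negligible[of "ball (0::'a) k"] assms
        by (auto simp: negligible_iff_null_sets null_sets_def zero_less_iff_neq_zero)
      ultimately show False by simp
    qed
    then show ?thesis using integral_nonneg_AE[of r lborel] by (simp add: Z_def r_def less_le)
  qed
  show ?thesis
  proof (intro exI conjI allI impI)
    show "0 \<le> r x / Z" "r (- x) / Z = r x / Z" for x using \<open>Z > 0\<close> by (simp_all add: r_def)
    show "r x / Z = 0" if "k \<le> norm x" for x using r0 that by simp
    show "((\<lambda>x. r x / Z) has_derivative (\<lambda>h. (r' x /\<^sub>R Z) \<bullet> h)) (at x)" for x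
      using \<open>Z > 0\<close> by (auto intro!: derivative_eq_intros r' simp: fun_eq_iff divide_inverse)
    show "continuous_on UNIV (\<lambda>x. r x / Z)" "continuous_on UNIV (\<lambda>x. r' x /\<^sub>R Z)"
      using \<open>Z > 0\<close> by (auto intro!: continuous_intros cr cr')
    have "(\<integral>\<^sup>+x. ennreal (r x / Z) \<partial>lborel) = ennreal (LINT x|lborel. r x / Z)"
      using \<open>Z > 0\<close> int by (intro nn_integral_eq_integral) (simp_all, simp add: r_def)
    moreover have "(LINT x|lborel. r x / Z) = 1" using \<open>Z > 0\<close> by (simp add: Z_def)
    ultimately show "(\<integral>\<^sup>+x. ennreal (r x / Z) \<partial>lborel) = 1" by simp
  qed
qed

text \<open>All derivatives fall on the kernel, so continuity of \<open>h\<close> suffices. A fixed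
  box as domain of integration keeps the parameter integral compact.\<close>

lemma leibniz_rule_mollifier:
  fixes h \<rho> :: "'a::euclidean_space \<Rightarrow> real"
  assumes h: "continuous_on (cbox a b) h" and \<rho>: "\<And>x. (\<rho> has_derivative (\<lambda>v. \<rho>' x \<bullet> v)) (at x)"
    and \<rho>': "continuous_on UNIV \<rho>'"
  defines "q \<equiv> \<lambda>x. integral (cbox a b) (\<lambda>y. h y *\<^sub>R \<rho>' (x - y))"
  shows "((\<lambda>x. integral (cbox a b) (\<lambda>y. h y * \<rho> (x - y))) has_derivative (\<lambda>v. q x \<bullet> v)) (at x)"
    and "continuous_on UNIV q"
proof -
  have c\<rho>: "continuous_on UNIV \<rho>"
    by (rule has_derivative_imp_continuous_on[OF \<rho>])
  have cont: "continuous_on (UNIV \<times> cbox a b) (\<lambda>(x, y). h y *\<^sub>R \<rho>' (x - y))"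
    by (auto simp: case_prod_beta intro!: continuous_intros continuous_on_compose2[OF h] continuous_on_compose2[OF \<rho>'])
  show "continuous_on UNIV q"
    unfolding q_def by (rule integral_continuous_on_param[OF cont])
  have d: "((\<lambda>x. integral (cbox a b) (\<lambda>y. h y * \<rho> (x - y))) has_derivative
      integral (cbox a b) (\<lambda>y. blinfun_inner_right (h y *\<^sub>R \<rho>' (x - y)))) (at x within UNIV)"
  proof (rule leibniz_rule[where fx = "\<lambda>x y. blinfun_inner_right (h y *\<^sub>R \<rho>' (x - y))"])
    show "((\<lambda>x. h y * \<rho> (x - y)) has_derivative blinfun_inner_right (h y *\<^sub>R \<rho>' (x - y))) (at x within UNIV)" for x y
    proof -
      have "((\<lambda>x. \<rho> (x - y)) has_derivative (\<lambda>v. \<rho>' (x - y) \<bullet> v)) (at x)"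
        by (rule has_derivative_compose[of "\<lambda>x. x - y" "\<lambda>v. v", OF _ \<rho>]) (auto intro!: derivative_eq_intros)
      moreover have "blinfun_apply (blinfun_inner_right (h y *\<^sub>R \<rho>' (x - y))) = (\<lambda>v. h y * (\<rho>' (x - y) \<bullet> v))"
        by (simp add: fun_eq_iff)
      ultimately show ?thesis using has_derivative_mult_right by (simp only:)
    qed
    show "(\<lambda>y. h y * \<rho> (x - y)) integrable_on cbox a b" for x
      by (intro integrable_continuous continuous_intros h continuous_on_compose2[OF c\<rho>]) auto
    show "continuous_on (UNIV \<times> cbox a b) (\<lambda>(x, y). blinfun_inner_right (h y *\<^sub>R \<rho>' (x - y)))"
      using cont unfolding case_prod_beta
      by (rule bounded_linear.continuous_on[OF bounded_linear_blinfun_inner_right])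
  qed auto
  have i: "(\<lambda>y. h y *\<^sub>R \<rho>' (x - y)) integrable_on cbox a b"
    by (intro integrable_continuous continuous_intros h continuous_on_compose2[OF \<rho>']) auto
  have "integral (cbox a b) (\<lambda>y. blinfun_inner_right (h y *\<^sub>R \<rho>' (x - y))) = blinfun_inner_right (q x)"
    using integral_linear[OF i bounded_linear_blinfun_inner_right] by (simp add: q_def o_def)
  with d show "((\<lambda>x. integral (cbox a b) (\<lambda>y. h y * \<rho> (x - y))) has_derivative (\<lambda>v. q x \<bullet> v)) (at x)"
    by simp
qed

lemma set_integrable_continuous_compact:
  fixes f :: "'a::euclidean_space \<Rightarrow> 'b::euclidean_space"
  assumes "continuous_on K f" "compact K"
  shows "set_integrable lebesgue K f"
proof -
  have "integrable lborel (\<lambda>x. indicator K x *\<^sub>R f x)"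
    using assms by (intro borel_integrable_compact)
  then show ?thesis
    unfolding set_integrable_def by (simp add: integrable_completion borel_measurable_integrable)
qed

text \<open>The reflected kernel \<open>\<lambda>y. \<rho> (x - y)\<close> is itself a test function
  as soon as the ball around \<open>x\<close> lies in the box. Its gradient in \<open>y\<close> is
  \<open>- \<rho>' (x - y)\<close>, and this sign cancels the one in the definition of a weak
  gradient.\<close>

lemma weak_gradient_mollified:
  fixes h \<rho> :: "'a::euclidean_space \<Rightarrow> real"
  assumes wg: "weak_gradient U h G" and h: "continuous_on (cbox a b) h" and box: "cbox a b \<subseteq> U"
    and \<rho>: "\<And>x. (\<rho> has_derivative (\<lambda>v. \<rho>' x \<bullet> v)) (at x)" "continuous_on UNIV \<rho>'"
      "\<And>x. k \<le> norm x \<Longrightarrow> \<rho> x = 0"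
    and x: "cball x k \<subseteq> cbox a b"
  shows "integral (cbox a b) (\<lambda>y. h y *\<^sub>R \<rho>' (x - y)) = (LINT y|lebesgue. \<rho> (x - y) *\<^sub>R (indicator (cbox a b) y *\<^sub>R G y))"
proof -
  have sub: "closure {y. \<rho> (x - y) \<noteq> 0} \<subseteq> cball x k"
    using \<rho>(3) by (intro closure_minimal) (auto simp: dist_norm, force)
  have off: "\<rho> (x - y) = 0 \<and> \<rho>' (x - y) = 0" if "y \<notin> cbox a b" for y
  proof -
    have "y \<notin> cball x k" using x that by auto
    then have "k < norm (x - y)" by (simp add: dist_norm)
    then show ?thesis
      using \<rho>(3) gradient_vanishes_off_support[OF \<rho>(1) closed_cball[of 0 k], of "x - y"] by auto
  qed
  have "test_fun U (\<lambda>y. \<rho> (x - y)) (\<lambda>y. - \<rho>' (x - y))"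
    unfolding test_fun_def
  proof (intro conjI allI)
    show "((\<lambda>y. \<rho> (x - y)) has_derivative (\<lambda>h. - \<rho>' (x - y) \<bullet> h)) (at y)" for y
    proof -
      have "((\<lambda>y. x - y) has_derivative (\<lambda>h. - h)) (at y)" by (auto intro!: derivative_eq_intros)
      from has_derivative_compose[OF this \<rho>(1)] show ?thesis by simp
    qed
    show "continuous_on UNIV (\<lambda>y. - \<rho>' (x - y))"
      by (intro continuous_intros continuous_on_compose2[OF \<rho>(2)]) auto
    show "compact (closure {y. \<rho> (x - y) \<noteq> 0})"
      using sub bounded_subset[OF bounded_cball] by (auto simp: compact_eq_bounded_closed)
    show "closure {y. \<rho> (x - y) \<noteq> 0} \<subseteq> U" using sub x box by blast
  qed
  then have eq: "(LINT y:U|lebesgue. h y *\<^sub>R - \<rho>' (x - y)) = - (LINT y:U|lebesgue. \<rho> (x - y) *\<^sub>R G y)"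
    using wg unfolding weak_gradient_def by blast
  have "(LINT y:U|lebesgue. h y *\<^sub>R - \<rho>' (x - y)) = (LINT y:cbox a b|lebesgue. h y *\<^sub>R - \<rho>' (x - y))"
    unfolding set_lebesgue_integral_def
    by (rule Bochner_Integration.integral_cong) (use off box in \<open>auto simp: indicator_def\<close>)
  also have "\<dots> = integral (cbox a b) (\<lambda>y. h y *\<^sub>R - \<rho>' (x - y))"
  proof (rule set_lebesgue_integral_eq_integral)
    have "continuous_on (cbox a b) (\<lambda>y. h y *\<^sub>R - \<rho>' (x - y))"
      by (intro continuous_intros h continuous_on_compose2[OF \<rho>(2)]) auto
    then show "set_integrable lebesgue (cbox a b) (\<lambda>y. h y *\<^sub>R - \<rho>' (x - y))"
      by (rule set_integrable_continuous_compact[OF _ compact_cbox])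
  qed
  also have "\<dots> = - integral (cbox a b) (\<lambda>y. h y *\<^sub>R \<rho>' (x - y))"
    by (simp add: scaleR_minus_right)
  finally have "integral (cbox a b) (\<lambda>y. h y *\<^sub>R \<rho>' (x - y)) = (LINT y:U|lebesgue. \<rho> (x - y) *\<^sub>R G y)"
    using eq by simp
  also have "\<dots> = (LINT y|lebesgue. \<rho> (x - y) *\<^sub>R (indicator (cbox a b) y *\<^sub>R G y))"
    unfolding set_lebesgue_integral_def
    by (rule Bochner_Integration.integral_cong) (use off box in \<open>auto simp: indicator_def\<close>)
  finally show ?thesis .
qed

lemma mollifier_translate:
  fixes \<rho> :: "'a::euclidean_space \<Rightarrow> real"
  assumes "continuous_on UNIV \<rho>" "\<And>x. 0 \<le> \<rho> x" "\<And>x. \<rho> (- x) = \<rho> x" "(\<integral>\<^sup>+x. \<rho> x \<partial>lborel) = 1"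
  shows "integrable lebesgue (\<lambda>y. \<rho> (x - y))" "(LINT y|lebesgue. \<rho> (x - y)) = 1"
proof -
  have m: "\<rho> \<in> borel_measurable borel"
    using assms(1) by (rule borel_measurable_continuous_onI)
  have m': "(\<lambda>y. \<rho> (x - y)) \<in> borel_measurable lborel" using m by simp
  have "(\<integral>\<^sup>+y. \<rho> (x - y) \<partial>lborel) = (\<integral>\<^sup>+y. \<rho> (y - x) \<partial>lborel)"
    using assms(3) by (metis (no_types, lifting) minus_diff_eq)
  also have "\<dots> = 1" using nn_integral_translation[of "\<lambda>y. ennreal (\<rho> y)" x] m assms(4) by simp
  finally have n: "(\<integral>\<^sup>+y. \<rho> (x - y) \<partial>lborel) = 1" .
  then have "integrable lborel (\<lambda>y. \<rho> (x - y))"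
    using assms(2) m' by (intro integrableI_nonneg) auto
  then show "integrable lebesgue (\<lambda>y. \<rho> (x - y))"
    using m' by (simp add: integrable_completion)
  have "(LINT y|lborel. \<rho> (x - y)) = 1"
    using n assms(2) m' by (simp add: integral_eq_nn_integral)
  then show "(LINT y|lebesgue. \<rho> (x - y)) = 1" using m' by (simp add: integral_completion)
qed

text \<open>On the set \<open>B\<close> of finite measure, \<open>norm (f x)\<close> is at most
  \<open>1 + norm (f x) powr p\<close>.\<close>

lemma integrable_of_powr_integrable:
  fixes f :: "'a \<Rightarrow> 'b::{banach, second_countable_topology}"
  assumes "f \<in> borel_measurable M" "integrable M (\<lambda>x. norm (f x) powr p)" "1 \<le> p"
    "\<And>x. x \<notin> B \<Longrightarrow> f x = 0" "B \<in> sets M" "emeasure M B < \<infinity>"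
  shows "integrable M f"
proof (rule Bochner_Integration.integrable_bound)
  show "integrable M (\<lambda>x. indicat_real B x + norm (f x) powr p)"
    using assms by (intro Bochner_Integration.integrable_add integrable_real_indicator)
  show "AE x in M. norm (f x) \<le> norm (indicat_real B x + norm (f x) powr p)"
  proof (rule AE_I2)
    fix x
    have "norm (f x) \<le> norm (f x) powr p" if "1 \<le> norm (f x)"
      using powr_mono[OF assms(3) that] that by simp
    then show "norm (f x) \<le> norm (indicat_real B x + norm (f x) powr p)"
      using assms(4)[of x] powr_ge_zero[of "norm (f x)" p]
      by (cases "x \<in> B"; cases "1 \<le> norm (f x)") (auto simp del: powr_ge_zero)
  qed
qed (use assms in simp)

text \<open>Averaging the continuous part \<open>g\<close> costs only its oscillation
  \<open>c\<close>; the remainder \<open>W\<close> is charged once under the average and once at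
  \<open>x\<close>. The bound lives in \<open>ennreal\<close> so that it can be integrated in
  \<open>x\<close> before integrability of the averaged remainder is known.\<close>

lemma mollified_error_bound:
  fixes \<rho> :: "'a::euclidean_space \<Rightarrow> real" and H W g :: "'a \<Rightarrow> 'b::euclidean_space"
  assumes \<rho>: "continuous_on UNIV \<rho>" "\<And>x. 0 \<le> \<rho> x" "\<And>x. \<rho> (- x) = \<rho> x" "(\<integral>\<^sup>+x. \<rho> x \<partial>lborel) = 1"
    and H: "integrable lebesgue H" and W: "integrable lebesgue W"
    and dec: "\<And>y. \<rho> (x - y) \<noteq> 0 \<Longrightarrow> H y = g y + W y" "\<And>y. \<rho> (x - y) \<noteq> 0 \<Longrightarrow> norm (g y - g x) \<le> c"
      "H x = g x + W x"
    and b: "\<And>z. \<rho> z \<le> b" and c: "0 \<le> c"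
  shows "ennreal (norm ((LINT y|lebesgue. \<rho> (x - y) *\<^sub>R H y) - H x))
    \<le> (\<integral>\<^sup>+y. ennreal (\<rho> (x - y) * norm (W y)) \<partial>lebesgue) + ennreal c + ennreal (norm (W x))"
proof -
  have [measurable]: "H \<in> borel_measurable lebesgue" "W \<in> borel_measurable lebesgue"
    using H W by auto
  note \<rho>1 = mollifier_translate[OF \<rho>, of x]
  have [measurable]: "(\<lambda>y. \<rho> (x - y)) \<in> borel_measurable lebesgue"
    using \<rho>1 by auto
  have iH: "integrable lebesgue (\<lambda>y. \<rho> (x - y) *\<^sub>R H y)"
    by (rule Bochner_Integration.integrable_bound[of _ "\<lambda>y. b * norm (H y)"])
      (use H b \<rho>(2) in \<open>auto intro!: AE_I2 mult_mono simp: abs_mult intro: order_trans[OF b abs_ge_self]\<close>)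
  have iW: "integrable lebesgue (\<lambda>y. \<rho> (x - y) * norm (W y))"
    by (rule Bochner_Integration.integrable_bound[of _ "\<lambda>y. b * norm (W y)"])
      (use W b \<rho>(2) in \<open>auto intro!: AE_I2 mult_mono simp: abs_mult intro: order_trans[OF b abs_ge_self]\<close>)
  have ig: "integrable lebesgue (\<lambda>y. \<rho> (x - y) *\<^sub>R g x)" using \<rho>1(1) by simp
  have "(LINT y|lebesgue. \<rho> (x - y) *\<^sub>R H y) - g x = (LINT y|lebesgue. \<rho> (x - y) *\<^sub>R H y - \<rho> (x - y) *\<^sub>R g x)"
    using iH ig \<rho>1 by simp
  also have "norm \<dots> \<le> (LINT y|lebesgue. \<rho> (x - y) * norm (W y) + c * \<rho> (x - y))"
  proof (rule Bochner_Integration.integral_norm_bound_integral)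
    show "integrable lebesgue (\<lambda>y. \<rho> (x - y) *\<^sub>R H y - \<rho> (x - y) *\<^sub>R g x)"
      using iH ig by simp
    show "integrable lebesgue (\<lambda>y. \<rho> (x - y) * norm (W y) + c * \<rho> (x - y))"
      using iW \<rho>1 by simp
    show "norm (\<rho> (x - y) *\<^sub>R H y - \<rho> (x - y) *\<^sub>R g x) \<le> \<rho> (x - y) * norm (W y) + c * \<rho> (x - y)" for y
    proof (cases "\<rho> (x - y) = 0")
      case False
      have "norm (\<rho> (x - y) *\<^sub>R H y - \<rho> (x - y) *\<^sub>R g x) = \<rho> (x - y) * norm (W y + (g y - g x))"
        using dec(1)[OF False] \<rho>(2)[of "x - y"] by (simp add: scaleR_diff_right[symmetric]) (simp add: algebra_simps)
      also have "\<dots> \<le> \<rho> (x - y) * (norm (W y) + c)"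
        using dec(2)[OF False] \<rho>(2) norm_triangle_ineq[of "W y" "g y - g x"] by (intro mult_left_mono) auto
      finally show ?thesis by (simp add: algebra_simps)
    qed simp
  qed
  also have "\<dots> = (LINT y|lebesgue. \<rho> (x - y) * norm (W y)) + c"
    using iW \<rho>1 by simp
  finally have n: "norm ((LINT y|lebesgue. \<rho> (x - y) *\<^sub>R H y) - g x) \<le> (LINT y|lebesgue. \<rho> (x - y) * norm (W y)) + c" .
  have "(LINT y|lebesgue. \<rho> (x - y) *\<^sub>R H y) - H x = ((LINT y|lebesgue. \<rho> (x - y) *\<^sub>R H y) - g x) - W x"
    using dec(3) by simp
  also have "norm \<dots> \<le> (LINT y|lebesgue. \<rho> (x - y) * norm (W y)) + c + norm (W x)"
    using n norm_triangle_ineq4[of "(LINT y|lebesgue. \<rho> (x - y) *\<^sub>R H y) - g x" "W x"] by linarith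
  finally have "ennreal (norm ((LINT y|lebesgue. \<rho> (x - y) *\<^sub>R H y) - H x))
      \<le> ennreal ((LINT y|lebesgue. \<rho> (x - y) * norm (W y)) + c + norm (W x))"
    by (rule ennreal_leI)
  also have "\<dots> = ennreal (LINT y|lebesgue. \<rho> (x - y) * norm (W y)) + ennreal c + ennreal (norm (W x))"
    using c \<rho>(2) by (simp add: ennreal_plus integral_nonneg_AE)
  also have "ennreal (LINT y|lebesgue. \<rho> (x - y) * norm (W y)) = (\<integral>\<^sup>+y. ennreal (\<rho> (x - y) * norm (W y)) \<partial>lebesgue)"
    using iW \<rho>(2) by (intro nn_integral_eq_integral[symmetric]) auto
  finally show ?thesis .
qed

text \<open>The comparison argument needs smallness of the gradient error against the weight
  \<open>E x powr (p - 1)\<close>, the size of the flux, rather than convergence in L^p. This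
  weighted form follows from Young's inequality and mass one of the kernel.\<close>

lemma mollification:
  fixes U :: "'a::euclidean_space set"
  assumes p: "1 < p" and W: "W1p_loc p U h G" and h: "continuous_on U h"
    and box: "cbox a b \<subseteq> U" and K: "compact K" "K \<subseteq> box a b"
    and E: "set_borel_measurable lebesgue K E" "\<And>x. 0 \<le> E x" "set_integrable lebesgue K (\<lambda>x. E x powr p)"
    and e: "0 < e"
  shows "\<exists>h' q'. (\<forall>x. (h' has_derivative (\<lambda>v. q' x \<bullet> v)) (at x)) \<and> continuous_on UNIV q' \<and>
     (\<forall>x\<in>K. \<bar>h' x - h x\<bar> \<le> e) \<and>
     set_integrable lebesgue K (\<lambda>x. E x powr (p - 1) * norm (q' x - G x)) \<and>
     (LINT x:K|lebesgue. E x powr (p - 1) * norm (q' x - G x)) \<le> e"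
proof -
  let ?B = "cbox a b"
  have [measurable]: "K \<in> sets lebesgue" "?B \<in> sets lebesgue"
    using K by (auto intro: lmeasurable_compact fmeasurableD)
  have finK: "emeasure lebesgue K < \<infinity>" "emeasure lebesgue ?B < \<infinity>"
    using lmeasurable_compact[OF K(1)] lmeasurable_cbox[of a b] by (auto simp: fmeasurable_def)
  have hB: "continuous_on ?B h" using h box by (rule continuous_on_subset)
  have wg: "weak_gradient U h G" and LG: "loc_Lp p U G" using W by (auto simp: W1p_loc_def)
  define H where "H y = indicator ?B y *\<^sub>R G y" for y
  have H_meas[measurable]: "H \<in> borel_measurable lebesgue"
  proof -
    have "(\<lambda>y. indicator U y *\<^sub>R G y) \<in> borel_measurable lebesgue"
      using LG by (simp add: loc_Lp_def set_borel_measurable_def)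
    then have "(\<lambda>y. indicator ?B y *\<^sub>R (indicator U y *\<^sub>R G y)) \<in> borel_measurable lebesgue"
      by (rule borel_measurable_scaleR[rotated]) (rule borel_measurable_indicator, simp)
    also have "(\<lambda>y. indicator ?B y *\<^sub>R (indicator U y *\<^sub>R G y)) = H"
    proof
      show "indicator ?B y *\<^sub>R (indicator U y *\<^sub>R G y) = H y" for y
        using box by (cases "y \<in> ?B") (auto simp: H_def)
    qed
    finally show ?thesis .
  qed
  have GB: "set_integrable lebesgue ?B (\<lambda>x. norm (G x) powr p)"
    using LG box by (auto simp: loc_Lp_def)
  have H0: "H x = 0" if "x \<notin> ?B" for x using that by (simp add: H_def)
  have H_eq: "(\<lambda>x. norm (H x) powr p) = (\<lambda>x. indicator ?B x *\<^sub>R norm (G x) powr p)"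
    by (auto simp: H_def indicator_def)
  have "integrable lebesgue (\<lambda>x. norm (H x) powr p)"
    using GB unfolding H_eq set_integrable_def .
  from integrable_of_powr_integrable[OF H_meas this, of ?B] have H_int: "integrable lebesgue H"
    using p finK H0 by simp
  define EK where "EK x = indicator K x * E x" for x
  have [measurable]: "EK \<in> borel_measurable lebesgue"
    using E(1) by (simp add: set_borel_measurable_def EK_def[abs_def])
  have EK0: "0 \<le> EK x" for x using E(2) by (simp add: EK_def)
  have EKp: "integrable lebesgue (\<lambda>x. EK x powr p)"
  proof -
    have "(\<lambda>x. EK x powr p) = (\<lambda>x. indicator K x *\<^sub>R E x powr p)"
      by (auto simp: EK_def indicator_def)
    then show ?thesis using E(3) by (simp add: set_integrable_def)
  qed
  \<comment> \<open>Raised to the power \<open>p / (p - 1)\<close>, which is at least 1, this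
    function becomes the integrable \<open>EK x powr p\<close>.\<close>
  have EKp1: "integrable lebesgue (\<lambda>x. EK x powr (p - 1))"
  proof (rule integrable_of_powr_integrable[where p = "p / (p - 1)" and B = K])
    show "integrable lebesgue (\<lambda>x. norm (EK x powr (p - 1)) powr (p / (p - 1)))"
      using EKp p by (simp add: powr_powr)
    show "1 \<le> p / (p - 1)" using p by (simp add: field_simps)
    show "EK x powr (p - 1) = 0" if "x \<notin> K" for x using that by (simp add: EK_def)
  qed (use finK in simp_all)
  define I where "I = (LINT x|lebesgue. EK x powr p)"
  define J where "J = (LINT x|lebesgue. EK x powr (p - 1))"
  have IJ: "0 \<le> I" "0 \<le> J" by (auto simp: I_def J_def integral_nonneg_AE)
  \<comment> \<open>A third of \<open>e\<close> is spent on each kind of error. The term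
    \<open>l * I\<close> occurs twice, from the averaged and from the pointwise remainder, hence the
    6; the added 1 avoids division by zero. \<open>l\<close> is fixed before \<eta>, because
    \<open>l powr (1 - p)\<close> grows as \<open>l\<close> shrinks.\<close>
  define l where "l = e / (6 * (I + 1))"
  have l: "0 < l" "2 * l * I \<le> e / 3"
    using e IJ by (auto simp: l_def field_simps)
  define \<eta> where "\<eta> = e / (6 * l powr (1 - p))"
  have "0 < \<eta>" using e l by (simp add: \<eta>_def)
  have "set_borel_measurable lebesgue ?B G"
    using H_meas by (simp add: set_borel_measurable_def H_def[abs_def])
  then obtain g where g: "continuous_on UNIV g" "set_integrable lebesgue ?B (\<lambda>x. norm (G x - g x) powr p)"
      "(LINT x:?B|lebesgue. norm (G x - g x) powr p) < \<eta>"
    using Lp_continuous_approximation[OF _ lmeasurable_cbox GB _ \<open>0 < \<eta>\<close>] p by auto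
  define Wd where "Wd x = indicator ?B x *\<^sub>R (G x - g x)" for x
  have [measurable]: "g \<in> borel_measurable lebesgue"
    using g(1) by (intro measurable_completion) (simp add: borel_measurable_continuous_onI)
  have "Wd = (\<lambda>x. H x - indicator ?B x *\<^sub>R g x)"
    by (auto simp: Wd_def H_def algebra_simps)
  then have Wd_meas[measurable]: "Wd \<in> borel_measurable lebesgue" by simp
  have Wd_eq: "(\<lambda>x. norm (Wd x) powr p) = (\<lambda>x. indicator ?B x *\<^sub>R norm (G x - g x) powr p)"
    by (auto simp: Wd_def indicator_def)
  then have Wdp: "integrable lebesgue (\<lambda>x. norm (Wd x) powr p)" "(LINT x|lebesgue. norm (Wd x) powr p) < \<eta>"
    using g(2,3) by (simp_all add: set_integrable_def set_lebesgue_integral_def)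
  have Wd_int: "integrable lebesgue Wd"
    by (rule integrable_of_powr_integrable[OF Wd_meas Wdp(1), of ?B]) (use p finK in \<open>simp_all add: Wd_def\<close>)
  define c where "c = e / (3 * (J + 1))"
  have c: "0 < c" "c * J \<le> e / 3" using e IJ by (auto simp: c_def field_simps)
  obtain k0 where k0: "k0 > 0" "\<And>x. x \<in> K \<Longrightarrow> cball x k0 \<subseteq> box a b"
    using compact_subset_open_imp_cball_epsilon_subset[OF K(1) open_box K(2)] unfolding UN_subset_iff by metis
  have "uniformly_continuous_on ?B h"
    using hB by (intro compact_uniformly_continuous) auto
  then obtain k1 where k1: "k1 > 0" "\<And>x y. x \<in> ?B \<Longrightarrow> y \<in> ?B \<Longrightarrow> dist y x < k1 \<Longrightarrow> dist (h y) (h x) < e"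
    using e unfolding uniformly_continuous_on_def by metis
  have "uniformly_continuous_on ?B g"
    using g(1) by (intro compact_uniformly_continuous) (auto intro: continuous_on_subset)
  then obtain k2 where k2: "k2 > 0" "\<And>x y. x \<in> ?B \<Longrightarrow> y \<in> ?B \<Longrightarrow> dist y x < k2 \<Longrightarrow> dist (g y) (g x) < c"
    using c(1) unfolding uniformly_continuous_on_def by metis
  \<comment> \<open>The radius serves three purposes: balls around \<open>K\<close> stay in the box,
    \<open>h\<close> varies by less than \<open>e\<close>, and \<open>g\<close> by less than
    \<open>c\<close>.\<close>
  define k where "k = min k0 (min k1 k2)"
  have k: "k > 0" "k \<le> k0" "k \<le> k1" "k \<le> k2" using k0 k1 k2 by (auto simp: k_def)
  have ballk: "cball x k \<subseteq> ?B" if "x \<in> K" for x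
    using k0(2)[OF that] k(2) box_subset_cbox[of a b] subset_cball[of k k0 x] by blast
  obtain \<rho> :: "'a \<Rightarrow> real" and \<rho>' where \<rho>: "\<And>x. 0 \<le> \<rho> x" "\<And>x. \<rho> (- x) = \<rho> x"
      "\<And>x. k \<le> norm x \<Longrightarrow> \<rho> x = 0" "\<And>x. (\<rho> has_derivative (\<lambda>h. \<rho>' x \<bullet> h)) (at x)"
      "continuous_on UNIV \<rho>" "continuous_on UNIV \<rho>'" "(\<integral>\<^sup>+x. \<rho> x \<partial>lborel) = 1"
    using mollifier_exists[OF k(1)] by blast
  have near: "y \<in> ?B \<and> dist y x < k" if "x \<in> K" "\<rho> (x - y) \<noteq> 0" for x y
  proof -
    have "norm (x - y) < k" using \<rho>(3)[of "x - y"] that(2) by force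
    then have "dist y x < k" "y \<in> cball x k" by (simp_all add: dist_norm norm_minus_commute)
    then show ?thesis using ballk[OF that(1)] by blast
  qed
  have KB: "x \<in> ?B" if "x \<in> K" for x using that K(2) box_subset_cbox[of a b] by blast
  define h' where "h' x = integral ?B (\<lambda>y. h y * \<rho> (x - y))" for x
  define q' where "q' x = integral ?B (\<lambda>y. h y *\<^sub>R \<rho>' (x - y))" for x
  have d: "(h' has_derivative (\<lambda>v. q' x \<bullet> v)) (at x)" for x
    unfolding h'_def[abs_def] q'_def by (rule leibniz_rule_mollifier[OF hB \<rho>(4,6)])
  have cq: "continuous_on UNIV q'"
    unfolding q'_def[abs_def] by (rule leibniz_rule_mollifier[OF hB \<rho>(4,6)])
  have hh: "\<bar>h' x - h x\<bar> \<le> e" if x: "x \<in> K" for x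
  proof -
    note \<rho>1 = mollifier_translate[OF \<rho>(5,1,2,7), of x]
    have contB: "continuous_on ?B (\<lambda>y. h y * \<rho> (x - y))"
      by (intro continuous_intros hB continuous_on_compose2[OF \<rho>(5)]) auto
    have si: "set_integrable lebesgue ?B (\<lambda>y. h y * \<rho> (x - y))"
      by (rule set_integrable_continuous_compact[OF contB compact_cbox])
    have "h' x = (LINT y|lebesgue. indicator ?B y *\<^sub>R (h y * \<rho> (x - y)))"
      using set_lebesgue_integral_eq_integral(2)[OF si] by (simp add: h'_def set_lebesgue_integral_def)
    moreover have "h x = (LINT y|lebesgue. h x * \<rho> (x - y))" using \<rho>1 by simp
    ultimately have "h' x - h x = (LINT y|lebesgue. indicator ?B y *\<^sub>R (h y * \<rho> (x - y)) - h x * \<rho> (x - y))"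
      using si \<rho>1(1) by (simp add: set_integrable_def)
    also have "norm \<dots> \<le> (LINT y|lebesgue. e * \<rho> (x - y))"
    proof (rule Bochner_Integration.integral_norm_bound_integral)
      show "integrable lebesgue (\<lambda>y. indicator ?B y *\<^sub>R (h y * \<rho> (x - y)) - h x * \<rho> (x - y))"
        using si \<rho>1(1) unfolding set_integrable_def by (intro Bochner_Integration.integrable_diff) auto
      show "integrable lebesgue (\<lambda>y. e * \<rho> (x - y))" using \<rho>1(1) by simp
      show "norm (indicator ?B y *\<^sub>R (h y * \<rho> (x - y)) - h x * \<rho> (x - y)) \<le> e * \<rho> (x - y)" for y
      proof (cases "\<rho> (x - y) = 0")
        case False
        then have y: "y \<in> ?B" "dist y x < k1" using near[OF x False] k(3) by auto
        have "norm (indicator ?B y *\<^sub>R (h y * \<rho> (x - y)) - h x * \<rho> (x - y)) = \<bar>h y - h x\<bar> * \<rho> (x - y)"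
          using y \<rho>(1)[of "x - y"] by (simp add: abs_mult left_diff_distrib[symmetric])
        also have "\<dots> \<le> e * \<rho> (x - y)"
          using k1(2)[OF KB[OF x] y] \<rho>(1) by (intro mult_right_mono) (auto simp: dist_real_def)
        finally show ?thesis .
      qed simp
    qed
    also have "\<dots> = e" using \<rho>1 by simp
    finally show ?thesis by simp
  qed
  have [measurable]: "\<rho> \<in> borel_measurable borel" using \<rho>(5) by (rule borel_measurable_continuous_onI)
  have [measurable]: "q' \<in> borel_measurable lebesgue"
    using cq by (intro measurable_completion) (simp add: borel_measurable_continuous_onI)
  obtain bd where bd: "\<And>z. \<rho> z \<le> bd"
  proof -
    have "bounded (\<rho> ` cball 0 k)"
      using \<rho>(5) by (intro compact_imp_bounded compact_continuous_image) (auto intro: continuous_on_subset)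
    then obtain M where M: "\<And>z. z \<in> cball 0 k \<Longrightarrow> \<bar>\<rho> z\<bar> \<le> M"
      by (metis bounded_iff imageI real_norm_def)
    have "\<rho> z \<le> max M 0" for z
      using M[of z] \<rho>(3)[of z] by (cases "norm z \<le> k") auto
    then show ?thesis by (rule that)
  qed
  let ?T = "\<lambda>x. \<integral>\<^sup>+y. ennreal (\<rho> (x - y) * norm (Wd y)) \<partial>lebesgue"
  let ?Y = "\<lambda>x. ennreal l * ennreal (EK x powr p) + ennreal (l powr (1 - p)) * ennreal (norm (Wd x) powr p)"
  have pt: "ennreal (EK x powr (p - 1) * norm (q' x - G x))
      \<le> ennreal (EK x powr (p - 1)) * ?T x
        + ennreal c * ennreal (EK x powr (p - 1))
        + ?Y x" for x
  proof (cases "x \<in> K")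
    case False
    then show ?thesis by (simp add: EK_def)
  next
    case x: True
    have q: "q' x = (LINT y|lebesgue. \<rho> (x - y) *\<^sub>R H y)"
      unfolding q'_def H_def
      by (rule weak_gradient_mollified[OF wg hB box \<rho>(4,6,3) ballk[OF x]])
    have "ennreal (norm (q' x - H x)) \<le> ?T x
        + ennreal c + ennreal (norm (Wd x))"
      unfolding q
    proof (rule mollified_error_bound[OF \<rho>(5,1,2,7) H_int Wd_int, where g = g and b = bd])
      show "norm (g y - g x) \<le> c" if "\<rho> (x - y) \<noteq> 0" for y
        using near[OF x that] k(4) k2(2)[OF KB[OF x], of y] by (force simp: dist_norm)
    qed (use near[OF x] KB[OF x] bd c in \<open>auto simp: H_def Wd_def\<close>)
    then have "ennreal (EK x powr (p - 1)) * ennreal (norm (q' x - G x)) \<le> ennreal (EK x powr (p - 1)) *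
       (?T x + ennreal c + ennreal (norm (Wd x)))"
      using KB[OF x] by (intro mult_left_mono) (auto simp: H_def)
    also have "\<dots> = ennreal (EK x powr (p - 1)) * ?T x
        + ennreal c * ennreal (EK x powr (p - 1)) + ennreal (EK x powr (p - 1) * norm (Wd x))"
      by (simp add: distrib_left ennreal_mult mult.commute)
    also have "ennreal (EK x powr (p - 1) * norm (Wd x)) \<le> ennreal (l * EK x powr p + l powr (1 - p) * norm (Wd x) powr p)"
      using EK0 l p by (intro ennreal_leI powr_mult_le_weighted) auto
    also have "\<dots> = ?Y x"
      using l by (simp add: ennreal_mult ennreal_plus)
    finally show ?thesis by (simp add: ennreal_mult add_left_mono)
  qed
  have pair: "(\<integral>\<^sup>+x. ennreal (EK x powr (p - 1)) * ?T x \<partial>lebesgue)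
    \<le> ennreal l * (\<integral>\<^sup>+x. ennreal (EK x powr p) \<partial>lebesgue)
      + ennreal (l powr (1 - p)) * (\<integral>\<^sup>+x. ennreal (norm (Wd x) powr p) \<partial>lebesgue)"
    by (rule nn_integral_mollified_pairing[OF \<rho>(5,1,2,7) _ EK0 _ _ p l(1)]) auto
  have nI: "(\<integral>\<^sup>+x. ennreal (EK x powr p) \<partial>lebesgue) = ennreal I"
    using EKp unfolding I_def by (intro nn_integral_eq_integral) auto
  have nJ: "(\<integral>\<^sup>+x. ennreal (EK x powr (p - 1)) \<partial>lebesgue) = ennreal J"
    using EKp1 unfolding J_def by (intro nn_integral_eq_integral) auto
  define V where "V = (LINT x|lebesgue. norm (Wd x) powr p)"
  have nV: "(\<integral>\<^sup>+x. ennreal (norm (Wd x) powr p) \<partial>lebesgue) = ennreal V"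
    using Wdp unfolding V_def by (intro nn_integral_eq_integral) auto
  have V: "0 \<le> V" "2 * l powr (1 - p) * V \<le> e / 3"
  proof -
    show "0 \<le> V" by (auto simp: V_def integral_nonneg_AE)
    have "l powr (1 - p) * V \<le> l powr (1 - p) * \<eta>"
      using Wdp(2) by (intro mult_left_mono) (auto simp: V_def)
    then show "2 * l powr (1 - p) * V \<le> e / 3" using l by (simp add: \<eta>_def field_simps)
  qed
  \<comment> \<open>Exchanging \<open>Wd\<close> for a Borel representative changes the inner
    integral at no \<open>x\<close>, and then it is a Borel function of \<open>x\<close>.\<close>
  have inner_meas: "(\<lambda>x. \<integral>\<^sup>+y. ennreal (\<rho> (x - y) * norm (Wd y)) \<partial>lebesgue) \<in> borel_measurable lebesgue"
  proof -
    obtain W' where W'[measurable]: "W' \<in> borel_measurable lborel" and WW: "AE x in lborel. norm (Wd x) = W' x"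
      using completion_ex_borel_measurable_real[of "\<lambda>x. norm (Wd x)" lborel] by auto
    have "?T x = (\<integral>\<^sup>+y. ennreal (\<rho> (x - y) * W' y) \<partial>lborel)" for x
    proof -
      have "?T x = (\<integral>\<^sup>+y. ennreal (\<rho> (x - y) * W' y) \<partial>lebesgue)"
        by (rule nn_integral_cong_AE) (use AE_completion[OF WW] in eventually_elim, simp)
      then show ?thesis by (simp add: nn_integral_completion)
    qed
    moreover have "(\<lambda>x. \<integral>\<^sup>+y. ennreal (\<rho> (x - y) * W' y) \<partial>lborel) \<in> borel_measurable lborel"
      by measurable
    ultimately show ?thesis by (simp add: measurable_completion)
  qed
  have m: "(\<lambda>x. EK x powr (p - 1) * norm (q' x - G x)) \<in> borel_measurable lebesgue"
  proof -
    have "(\<lambda>x. EK x powr (p - 1) * norm (q' x - G x)) = (\<lambda>x. EK x powr (p - 1) * norm (q' x - H x))"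
      using KB by (auto simp: EK_def H_def indicator_def)
    then show ?thesis by simp
  qed
  note [measurable] = inner_meas
  have "(\<integral>\<^sup>+x. ennreal (EK x powr (p - 1) * norm (q' x - G x)) \<partial>lebesgue)
     \<le> (\<integral>\<^sup>+x. ennreal (EK x powr (p - 1)) * ?T x
        + ennreal c * ennreal (EK x powr (p - 1))
        + (?Y x) \<partial>lebesgue)"
    by (intro nn_integral_mono pt)
  also have "\<dots> = (\<integral>\<^sup>+x. ennreal (EK x powr (p - 1)) * ?T x \<partial>lebesgue)
      + ennreal c * ennreal J + (ennreal l * ennreal I + ennreal (l powr (1 - p)) * ennreal V)"
    by (simp add: nn_integral_add nn_integral_cmult nI nJ nV)
  also have "\<dots> \<le> (ennreal l * ennreal I + ennreal (l powr (1 - p)) * ennreal V)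
      + ennreal c * ennreal J + (ennreal l * ennreal I + ennreal (l powr (1 - p)) * ennreal V)"
    using pair unfolding nI nV by (intro add_right_mono)
  also have "\<dots> = ennreal (2 * l * I + c * J + 2 * l powr (1 - p) * V)"
    using l IJ V c by (simp add: ennreal_mult[symmetric] ennreal_plus[symmetric] del: ennreal_plus)
  also have "\<dots> \<le> ennreal e" using l c V by (intro ennreal_leI) linarith
  finally have fin: "(\<integral>\<^sup>+x. ennreal (EK x powr (p - 1) * norm (q' x - G x)) \<partial>lebesgue) \<le> ennreal e" .
  have eqK: "(\<lambda>x. EK x powr (p - 1) * norm (q' x - G x)) =
      (\<lambda>x. indicator K x *\<^sub>R (E x powr (p - 1) * norm (q' x - G x)))"
    by (auto simp: EK_def indicator_def)
  have i: "integrable lebesgue (\<lambda>x. EK x powr (p - 1) * norm (q' x - G x))"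
    by (rule integrableI_nonneg[OF m]) (use fin in \<open>auto intro: le_less_trans\<close>)
  have "ennreal (LINT x|lebesgue. EK x powr (p - 1) * norm (q' x - G x)) \<le> ennreal e"
    using fin nn_integral_eq_integral[OF i] by simp
  then have "(LINT x|lebesgue. EK x powr (p - 1) * norm (q' x - G x)) \<le> e"
    using e by (simp add: ennreal_le_iff)
  then show ?thesis
    using d cq hh i unfolding eqK set_integrable_def set_lebesgue_integral_def by blast
qed

subsection \<open>Comparison of weak and classical solutions\<close>

text \<open>The p-Laplacian in nondivergence form, divided by the power p - 2 of the gradient's
  length, for Hessian \<open>H\<close> and gradient direction \<open>n\<close>. As \<open>n\<close>
  is a free argument of any length, critical points and regularised directions shorter than 1 are
  covered.\<close>

definition normalized_p_laplacian :: "real \<Rightarrow> ('a::euclidean_space \<Rightarrow> 'a) \<Rightarrow> 'a \<Rightarrow> real" where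
  "normalized_p_laplacian p H n = (\<Sum>b\<in>Basis. H b \<bullet> b) + (p - 2) * (n \<bullet> H n)"

text \<open>By Cauchy-Schwarz the expression is at least its value for parallel vectors of the same
  lengths, where monotonicity of \<open>s powr (p - 1)\<close> decides.\<close>

lemma p_flux_monotone:
  fixes x y :: "'a::real_inner"
  assumes "1 < p"
  shows "0 \<le> (norm x powr (p - 2) *\<^sub>R x - norm y powr (p - 2) *\<^sub>R y) \<bullet> (x - y)"
proof -
  have pw: "norm z powr (p - 2) * (norm z * norm z) = norm z powr (p - 1) * norm z"
    "norm z powr (p - 2) * norm z = norm z powr (p - 1)" for z :: 'a
    by (cases "z = 0"; simp add: powr_diff power2_eq_square field_simps)+
  have "0 \<le> (norm x powr (p - 1) - norm y powr (p - 1)) * (norm x - norm y)"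
    using assms powr_mono2[of "p - 1" "norm x" "norm y"] powr_mono2[of "p - 1" "norm y" "norm x"]
    by (cases "norm x \<le> norm y") (auto intro: mult_nonneg_nonneg mult_nonpos_nonpos)
  also have "\<dots> = norm x powr (p - 1) * norm x + norm y powr (p - 1) * norm y
      - (norm x powr (p - 2) * (norm x * norm y) + norm y powr (p - 2) * (norm x * norm y))"
    unfolding pw(2)[symmetric] by (simp add: algebra_simps)
  also have "\<dots> \<le> norm x powr (p - 1) * norm x + norm y powr (p - 1) * norm y
      - (norm x powr (p - 2) * (x \<bullet> y) + norm y powr (p - 2) * (x \<bullet> y))"
    by (intro diff_left_mono add_mono mult_left_mono norm_cauchy_schwarz) auto
  also have "\<dots> = (norm x powr (p - 2) *\<^sub>R x - norm y powr (p - 2) *\<^sub>R y) \<bullet> (x - y)"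
    unfolding pw(1)[symmetric]
    by (simp add: inner_diff_left inner_diff_right inner_commute algebra_simps flip: power2_norm_eq_inner power2_eq_square)
  finally show ?thesis .
qed

lemma continuous_on_vanishing_extension:
  fixes f :: "'a::topological_space \<Rightarrow> 'b::real_normed_vector"
  assumes "open U" "closed C" "C \<subseteq> U" "continuous_on U f" "\<And>x. x \<notin> C \<Longrightarrow> f x = 0"
  shows "continuous_on UNIV f"
proof -
  have "continuous_on (- C) f"
    by (rule continuous_on_eq[OF continuous_on_const[of _ "0::'b"]]) (use assms(5) in simp)
  then have "continuous_on (U \<union> - C) f"
    using assms by (intro continuous_on_open_Un) auto
  moreover have "U \<union> - C = UNIV" using assms(3) by blast
  ultimately show ?thesis by simp
qed

text \<open>The flux \<open>|z| powr (p - 2) *\<^sub>R z\<close> need not be differentiable at critical points, so integration by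
  parts is done for \<open>(|z|\<^sup>2 + t) powr ((p - 2) / 2) *\<^sub>R z\<close>, followed by the limit \<open>t \<longlongrightarrow> 0\<close>.\<close>
definition regularized_weight :: "real \<Rightarrow> real \<Rightarrow> 'a::real_inner \<Rightarrow> real" where
  "regularized_weight p t z = (z \<bullet> z + t) powr ((p - 2) / 2)"

lemma has_derivative_regularized_flux:
  fixes q :: "'a::euclidean_space \<Rightarrow> 'a"
  assumes "(q has_derivative H) (at x)" "0 < t"
  shows "((\<lambda>x. regularized_weight p t (q x) *\<^sub>R q x) has_derivative
    (\<lambda>v. regularized_weight p t (q x) *\<^sub>R
       (H v + ((p - 2) * (q x \<bullet> H v) / (q x \<bullet> q x + t)) *\<^sub>R q x))) (at x)"
proof -
  have pos: "0 < q x \<bullet> q x + t" using assms(2) by (simp add: add_nonneg_pos)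
  have "((\<lambda>x. q x \<bullet> q x + t) has_derivative (\<lambda>v. 2 * (q x \<bullet> H v))) (at x)"
    using assms(1) by (auto intro!: derivative_eq_intros simp: inner_commute)
  moreover have "((\<lambda>y. y powr ((p - 2) / 2)) has_derivative
      (*) ((p - 2) / 2 * (q x \<bullet> q x + t) powr ((p - 2) / 2 - 1))) (at (q x \<bullet> q x + t))"
    using has_real_derivative_powr[OF pos, of "(p - 2) / 2"] by (simp only: has_field_derivative_def)
  ultimately have "((\<lambda>x. regularized_weight p t (q x)) has_derivative
      (\<lambda>v. (p - 2) / 2 * (q x \<bullet> q x + t) powr ((p - 2) / 2 - 1) * (2 * (q x \<bullet> H v)))) (at x)"
    unfolding regularized_weight_def by (rule has_derivative_compose)
  from has_derivative_scaleR[OF this assms(1)] show ?thesis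
  proof (rule has_derivative_eq_rhs)
    obtain s where s: "q x \<bullet> q x + t = s" by blast
    show "(\<lambda>v. regularized_weight p t (q x) *\<^sub>R H v + ((p - 2) / 2 * (q x \<bullet> q x + t) powr ((p - 2) / 2 - 1) *
        (2 * (q x \<bullet> H v))) *\<^sub>R q x) = (\<lambda>v. regularized_weight p t (q x) *\<^sub>R
        (H v + ((p - 2) * (q x \<bullet> H v) / (q x \<bullet> q x + t)) *\<^sub>R q x))"
      using pos unfolding regularized_weight_def s
      by (simp add: fun_eq_iff powr_diff scaleR_add_right)
  qed
qed

text \<open>Up to the weight this is the divergence of the regularised flux. The direction that
  appears is shorter than 1, which is why the operator has to be bounded on the whole unit ball at
  critical points.\<close>

lemma regularized_flux_trace:
  fixes z :: "'a::euclidean_space"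
  assumes "linear H" "0 < t"
  shows "(\<Sum>b\<in>Basis. (H b + ((p - 2) * (z \<bullet> H b) / (z \<bullet> z + t)) *\<^sub>R z) \<bullet> b)
    = normalized_p_laplacian p H (z /\<^sub>R sqrt (z \<bullet> z + t))"
proof -
  have pos: "0 < z \<bullet> z + t" using assms(2) by (simp add: add_nonneg_pos)
  have "H z = (\<Sum>b\<in>Basis. (z \<bullet> b) *\<^sub>R H b)"
    using linear_sum[OF assms(1), of "\<lambda>b. (z \<bullet> b) *\<^sub>R b" Basis] linear_scale[OF assms(1)]
    by (simp add: euclidean_representation)
  then have "z \<bullet> H z = (\<Sum>b\<in>Basis. (z \<bullet> H b) * (z \<bullet> b))"
    by (simp add: inner_sum_right mult.commute)
  moreover have "sqrt (z \<bullet> z + t) * sqrt (z \<bullet> z + t) = z \<bullet> z + t"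
    using pos by (intro real_sqrt_mult_self[THEN trans]) simp
  ultimately show ?thesis
    by (simp add: normalized_p_laplacian_def inner_add_left sum.distrib linear_scale[OF assms(1)]
        sum_distrib_left sum_divide_distrib field_simps flip: power2_eq_square)
qed

text \<open>With \<open>A\<close> the regularised flux, the divergence of \<open>\<theta> A\<close>
  integrates to zero, so the pairing with \<open>g\<close> is minus the integral of \<theta> times
  the divergence of \<open>A\<close>. The set \<open>S\<close>, where weight and test function are
  bounded below, makes the sign quantitative; with \<open>S\<close>, \<open>w\<close> and
  \<open>s\<close> chosen independently of \<open>t\<close> the bound survives
  \<open>t \<longlongrightarrow> 0\<close>.\<close>

lemma regularized_flux_integral_lower_bound:
  fixes q g :: "'a::euclidean_space \<Rightarrow> 'a"
  assumes q: "\<And>x. x \<in> ball x0 r \<Longrightarrow> (q has_derivative H x) (at x)"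
    and H: "\<And>b. continuous_on (ball x0 r) (\<lambda>x. H x b)"
    and t: "0 < t"
    and L: "\<And>x. x \<in> ball x0 r \<Longrightarrow> normalized_p_laplacian p (H x) (q x /\<^sub>R sqrt (q x \<bullet> q x + t)) \<le> - c"
    and c: "0 < c"
    and \<theta>: "\<And>x. (\<theta> has_derivative (\<lambda>v. g x \<bullet> v)) (at x)" "continuous_on UNIV g" "\<And>x. 0 \<le> \<theta> x"
      "\<And>x. x \<notin> cball x0 r' \<Longrightarrow> \<theta> x = 0" "r' < r"
    and S: "S \<in> lmeasurable" "S \<subseteq> ball x0 r"
      "\<And>x. x \<in> S \<Longrightarrow> w \<le> regularized_weight p t (q x)" "\<And>x. x \<in> S \<Longrightarrow> s \<le> \<theta> x" "0 < w" "0 < s"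
  shows "c * w * s * measure lebesgue S \<le> (LINT x|lebesgue. (regularized_weight p t (q x) *\<^sub>R q x) \<bullet> g x)"
    "integrable lebesgue (\<lambda>x. (regularized_weight p t (q x) *\<^sub>R q x) \<bullet> g x)"
proof -
  define A where "A x = regularized_weight p t (q x) *\<^sub>R q x" for x
  define A' where "A' x v = regularized_weight p t (q x) *\<^sub>R
      (H x v + ((p - 2) * (q x \<bullet> H x v) / (q x \<bullet> q x + t)) *\<^sub>R q x)" for x v
  have sub: "cball x0 r' \<subseteq> ball x0 r" using \<theta>(5) by auto
  have A: "(A has_derivative A' x) (at x)" if "x \<in> ball x0 r" for x
    unfolding A_def[abs_def] A'_def by (rule has_derivative_regularized_flux[OF q[OF that] t])
  have cA: "continuous_on (ball x0 r) A"
    by (rule has_derivative_imp_continuous_on[OF A])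
  have cq: "continuous_on (ball x0 r) q"
    by (rule has_derivative_imp_continuous_on[OF q])
  have pos: "0 < q x \<bullet> q x + t" for x using t by (simp add: add_nonneg_pos)
  have cA': "continuous_on (ball x0 r) (\<lambda>x. A' x b)" for b
    unfolding A'_def regularized_weight_def
    by (intro continuous_intros cq H) (use pos in \<open>auto simp: less_imp_neq[THEN not_sym]\<close>)
  have c\<theta>: "continuous_on UNIV \<theta>"
    by (rule has_derivative_imp_continuous_on[OF \<theta>(1)])
  have g0: "g x = 0" if "x \<notin> cball x0 r'" for x
    using gradient_vanishes_off_support[OF \<theta>(1) closed_cball \<theta>(4) that] .
  \<comment> \<open>The derivative of \<open>\<theta> x * (A x \<bullet> b)\<close> in direction
    \<open>v\<close>, extended by zero because \<open>A\<close> is differentiable only inside the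
    ball.\<close>
  define D where "D b x v = (if x \<in> ball x0 r then \<theta> x * (A' x v \<bullet> b) + (g x \<bullet> v) * (A x \<bullet> b) else 0)" for b x v
  have D0: "D b x v = 0" if "x \<notin> cball x0 r'" for b x v
    using \<theta>(4)[OF that] g0[OF that] by (simp add: D_def)
  have dD: "((\<lambda>x. \<theta> x * (A x \<bullet> b)) has_derivative D b x) (at x)" for b x
  proof (cases "x \<in> ball x0 r")
    case True
    have "((\<lambda>x. \<theta> x * (A x \<bullet> b)) has_derivative (\<lambda>v. \<theta> x * (A' x v \<bullet> b) + (g x \<bullet> v) * (A x \<bullet> b))) (at x)"
      by (intro has_derivative_mult \<theta>(1) has_derivative_inner_left A True)
    then show ?thesis using True by (simp add: D_def[abs_def])
  next
    case False
    then have n: "x \<notin> cball x0 r'" using sub by blast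
    have "((\<lambda>_. 0::real) has_derivative (\<lambda>_. 0)) (at x)" by simp
    then have "((\<lambda>x. \<theta> x * (A x \<bullet> b)) has_derivative (\<lambda>_. 0)) (at x)"
      by (rule has_derivative_transform_within_open[of _ _ _ _ "- cball x0 r'"]) (use n \<theta>(4) in auto)
    then show ?thesis using False by (simp add: D_def[abs_def])
  qed
  have cD: "continuous_on UNIV (\<lambda>x. D b x v)" for b v
  proof (rule continuous_on_vanishing_extension[OF open_ball closed_cball sub])
    have "continuous_on (ball x0 r) (\<lambda>x. \<theta> x * (A' x v \<bullet> b) + (g x \<bullet> v) * (A x \<bullet> b))"
      by (intro continuous_intros cA' cA continuous_on_subset[OF c\<theta>] continuous_on_subset[OF \<theta>(2)]) auto
    then show "continuous_on (ball x0 r) (\<lambda>x. D b x v)"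
      by (rule continuous_on_eq) (simp add: D_def)
  qed (rule D0)
  have int_D: "integrable lebesgue (\<lambda>x. D b x v)" for b v
    using integrable_continuous_compact_support(2)[OF cD compact_cball D0] .
  have zero: "(LINT x|lebesgue. D b x b) = 0" for b
    by (rule integral_directional_derivative_zero[OF dD cD compact_cball]) (use \<theta>(4) in auto)
  have cAg: "continuous_on UNIV (\<lambda>x. A x \<bullet> g x)"
    by (rule continuous_on_vanishing_extension[OF open_ball closed_cball sub])
      (use g0 in \<open>auto intro!: continuous_intros cA continuous_on_subset[OF \<theta>(2)]\<close>)
  have int_Ag: "integrable lebesgue (\<lambda>x. A x \<bullet> g x)"
    by (rule integrable_continuous_compact_support(2)[OF cAg compact_cball[of x0 r']]) (use g0 in auto)
  then show "integrable lebesgue (\<lambda>x. (regularized_weight p t (q x) *\<^sub>R q x) \<bullet> g x)"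
    by (simp add: A_def)
  have pt: "(\<Sum>b\<in>Basis. D b x b) + c * w * s * indicator S x \<le> A x \<bullet> g x" for x
  proof (cases "x \<in> ball x0 r")
    case True
    have "(\<Sum>b\<in>Basis. A' x b \<bullet> b) = regularized_weight p t (q x) *
        normalized_p_laplacian p (H x) (q x /\<^sub>R sqrt (q x \<bullet> q x + t))"
      using regularized_flux_trace[OF has_derivative_linear[OF q[OF True]] t, of p "q x"]
      by (simp add: A'_def sum_distrib_left[symmetric])
    also have "\<dots> \<le> regularized_weight p t (q x) * (- c)"
      by (intro mult_left_mono L True) (simp add: regularized_weight_def)
    finally have "\<theta> x * (\<Sum>b\<in>Basis. A' x b \<bullet> b) \<le> \<theta> x * (regularized_weight p t (q x) * (- c))"
      using \<theta>(3) by (rule mult_left_mono)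
    moreover have "w * s * indicator S x \<le> regularized_weight p t (q x) * \<theta> x"
      using S(3-6) \<theta>(3) by (cases "x \<in> S") (auto intro!: mult_mono mult_nonneg_nonneg simp: regularized_weight_def)
    then have "c * (w * s * indicator S x) \<le> c * (regularized_weight p t (q x) * \<theta> x)"
      using c by (intro mult_left_mono) auto
    moreover have "(\<Sum>b\<in>Basis. D b x b) = \<theta> x * (\<Sum>b\<in>Basis. A' x b \<bullet> b) + A x \<bullet> g x"
      using True by (simp add: D_def sum.distrib sum_distrib_left euclidean_inner[of "A x" "g x"] mult.commute)
    ultimately show ?thesis by (simp add: algebra_simps)
  next
    case False
    then have "x \<notin> cball x0 r'" "x \<notin> S" using sub S(2) by blast+
    then show ?thesis using D0[of x] g0[of x] by simp
  qed
  have iS: "integrable lebesgue (\<lambda>x. c * w * s * indicator S x)"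
    using S(1) by (intro integrable_mult_right integrable_real_indicator) (auto simp: fmeasurable_def)
  have "(LINT x|lebesgue. (\<Sum>b\<in>Basis. D b x b) + c * w * s * indicator S x) \<le> (LINT x|lebesgue. A x \<bullet> g x)"
    by (intro integral_mono pt Bochner_Integration.integrable_add Bochner_Integration.integrable_sum int_D iS int_Ag)
  moreover have "(LINT x|lebesgue. (\<Sum>b\<in>Basis. D b x b) + c * w * s * indicator S x) = c * w * s * measure lebesgue S"
    using int_D iS S(1) by (simp add: Bochner_Integration.integral_add zero fmeasurableD)
  ultimately show "c * w * s * measure lebesgue S \<le> (LINT x|lebesgue. (regularized_weight p t (q x) *\<^sub>R q x) \<bullet> g x)"
    by (simp add: A_def)
qed

lemma regularized_flux_integral_limit:
  fixes q g :: "'a::euclidean_space \<Rightarrow> 'a"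
  assumes p: "1 < p" and t0: "0 < t0"
    and int: "\<And>t. 0 < t \<Longrightarrow> t < t0 \<Longrightarrow> integrable lebesgue (\<lambda>x. (regularized_weight p t (q x) *\<^sub>R q x) \<bullet> g x)"
    and lb: "\<And>t. 0 < t \<Longrightarrow> t < t0 \<Longrightarrow> c \<le> (LINT x|lebesgue. (regularized_weight p t (q x) *\<^sub>R q x) \<bullet> g x)"
    and g: "integrable lebesgue g" and Q: "\<And>x. g x \<noteq> 0 \<Longrightarrow> norm (q x) \<le> Q"
  shows "c \<le> (LINT x|lebesgue. (norm (q x) powr (p - 2) *\<^sub>R q x) \<bullet> g x)"
    "integrable lebesgue (\<lambda>x. (norm (q x) powr (p - 2) *\<^sub>R q x) \<bullet> g x)"
proof -
  define T where "T n = min t0 1 / real (n + 2)" for n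
  have T: "0 < T n" "T n < t0" "T n \<le> 1" for n
    using t0 by (auto simp: T_def field_simps min_def) (smt (verit) mult_nonneg_nonneg of_nat_0_le_iff)+
  have Tlim: "T \<longlonglongrightarrow> 0"
    unfolding T_def using LIMSEQ_ignore_initial_segment[OF lim_const_over_n[of "min t0 1"], of 2] by simp
  define f where "f n x = (regularized_weight p (T n) (q x) *\<^sub>R q x) \<bullet> g x" for n x
  define f0 where "f0 x = (norm (q x) powr (p - 2) *\<^sub>R q x) \<bullet> g x" for x
  have lim: "(\<lambda>n. f n x) \<longlonglongrightarrow> f0 x" for x
  proof (cases "q x = 0")
    case False
    have "(\<lambda>n. (q x \<bullet> q x + T n) powr ((p - 2) / 2)) \<longlonglongrightarrow> (q x \<bullet> q x + 0) powr ((p - 2) / 2)"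
      using False by (intro tendsto_intros Tlim) auto
    moreover have "(q x \<bullet> q x + 0) powr ((p - 2) / 2) = norm (q x) powr (p - 2)"
      using False by (simp add: powr_half_sqrt[symmetric] norm_eq_sqrt_inner powr_powr)
    ultimately have "(\<lambda>n. regularized_weight p (T n) (q x)) \<longlonglongrightarrow> norm (q x) powr (p - 2)"
      by (simp only: regularized_weight_def)
    then show ?thesis
      unfolding f_def f0_def by (intro tendsto_inner tendsto_scaleR tendsto_const)
  qed (simp add: f_def f0_def)
  have bd: "norm (f n x) \<le> (Q\<^sup>2 + 1) powr ((p - 1) / 2) * norm (g x)" for n x
  proof (cases "g x = 0")
    case False
    have pos: "0 < q x \<bullet> q x + T n" using T(1) by (simp add: add_nonneg_pos)
    have "norm (f n x) \<le> norm (regularized_weight p (T n) (q x) *\<^sub>R q x) * norm (g x)"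
      unfolding f_def real_norm_def by (rule Cauchy_Schwarz_ineq2)
    also have "norm (regularized_weight p (T n) (q x) *\<^sub>R q x) = (q x \<bullet> q x + T n) powr ((p - 2) / 2) * sqrt (q x \<bullet> q x)"
      by (simp add: regularized_weight_def) (simp add: norm_eq_sqrt_inner)
    \<comment> \<open>Enlarging the norm to this square root merges both factors into the positive
      power \<open>(p - 1) / 2\<close>, which is monotone even when \<open>p < 2\<close>.\<close>
    also have "\<dots> \<le> (q x \<bullet> q x + T n) powr ((p - 2) / 2) * sqrt (q x \<bullet> q x + T n)"
      using T(1)[of n] by (intro mult_left_mono real_sqrt_le_mono) auto
    also have "\<dots> = (q x \<bullet> q x + T n) powr ((p - 1) / 2)"
      using pos by (simp add: powr_half_sqrt[symmetric] powr_add[symmetric] field_simps)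
    also have "\<dots> \<le> (Q\<^sup>2 + 1) powr ((p - 1) / 2)"
    proof (rule powr_mono2)
      have "(norm (q x))\<^sup>2 \<le> Q\<^sup>2" using Q[OF False] by (intro power_mono) auto
      then show "q x \<bullet> q x + T n \<le> Q\<^sup>2 + 1"
        using T(3)[of n] by (simp add: power2_norm_eq_inner)
    qed (use p pos in auto)
    finally show ?thesis by (simp add: mult_right_mono)
  qed (simp add: f_def)
  have intf: "integrable lebesgue (f n)" for n
    using int[OF T(1,2)] by (simp add: f_def[abs_def])
  have fm: "f n \<in> borel_measurable lebesgue" for n using intf by auto
  have f0m: "f0 \<in> borel_measurable lebesgue"
    by (rule borel_measurable_LIMSEQ_real[OF lim fm])
  have w: "integrable lebesgue (\<lambda>x. (Q\<^sup>2 + 1) powr ((p - 1) / 2) * norm (g x))"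
    using g by simp
  have conv: "(\<lambda>n. LINT x|lebesgue. f n x) \<longlonglongrightarrow> (LINT x|lebesgue. f0 x)"
    by (rule integral_dominated_convergence[OF f0m fm w]) (use lim bd in auto)
  have "integrable lebesgue f0"
    by (rule integrable_dominated_convergence[where s = f, OF f0m fm w]) (use lim bd in auto)
  then show "integrable lebesgue (\<lambda>x. (norm (q x) powr (p - 2) *\<^sub>R q x) \<bullet> g x)"
    by (simp add: f0_def[abs_def])
  have "c \<le> (LINT x|lebesgue. f0 x)"
    by (rule LIMSEQ_le_const[OF conv]) (use lb[OF T(1,2)] in \<open>auto simp: f_def\<close>)
  then show "c \<le> (LINT x|lebesgue. (norm (q x) powr (p - 2) *\<^sub>R q x) \<bullet> g x)"
    by (simp add: f0_def)
qed

text \<open>In the application \<open>x\<close> is the weak gradient, \<open>y\<close> the gradient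
  of the smooth function and \<open>z\<close> the mollified gradient. Replacing \<open>z\<close> by
  \<open>x\<close> leaves a nonnegative monotone term at a price proportional to
  \<open>norm (z - x)\<close>.\<close>

lemma p_flux_inner_lower_bound:
  fixes x y z :: "'a::real_inner"
  assumes p: "1 < p" and e: "norm x + norm y \<le> e"
  shows "- (2 * e powr (p - 1) * norm (z - x)) \<le>
    (norm x powr (p - 2) *\<^sub>R x - norm y powr (p - 2) *\<^sub>R y) \<bullet> (z - y)"
proof -
  define A where "A v = norm v powr (p - 2) *\<^sub>R v" for v :: 'a
  have nA: "norm (A v) \<le> e powr (p - 1)" if "norm v \<le> e" for v
  proof -
    have "norm (A v) = norm v powr (p - 1)"
      by (cases "v = 0") (simp_all add: A_def powr_diff power2_eq_square field_simps)
    also have "\<dots> \<le> e powr (p - 1)" using that p by (intro powr_mono2) auto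
    finally show ?thesis .
  qed
  have "norm x \<le> e" "norm y \<le> e"
    using e norm_ge_zero[of x] norm_ge_zero[of y] by linarith+
  then have "norm (A x - A y) \<le> 2 * e powr (p - 1)"
    using norm_triangle_ineq4[of "A x" "A y"] nA[of x] nA[of y] by linarith
  then have "norm (A x - A y) * norm (z - x) \<le> 2 * e powr (p - 1) * norm (z - x)"
    by (rule mult_right_mono) simp
  moreover have "\<bar>(A x - A y) \<bullet> (z - x)\<bar> \<le> norm (A x - A y) * norm (z - x)"
    by (rule Cauchy_Schwarz_ineq2)
  moreover have "(A x - A y) \<bullet> (z - y) = (A x - A y) \<bullet> (x - y) + (A x - A y) \<bullet> (z - x)"
    by (simp add: inner_diff_right)
  moreover have "0 \<le> (A x - A y) \<bullet> (x - y)"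
    unfolding A_def by (rule p_flux_monotone[OF p])
  ultimately show ?thesis unfolding A_def by linarith
qed

text \<open>The test function is the squared positive part of \<open>h' - \<phi> - m\<close>, where \<open>h'\<close> is a mollification
  of \<open>h\<close> and \<open>m\<close> is slightly below the maximum of \<open>h - \<phi>\<close>. Squaring the positive part makes it \<open>C\<^sup>1\<close>.
  The weak equation for \<open>h\<close>, the strict inequality for \<open>\<phi>\<close> and monotonicity of the flux are
  incompatible as soon as \<open>\<nabla>h'\<close> is close to the weak gradient in a weighted \<open>L\<^sup>1\<close> norm.\<close>
lemma p_harmonic_no_strict_touching:
  fixes h \<phi> :: "'a::euclidean_space \<Rightarrow> real"
  assumes p: "1 < p" and D: "open D" and h: "p_harmonic p D h"
    and r: "0 < r" "r < R" and box: "cball x0 r \<subseteq> box a b" "cbox a b \<subseteq> D"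
    and \<phi>: "\<And>x. x \<in> ball x0 R \<Longrightarrow> (\<phi> has_derivative (\<lambda>v. q x \<bullet> v)) (at x)"
    and q: "\<And>x. x \<in> ball x0 R \<Longrightarrow> (q has_derivative H x) (at x)"
    and H: "\<And>b. continuous_on (ball x0 R) (\<lambda>x. H x b)"
    and L: "\<And>x t. x \<in> ball x0 R \<Longrightarrow> 0 < t \<Longrightarrow> t < t0 \<Longrightarrow>
      normalized_p_laplacian p (H x) (q x /\<^sub>R sqrt (q x \<bullet> q x + t)) \<le> - c"
    and c: "0 < c" "0 < t0"
    and k: "0 < k" "\<And>x. x \<in> cball x0 r \<Longrightarrow> h x - \<phi> x \<le> h x0 - \<phi> x0 - k * (dist x0 x)\<^sup>2"
  shows False
proof -
  let ?K = "cball x0 r"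
  obtain G where WG: "W1p_loc p D h G" and weak: "\<And>\<psi> g. test_fun D \<psi> g \<Longrightarrow>
      (LINT x:D|lebesgue. norm (G x) powr (p - 2) * (G x \<bullet> g x)) = 0" and ch: "continuous_on D h"
    using h unfolding p_harmonic_def by blast
  have KD: "?K \<subseteq> D" using box box_subset_cbox[of a b] by blast
  have KR: "?K \<subseteq> ball x0 R" using r by auto
  have cq: "continuous_on (ball x0 R) q"
    by (rule has_derivative_imp_continuous_on[OF q])
  have c\<phi>: "continuous_on (ball x0 R) \<phi>"
    by (rule has_derivative_imp_continuous_on[OF \<phi>])
  \<comment> \<open>\<open>s\<close> is the guaranteed drop of \<open>h - \<phi>\<close> at radius
    \<open>r\<close>. With the level \<open>s / 4\<close> below the maximum, \<open>v\<close> is at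
    most \<open>- 5 * s / 16\<close> beyond radius \<open>3 * r / 4\<close>, so an error of at most
    \<open>s / 24\<close> leaves the test function supported well inside.\<close>
  define s where "s = k * r\<^sup>2"
  have s: "0 < s" using k r by (simp add: s_def)
  define m where "m = h x0 - \<phi> x0 - s / 4"
  define v where "v x = h x - \<phi> x - m" for x
  have vx0: "v x0 = s / 4" by (simp add: v_def m_def)
  have v_le: "v x \<le> s / 4 - k * (dist x0 x)\<^sup>2" if "x \<in> ?K" for x
    using k(2)[OF that] by (simp add: v_def m_def)
  have cv: "continuous_on (ball x0 r) v"
    unfolding v_def by (intro continuous_intros continuous_on_subset[OF ch] continuous_on_subset[OF c\<phi>])
      (use KD KR in auto)
  have "bounded (q ` ?K)"
    using continuous_on_subset[OF cq KR] by (intro compact_imp_bounded compact_continuous_image) auto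
  then obtain Q where Q: "\<And>x. x \<in> ?K \<Longrightarrow> norm (q x) \<le> Q"
    by (metis bounded_iff imageI)
  have Q0: "0 \<le> Q" using order_trans[OF norm_ge_zero Q[of x0]] r by simp
  \<comment> \<open>On \<open>N\<close> the mollified function is at least
    \<open>s / 6 - s / 24 = s / 8\<close>, the later lower bound for the test function.\<close>
  define N where "N = ball x0 r \<inter> v -` {s / 6<..}"
  have N: "open N" "x0 \<in> N"
    using continuous_open_preimage[OF cv open_ball open_greaterThan] s r vx0 by (auto simp: N_def)
  \<comment> \<open>If \<open>q\<close> vanished on the open set \<open>N\<close>, then
    \<open>H x0\<close> and hence the operator would be 0 instead of negative. A nonzero gradient is
    wanted because for \<open>p > 2\<close> the weight degenerates where the gradient
    vanishes.\<close>
  obtain x1 where x1: "x1 \<in> N" "q x1 \<noteq> 0"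
  proof (rule ccontr)
    assume "\<not> thesis"
    with that have q0: "q x = 0" if "x \<in> N" for x using that by blast
    have x0R: "x0 \<in> ball x0 R" using r by auto
    have "((\<lambda>_. 0) has_derivative H x0) (at x0)"
      by (rule has_derivative_transform_within_open[OF q[OF x0R] N]) (use q0 in auto)
    then have "H x0 = (\<lambda>_. 0)"
      using has_derivative_unique has_derivative_const by metis
    then show False using L[OF x0R, of "t0 / 2"] c by (simp add: normalized_p_laplacian_def)
  qed
  have "open (N \<inter> ({x \<in> ball x0 r. norm (q x1) / 2 < norm (q x)}))"
  proof -
    have "{x \<in> ball x0 r. norm (q x1) / 2 < norm (q x)} = ball x0 r \<inter> (\<lambda>x. norm (q x)) -` {norm (q x1) / 2<..}"
      by auto
    moreover have "open \<dots>"
      by (intro continuous_open_preimage open_ball open_greaterThan continuous_on_norm continuous_on_subset[OF cq])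
        (use r in auto)
    ultimately show ?thesis using N by (simp add: open_Int)
  qed
  moreover have "x1 \<in> N \<inter> {x \<in> ball x0 r. norm (q x1) / 2 < norm (q x)}"
    using x1 by (auto simp: N_def)
  ultimately obtain r1 where r1: "0 < r1" "cball x1 r1 \<subseteq> N \<inter> {x \<in> ball x0 r. norm (q x1) / 2 < norm (q x)}"
    using open_contains_cball by blast
  define S where "S = cball x1 r1"
  have Sb: "S \<subseteq> ball x0 r" and Sv: "\<And>x. x \<in> S \<Longrightarrow> s / 6 < v x" and Sq: "\<And>x. x \<in> S \<Longrightarrow> norm (q x1) / 2 < norm (q x)"
    using r1(2) by (auto simp: S_def N_def)
  have Sm: "S \<in> lmeasurable" by (simp add: S_def)
  have Spos: "0 < measure lebesgue S"
    using r1(1) by (simp add: S_def content_cball_pos)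
  \<comment> \<open>The weight is nondecreasing in the gradient for \<open>p \<ge> 2\<close> and
    nonincreasing for \<open>p < 2\<close>; the smaller endpoint value bounds it on \<open>S\<close>
    for all \<open>t \<le> 1\<close>.\<close>
  define w where "w = min (((norm (q x1) / 2)\<^sup>2) powr ((p - 2) / 2)) ((Q\<^sup>2 + 1) powr ((p - 2) / 2))"
  have "Q\<^sup>2 + 1 \<noteq> 0" by (metis add_nonneg_pos less_irrefl zero_le_power2 zero_less_one)
  then have w: "0 < w" using x1 by (simp add: w_def)
  have w_le: "w \<le> regularized_weight p t (q x)" if "x \<in> S" "0 < t" "t \<le> 1" for x t
  proof -
    have "(norm (q x1) / 2)\<^sup>2 \<le> (norm (q x))\<^sup>2" "(norm (q x))\<^sup>2 \<le> Q\<^sup>2"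
      using Sq[OF that(1)] Q[of x] Sb that(1) by (auto intro!: power_mono)
    then have b: "(norm (q x1) / 2)\<^sup>2 \<le> q x \<bullet> q x + t" "q x \<bullet> q x + t \<le> Q\<^sup>2 + 1"
      using that by (simp_all add: power2_norm_eq_inner)
    have pos: "0 < (norm (q x1) / 2)\<^sup>2" using x1 by simp
    show ?thesis
    proof (cases "2 \<le> p")
      case True
      then have "((norm (q x1) / 2)\<^sup>2) powr ((p - 2) / 2) \<le> regularized_weight p t (q x)"
        unfolding regularized_weight_def using b pos by (intro powr_mono2) auto
      then show ?thesis by (simp add: w_def)
    next
      case False
      moreover have "0 < q x \<bullet> q x + t" using that(2) by (simp add: add_nonneg_pos)
      ultimately have "(Q\<^sup>2 + 1) powr ((p - 2) / 2) \<le> regularized_weight p t (q x)"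
        unfolding regularized_weight_def by (intro powr_mono2'[OF _ _ b(2)]) simp_all
      then show ?thesis by (simp add: w_def)
    qed
  qed
  define c1 where "c1 = c * w * (s / 8)\<^sup>2 * measure lebesgue S"
  have c1: "0 < c1" using c w s Spos by (simp add: c1_def)
  \<comment> \<open>The first bound controls the support of the test function, the second makes the
    total mollification error \<open>2 * s * e\<close> smaller than the gain \<open>c1\<close> from
    strictness.\<close>
  define e where "e = min (s / 24) (c1 / (4 * s))"
  have e: "0 < e" "e \<le> s / 24" "2 * s * e < c1"
    using s c1 by (auto simp: e_def min_def field_simps split: if_splits)
  define E where "E x = norm (G x) + Q" for x
  have LG: "loc_Lp p D G" using WG by (simp add: W1p_loc_def)
  have GKm: "(\<lambda>x. indicator ?K x *\<^sub>R G x) \<in> borel_measurable lebesgue"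
  proof -
    have "(\<lambda>y. indicator D y *\<^sub>R G y) \<in> borel_measurable lebesgue"
      using LG by (simp add: loc_Lp_def set_borel_measurable_def)
    then have "(\<lambda>y. indicator ?K y *\<^sub>R (indicator D y *\<^sub>R G y)) \<in> borel_measurable lebesgue"
      by (rule borel_measurable_scaleR[rotated]) (rule borel_measurable_indicator, simp)
    also have "(\<lambda>y. indicator ?K y *\<^sub>R (indicator D y *\<^sub>R G y)) = (\<lambda>x. indicator ?K x *\<^sub>R G x)"
    proof
      show "indicator ?K y *\<^sub>R (indicator D y *\<^sub>R G y) = indicator ?K y *\<^sub>R G y" for y
        using KD by (cases "y \<in> ?K") auto
    qed
    finally show ?thesis .
  qed
  have GKp: "integrable lebesgue (\<lambda>x. indicator ?K x *\<^sub>R norm (G x) powr p)"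
    using LG KD by (auto simp: loc_Lp_def set_integrable_def)
  have iK: "integrable lebesgue (indicat_real ?K)"
    using lmeasurable_cball[of x0 r] by (intro integrable_real_indicator) (auto simp: fmeasurable_def)
  have Em: "set_borel_measurable lebesgue ?K E"
  proof -
    have "(\<lambda>x. norm (indicator ?K x *\<^sub>R G x) + indicator ?K x * Q) \<in> borel_measurable lebesgue"
      by (intro borel_measurable_add measurable_compose[OF GKm borel_measurable_norm] borel_measurable_times
          borel_measurable_integrable[OF iK] borel_measurable_const)
    also have "(\<lambda>x. norm (indicator ?K x *\<^sub>R G x) + indicator ?K x * Q) = (\<lambda>x. indicator ?K x *\<^sub>R E x)"
      by (auto simp: E_def indicator_def)
    finally show ?thesis by (simp add: set_borel_measurable_def)
  qed
  have Ep: "set_integrable lebesgue ?K (\<lambda>x. E x powr p)"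
    unfolding set_integrable_def
  proof (rule Bochner_Integration.integrable_bound)
    show "integrable lebesgue (\<lambda>x. 2 powr p * (indicator ?K x *\<^sub>R norm (G x) powr p + Q powr p * indicator ?K x))"
      using GKp iK by (intro integrable_mult_right Bochner_Integration.integrable_add)
    have "(\<lambda>x. (indicator ?K x *\<^sub>R E x) powr p) \<in> borel_measurable lebesgue"
      using Em unfolding set_borel_measurable_def by (intro powr_real_measurable borel_measurable_const)
    also have "(\<lambda>x. (indicator ?K x *\<^sub>R E x) powr p) = (\<lambda>x. indicator ?K x *\<^sub>R E x powr p)"
      by (auto simp: indicator_def)
    finally show "(\<lambda>x. indicator ?K x *\<^sub>R E x powr p) \<in> borel_measurable lebesgue" .
    show "AE x in lebesgue. norm (indicator ?K x *\<^sub>R E x powr p) \<le>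
        norm (2 powr p * (indicator ?K x *\<^sub>R norm (G x) powr p + Q powr p * indicator ?K x))"
    proof (rule AE_I2)
      fix x
      have "E x powr p \<le> 2 powr p * (norm (G x) powr p + Q powr p)"
        unfolding E_def using Q0 p by (intro powr_add_le) auto
      then show "norm (indicator ?K x *\<^sub>R E x powr p) \<le>
        norm (2 powr p * (indicator ?K x *\<^sub>R norm (G x) powr p + Q powr p * indicator ?K x))"
        by (cases "x \<in> ?K") (auto simp: abs_mult)
    qed
  qed
  have E0: "0 \<le> E x" for x using Q0 by (simp add: E_def)
  obtain h' q' where h': "\<And>x. (h' has_derivative (\<lambda>v. q' x \<bullet> v)) (at x)" and cq': "continuous_on UNIV q'"
      and hh: "\<And>x. x \<in> ?K \<Longrightarrow> \<bar>h' x - h x\<bar> \<le> e"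
      and iE: "set_integrable lebesgue ?K (\<lambda>x. E x powr (p - 1) * norm (q' x - G x))"
      and sE: "(LINT x:?K|lebesgue. E x powr (p - 1) * norm (q' x - G x)) \<le> e"
    using mollification[OF p WG ch box(2) compact_cball box(1) Em E0 Ep e(1)] by blast
  define u where "u x = h' x - \<phi> x - m" for x
  have u: "(u has_derivative (\<lambda>v. (q' x - q x) \<bullet> v)) (at x)" if "x \<in> ball x0 r" for x
  proof -
    have "x \<in> ball x0 R" using that r by auto
    from has_derivative_diff[OF has_derivative_diff[OF h' \<phi>[OF this]] has_derivative_const]
    show ?thesis by (simp add: u_def[abs_def] inner_diff_left)
  qed
  have cu: "continuous_on (ball x0 r) u"
    by (rule has_derivative_imp_continuous_on[OF u])
  have uv: "\<bar>u x - v x\<bar> \<le> e" if "x \<in> ?K" for x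
    using hh[OF that] by (simp add: u_def v_def)
  let ?r' = "3 * r / 4"
  have r': "?r' < r" "0 < ?r'" using r by auto
  have u_neg: "u x \<le> 0" if x: "x \<in> ball x0 r" "x \<notin> cball x0 ?r'" for x
  proof -
    have "?r'\<^sup>2 \<le> (dist x0 x)\<^sup>2" using x r' by (intro power_mono) auto
    then have "k * ?r'\<^sup>2 \<le> k * (dist x0 x)\<^sup>2" using k(1) by (intro mult_left_mono) auto
    moreover have "k * ?r'\<^sup>2 = 9 / 16 * s" by (simp add: s_def power_divide power_mult_distrib)
    moreover have "x \<in> ?K" using x(1) by auto
    ultimately show ?thesis using v_le[of x] uv[of x] e s by linarith
  qed
  have u_le: "max 0 (u x) \<le> s / 2" if "x \<in> ball x0 r" for x
  proof -
    have "0 \<le> k * (dist x0 x)\<^sup>2" using k by simp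
    moreover have "x \<in> ?K" using that by auto
    ultimately have "u x \<le> s / 2" using v_le[of x] uv[of x] e s by linarith
    then show ?thesis using s by simp
  qed
  define \<theta> where "\<theta> x = (if x \<in> ball x0 r then (max 0 (u x))\<^sup>2 else 0)" for x
  define g where "g x = (if x \<in> ball x0 r then (2 * max 0 (u x)) *\<^sub>R (q' x - q x) else 0)" for x
  have off: "\<theta> x = 0" "g x = 0" if "x \<notin> cball x0 ?r'" for x
    using u_neg[of x] that by (auto simp: \<theta>_def g_def max_def)
  have sub: "cball x0 ?r' \<subseteq> ball x0 r" using r' by auto
  have d\<theta>: "(\<theta> has_derivative (\<lambda>v. g x \<bullet> v)) (at x)" for x
  proof (cases "x \<in> ball x0 r")
    case True
    have "((\<lambda>x. (max 0 (u x))\<^sup>2) has_derivative (\<lambda>v. g x \<bullet> v)) (at x)"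
      using has_derivative_max0_square[OF u[OF True]] True by (simp add: g_def)
    then show ?thesis
      by (rule has_derivative_transform_within_open[OF _ open_ball True]) (simp add: \<theta>_def)
  next
    case False
    then have n: "x \<notin> cball x0 ?r'" using sub by blast
    have "((\<lambda>_. 0::real) has_derivative (\<lambda>v. g x \<bullet> v)) (at x)" using off(2)[OF n] by simp
    then show ?thesis
      by (rule has_derivative_transform_within_open[of _ _ _ _ "- cball x0 ?r'"]) (use n off in auto)
  qed
  have cg: "continuous_on UNIV g"
  proof (rule continuous_on_vanishing_extension[OF open_ball closed_cball sub _ off(2)])
    have "continuous_on (ball x0 r) (\<lambda>x. (2 * max 0 (u x)) *\<^sub>R (q' x - q x))"
      by (intro continuous_intros cu continuous_on_subset[OF cq'] continuous_on_subset[OF cq]) (use r in auto)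
    then show "continuous_on (ball x0 r) g"
      by (rule continuous_on_eq) (simp add: g_def)
  qed
  have ig: "integrable lebesgue g"
    by (rule integrable_continuous_compact_support(2)[OF cg compact_cball off(2)])
  have test: "test_fun D \<theta> g"
    unfolding test_fun_def
  proof (intro conjI allI d\<theta> cg)
    have cl: "closure {x. \<theta> x \<noteq> 0} \<subseteq> cball x0 ?r'"
      using off(1) by (intro closure_minimal closed_cball) blast
    then show "compact (closure {x. \<theta> x \<noteq> 0})"
      using bounded_subset[OF bounded_cball] by (auto simp: compact_eq_bounded_closed)
    show "closure {x. \<theta> x \<noteq> 0} \<subseteq> D"
      using cl sub KD ball_subset_cball[of x0 r] by blast
  qed
  define B where "B x = (norm (q x) powr (p - 2) *\<^sub>R q x) \<bullet> g x" for x
  have reg: "c1 \<le> (LINT x|lebesgue. (regularized_weight p t (q x) *\<^sub>R q x) \<bullet> g x)"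
      "integrable lebesgue (\<lambda>x. (regularized_weight p t (q x) *\<^sub>R q x) \<bullet> g x)"
    if t: "0 < t" "t < min t0 1" for t
  proof -
    have b: "x \<in> ball x0 R" if "x \<in> ball x0 r" for x using that r by auto
    have cH: "continuous_on (ball x0 r) (\<lambda>x. H x b)" for b
      using H by (rule continuous_on_subset) (use r in auto)
    have Lr: "normalized_p_laplacian p (H x) (q x /\<^sub>R sqrt (q x \<bullet> q x + t)) \<le> - c" if "x \<in> ball x0 r" for x
      using L[OF b[OF that]] t by simp
    have \<theta>0: "0 \<le> \<theta> x" for x by (simp add: \<theta>_def)
    have S\<theta>: "(s / 8)\<^sup>2 \<le> \<theta> x" if "x \<in> S" for x
    proof -
      have xb: "x \<in> ball x0 r" using Sb that by blast
      then have "x \<in> ?K" by auto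
      then have "s / 8 \<le> u x" using Sv[OF that] uv[of x] e by linarith
      then show ?thesis using xb s by (auto simp: \<theta>_def intro!: power_mono)
    qed
    have wS: "w \<le> regularized_weight p t (q x)" if "x \<in> S" for x using w_le[OF that] t by simp
    have s8: "0 < (s / 8)\<^sup>2" using s by simp
    note * = regularized_flux_integral_lower_bound[OF q[OF b] cH t(1) Lr c(1) d\<theta> cg \<theta>0 off(1) r'(1) Sm Sb wS S\<theta> w s8]
    show "c1 \<le> (LINT x|lebesgue. (regularized_weight p t (q x) *\<^sub>R q x) \<bullet> g x)"
      using *(1) by (simp add: c1_def)
    show "integrable lebesgue (\<lambda>x. (regularized_weight p t (q x) *\<^sub>R q x) \<bullet> g x)"
      using *(2) .
  qed
  have Qg: "norm (q x) \<le> Q" if "g x \<noteq> 0" for x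
    using that Q[of x] by (auto simp: g_def split: if_splits)
  have B: "c1 \<le> (LINT x|lebesgue. B x)" "integrable lebesgue B"
    using regularized_flux_integral_limit[OF p _ reg(2) reg(1) ig Qg, of "min t0 1"] c
    by (simp_all add: B_def[abs_def])
  define A where "A x = norm (G x) powr (p - 2) * (G x \<bullet> g x)" for x
  have goff: "g x = 0" if "x \<notin> ?K" for x using that by (simp add: g_def)
  have A_int0: "(LINT x|lebesgue. A x) = 0"
  proof -
    have "(LINT x:D|lebesgue. A x) = (LINT x|lebesgue. A x)"
    proof (rule set_integral_eq_integral_vanishing)
      fix x assume "x \<notin> D"
      then have "g x = 0" using goff[of x] KD by blast
      then show "A x = 0" by (simp add: A_def)
    qed
    then show ?thesis using weak[OF test] by (simp add: A_def[abs_def])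
  qed
  have iA: "integrable lebesgue A"
  proof -
    have "bounded (g ` ?K)"
      using continuous_on_subset[OF cg] by (intro compact_imp_bounded compact_continuous_image) auto
    then obtain M where M: "\<And>x. x \<in> ?K \<Longrightarrow> norm (g x) \<le> M"
      by (metis bounded_iff imageI)
    have M0: "0 \<le> M" using order_trans[OF norm_ge_zero M[of x0]] r by simp
    define GK where "GK x = indicator ?K x *\<^sub>R G x" for x
    have [measurable]: "GK \<in> borel_measurable lebesgue" using GKm by (simp add: GK_def[abs_def])
    have [measurable]: "g \<in> borel_measurable lebesgue" using ig by auto
    have eqA: "A = (\<lambda>x. norm (GK x) powr (p - 2) * (GK x \<bullet> g x))"
    proof
      show "A x = norm (GK x) powr (p - 2) * (GK x \<bullet> g x)" for x
        using goff[of x] by (cases "x \<in> ?K") (auto simp: A_def GK_def)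
    qed
    show ?thesis
    proof (rule Bochner_Integration.integrable_bound)
      show "integrable lebesgue (\<lambda>x. M * (indicator ?K x *\<^sub>R norm (G x) powr p + indicator ?K x))"
        using GKp iK by (intro integrable_mult_right Bochner_Integration.integrable_add)
      show "A \<in> borel_measurable lebesgue" unfolding eqA by measurable
      show "AE x in lebesgue. norm (A x) \<le> norm (M * (indicator ?K x *\<^sub>R norm (G x) powr p + indicator ?K x))"
      proof (rule AE_I2)
        fix x
        show "norm (A x) \<le> norm (M * (indicator ?K x *\<^sub>R norm (G x) powr p + indicator ?K x))"
        proof (cases "x \<in> ?K")
          case True
          have "\<bar>G x \<bullet> g x\<bar> \<le> norm (G x) * M"
            using Cauchy_Schwarz_ineq2[of "G x" "g x"] mult_left_mono[OF M[OF True] norm_ge_zero[of "G x"]] by linarith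
          then have "norm (A x) \<le> norm (G x) powr (p - 2) * (norm (G x) * M)"
            by (simp add: A_def abs_mult mult_left_mono)
          also have "\<dots> = norm (G x) powr (p - 1) * M"
            by (cases "G x = 0") (simp_all add: powr_diff power2_eq_square field_simps)
          also have "norm (G x) powr (p - 1) \<le> norm (G x) powr p + 1"
          proof (cases "1 \<le> norm (G x)")
            case True
            then have "norm (G x) powr (p - 1) \<le> norm (G x) powr p" by (intro powr_mono) auto
            then show ?thesis by simp
          next
            case False
            then have "norm (G x) powr (p - 1) \<le> 1 powr (p - 1)" using p by (intro powr_mono2) auto
            moreover have "0 \<le> norm (G x) powr p" by simp
            ultimately show ?thesis using powr_one_eq_one[of "p - 1"] by linarith
          qed
          finally show ?thesis using True M0 by (simp add: abs_mult mult_right_mono mult.commute)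
        qed (use goff[of x] M0 in \<open>simp add: A_def\<close>)
      qed
    qed
  qed
  \<comment> \<open>The flux difference is monotone up to the mollification error, and the factor
    \<open>2 * max 0 (u x)\<close> of the test gradient is at most \<open>s\<close>.\<close>
  have pt: "- (2 * s) * (indicator ?K x *\<^sub>R (E x powr (p - 1) * norm (q' x - G x))) \<le> A x - B x" for x
  proof (cases "x \<in> ball x0 r")
    case True
    define m2 where "m2 = 2 * max 0 (u x)"
    have m2: "0 \<le> m2" "m2 \<le> s" using u_le[OF True] by (auto simp: m2_def)
    have gx: "g x = m2 *\<^sub>R (q' x - q x)" using True by (simp add: g_def m2_def)
    have xK: "x \<in> ?K" using True by auto
    have T0: "0 \<le> 2 * E x powr (p - 1) * norm (q' x - G x)" by simp
    have "norm (G x) + norm (q x) \<le> E x" using Q[OF xK] by (simp add: E_def)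
    from p_flux_inner_lower_bound[OF p this, of "q' x"]
    have "m2 * - (2 * E x powr (p - 1) * norm (q' x - G x)) \<le>
      m2 * ((norm (G x) powr (p - 2) *\<^sub>R G x - norm (q x) powr (p - 2) *\<^sub>R q x) \<bullet> (q' x - q x))"
      using m2(1) by (rule mult_left_mono)
    also have "\<dots> = A x - B x"
      by (simp add: A_def B_def gx inner_diff_left algebra_simps)
    finally have "- (m2 * (2 * E x powr (p - 1) * norm (q' x - G x))) \<le> A x - B x" by simp
    moreover have "m2 * (2 * E x powr (p - 1) * norm (q' x - G x)) \<le> s * (2 * E x powr (p - 1) * norm (q' x - G x))"
      using m2(2) T0 by (rule mult_right_mono)
    ultimately show ?thesis using xK by (simp add: mult.assoc mult.left_commute)
  next
    case False
    then show ?thesis using s by (simp add: A_def B_def g_def)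
  qed
  have "- (2 * s) * (LINT x:?K|lebesgue. E x powr (p - 1) * norm (q' x - G x)) \<le> (LINT x|lebesgue. A x - B x)"
  proof -
    have "(LINT x|lebesgue. - (2 * s) * (indicator ?K x *\<^sub>R (E x powr (p - 1) * norm (q' x - G x))))
        \<le> (LINT x|lebesgue. A x - B x)"
      using iE iA B(2) unfolding set_integrable_def
      by (intro integral_mono integrable_mult_right Bochner_Integration.integrable_diff pt)
    then show ?thesis by (simp only: set_lebesgue_integral_def integral_mult_right_zero)
  qed
  also have "(LINT x|lebesgue. A x - B x) = - (LINT x|lebesgue. B x)"
    using iA B(2) A_int0 by simp
  finally have "c1 \<le> 2 * s * (LINT x:?K|lebesgue. E x powr (p - 1) * norm (q' x - G x))"
    using B(1) by simp
  also have "\<dots> \<le> 2 * s * e" using sE s by (intro mult_left_mono) auto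
  finally show False using e(3) by simp
qed

section \<open>Viscosity comparison\<close>

text \<open>The first alternative asks for strictness in every direction \<open>n\<close> and therefore also makes sense at
  critical points of \<open>\<phi>\<close>; only the fundamental solution needs the second one.\<close>
definition strict_p_supersolution_at :: "real \<Rightarrow> ('a::euclidean_space \<Rightarrow> real) \<Rightarrow> 'a \<Rightarrow> bool" where
  "strict_p_supersolution_at p \<phi> x0 \<longleftrightarrow> (\<exists>q H r. 0 < r \<and>
     (\<forall>x\<in>ball x0 r. (\<phi> has_derivative (\<lambda>v. q x \<bullet> v)) (at x) \<and> (q has_derivative H x) (at x)) \<and>
     (\<forall>b. continuous_on (ball x0 r) (\<lambda>x. H x b)) \<and>
     ((\<exists>c>0. \<forall>n. norm n \<le> 1 \<longrightarrow> normalized_p_laplacian p (H x0) n \<le> - c) \<or>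
      q x0 \<noteq> 0 \<and> normalized_p_laplacian p (H x0) (sgn (q x0)) < 0))"

lemma normalized_p_laplacian_diff_le:
  fixes H H' :: "'a::euclidean_space \<Rightarrow> 'a"
  assumes "linear H" "linear H'" "norm n \<le> 1"
  shows "normalized_p_laplacian p H n - normalized_p_laplacian p H' n
    \<le> (1 + \<bar>p - 2\<bar>) * (\<Sum>b\<in>Basis. norm (H b - H' b))"
proof -
  let ?M = "\<Sum>b\<in>Basis. norm (H b - H' b)"
  have tr: "(\<Sum>b\<in>Basis. H b \<bullet> b) - (\<Sum>b\<in>Basis. H' b \<bullet> b) \<le> ?M"
  proof -
    have "(\<Sum>b\<in>Basis. H b \<bullet> b) - (\<Sum>b\<in>Basis. H' b \<bullet> b) = (\<Sum>b\<in>Basis. (H b - H' b) \<bullet> b)"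
      by (simp add: sum_subtractf inner_diff_left)
    also have "\<dots> \<le> ?M"
    proof (rule sum_mono)
      fix b :: 'a assume "b \<in> Basis"
      then show "(H b - H' b) \<bullet> b \<le> norm (H b - H' b)"
        using norm_cauchy_schwarz[of "H b - H' b" b] by simp
    qed
    finally show ?thesis .
  qed
  have "H n - H' n = (\<Sum>b\<in>Basis. (n \<bullet> b) *\<^sub>R (H b - H' b))"
    using linear_sum[OF assms(1), of "\<lambda>b. (n \<bullet> b) *\<^sub>R b" Basis] linear_scale[OF assms(1)]
      linear_sum[OF assms(2), of "\<lambda>b. (n \<bullet> b) *\<^sub>R b" Basis] linear_scale[OF assms(2)]
    by (simp add: euclidean_representation scaleR_diff_right sum_subtractf)
  also have "norm \<dots> \<le> ?M"
  proof (rule sum_norm_le)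
    fix b :: 'a assume "b \<in> Basis"
    then have "\<bar>n \<bullet> b\<bar> \<le> 1" using Basis_le_norm[of b n] assms(3) by linarith
    then show "norm ((n \<bullet> b) *\<^sub>R (H b - H' b)) \<le> norm (H b - H' b)"
      by (simp add: mult_left_le_one_le)
  qed
  finally have HM: "norm (H n - H' n) \<le> ?M" .
  have "\<bar>n \<bullet> (H n - H' n)\<bar> \<le> norm n * norm (H n - H' n)" by (rule Cauchy_Schwarz_ineq2)
  also have "\<dots> \<le> 1 * ?M" using assms(3) HM by (intro mult_mono) auto
  finally have "\<bar>(p - 2) * (n \<bullet> (H n - H' n))\<bar> \<le> \<bar>p - 2\<bar> * ?M"
    by (simp add: abs_mult mult_left_mono)
  then have "(p - 2) * (n \<bullet> H n) - (p - 2) * (n \<bullet> H' n) \<le> \<bar>p - 2\<bar> * ?M"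
    by (simp add: inner_diff_right right_diff_distrib)
  with tr show ?thesis
    by (simp add: normalized_p_laplacian_def algebra_simps)
qed

lemma normalized_p_laplacian_add_scaleR:
  "normalized_p_laplacian p (\<lambda>v. H v + c *\<^sub>R v) (n::'a::euclidean_space)
    = normalized_p_laplacian p H n + c * (DIM('a) + (p - 2) * (norm n)\<^sup>2)"
proof -
  have "(\<Sum>b\<in>(Basis :: 'a set). c * (b \<bullet> b)) = (\<Sum>b\<in>(Basis :: 'a set). c)"
    by (rule sum.cong) auto
  then have tr: "(\<Sum>b\<in>Basis. (H b + c *\<^sub>R b) \<bullet> b) = (\<Sum>b\<in>Basis. H b \<bullet> b) + c * DIM('a)"
    by (simp add: inner_add_left sum.distrib)
  have "n \<bullet> (H n + c *\<^sub>R n) = n \<bullet> H n + c * (norm n)\<^sup>2"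
    by (simp add: inner_add_right power2_norm_eq_inner)
  then show ?thesis
    unfolding normalized_p_laplacian_def tr by (simp only: algebra_simps)
qed

lemma norm_regularized_direction_le_one:
  assumes "0 < t"
  shows "norm (z /\<^sub>R sqrt (z \<bullet> z + t)) \<le> 1"
proof -
  have "norm z \<le> sqrt (z \<bullet> z + t)" unfolding norm_eq_sqrt_inner using assms by simp
  moreover have "0 < z \<bullet> z + t" using assms by (simp add: add_nonneg_pos)
  ultimately show ?thesis by (simp add: field_simps)
qed

text \<open>Strictness at the single point \<open>x0\<close> yields a uniform margin for nearby
  \<open>x\<close> and small \<open>t\<close>. In the second alternative the regularised direction
  converges to \<open>sgn (q x0)\<close> as \<open>(x, t)\<close> tends to \<open>(x0, 0)\<close>,
  which rests on \<open>q x0 \<noteq> 0\<close>. Variation of the Hessian is controlled uniformly in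
  the direction.\<close>

lemma strict_supersolution_neighbourhood:
  fixes q :: "'a::euclidean_space \<Rightarrow> 'a"
  assumes r: "0 < r" and q: "\<And>x. x \<in> ball x0 r \<Longrightarrow> (q has_derivative H x) (at x)"
    and H: "\<And>b. continuous_on (ball x0 r) (\<lambda>x. H x b)"
    and strict: "(\<exists>c>0. \<forall>n. norm n \<le> 1 \<longrightarrow> normalized_p_laplacian p (H x0) n \<le> - c) \<or>
      q x0 \<noteq> 0 \<and> normalized_p_laplacian p (H x0) (sgn (q x0)) < 0"
  obtains r1 t0 c where "0 < r1" "r1 \<le> r" "0 < t0" "0 < c"
    "\<And>x t. x \<in> ball x0 r1 \<Longrightarrow> 0 < t \<Longrightarrow> t < t0 \<Longrightarrow>
      normalized_p_laplacian p (H x) (q x /\<^sub>R sqrt (q x \<bullet> q x + t)) \<le> - c"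
proof -
  let ?F = "nhds x0 \<times>\<^sub>F at_right (0::real)"
  let ?n = "\<lambda>z. q (fst z) /\<^sub>R sqrt (q (fst z) \<bullet> q (fst z) + snd z)"
  have x0: "x0 \<in> ball x0 r" using r by simp
  have lin: "linear (H x)" if "x \<in> ball x0 r" for x
    using has_derivative_linear[OF q[OF that]] .
  have fst: "filterlim fst (nhds x0) ?F" by (rule filterlim_fst)
  have snd: "(snd \<longlongrightarrow> 0) ?F"
    using filterlim_snd[of "at_right (0::real)" "nhds x0"] by (rule filterlim_mono) (auto simp: at_within_le_nhds)
  have snd0: "\<forall>\<^sub>F z in ?F. 0 < snd z"
    using filterlim_snd[of "at_right (0::real)" "nhds x0"] eventually_at_right_less[of "0::real"]
    by (auto simp: filterlim_iff)
  have "\<exists>c>0. \<forall>\<^sub>F z in ?F. normalized_p_laplacian p (H x0) (?n z) < - c"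
  proof (cases "\<exists>c>0. \<forall>n. norm n \<le> 1 \<longrightarrow> normalized_p_laplacian p (H x0) n \<le> - c")
    case True
    then obtain c where c: "0 < c" "\<And>n. norm n \<le> 1 \<Longrightarrow> normalized_p_laplacian p (H x0) n \<le> - c" by blast
    have "\<forall>\<^sub>F z in ?F. normalized_p_laplacian p (H x0) (?n z) < - (c / 2)"
      using snd0
    proof eventually_elim
      case (elim z)
      show ?case using c(2)[OF norm_regularized_direction_le_one[OF elim]] c(1) by (smt (verit) field_sum_of_halves)
    qed
    then show ?thesis using c(1) half_gt_zero by blast
  next
    case False
    with strict have s: "q x0 \<noteq> 0" "normalized_p_laplacian p (H x0) (sgn (q x0)) < 0" by auto
    define c where "c = - normalized_p_laplacian p (H x0) (sgn (q x0)) / 2"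
    have c: "0 < c" "normalized_p_laplacian p (H x0) (sgn (q x0)) < - c" using s by (auto simp: c_def)
    have "(q \<longlongrightarrow> q x0) (nhds x0)"
      using has_derivative_continuous[OF q[OF x0]] by (simp add: continuous_at tendsto_at_iff_tendsto_nhds)
    then have qlim: "((\<lambda>z. q (fst z)) \<longlongrightarrow> q x0) ?F"
      using fst by (rule filterlim_compose)
    have "(?n \<longlongrightarrow> q x0 /\<^sub>R sqrt (q x0 \<bullet> q x0 + 0)) ?F"
      using s(1) by (intro tendsto_intros qlim snd) auto
    moreover have "q x0 /\<^sub>R sqrt (q x0 \<bullet> q x0 + 0) = sgn (q x0)"
      by (simp add: sgn_div_norm norm_eq_sqrt_inner)
    ultimately have nlim: "(?n \<longlongrightarrow> sgn (q x0)) ?F" by simp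
    have "((\<lambda>z. H x0 (?n z)) \<longlongrightarrow> H x0 (sgn (q x0))) ?F"
      using has_derivative_bounded_linear[OF q[OF x0]] nlim by (rule bounded_linear.tendsto)
    then have "((\<lambda>z. normalized_p_laplacian p (H x0) (?n z)) \<longlongrightarrow> normalized_p_laplacian p (H x0) (sgn (q x0))) ?F"
      unfolding normalized_p_laplacian_def by (intro tendsto_intros nlim)
    then show ?thesis using c order_tendstoD(2) by blast
  qed
  then obtain c where c: "0 < c" "\<forall>\<^sub>F z in ?F. normalized_p_laplacian p (H x0) (?n z) < - c" by blast
  define M where "M x = (1 + \<bar>p - 2\<bar>) * (\<Sum>b\<in>Basis. norm (H x b - H x0 b))" for x
  have "isCont (\<lambda>x. H x b) x0" for b
    using H x0 by (metis continuous_on_eq_continuous_at open_ball)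
  then have "((\<lambda>x. H x b) \<longlongrightarrow> H x0 b) (nhds x0)" for b
    using tendsto_at_iff_tendsto_nhds[of "\<lambda>x. H x b" x0] by (simp add: continuous_at)
  then have "(M \<longlongrightarrow> (1 + \<bar>p - 2\<bar>) * (\<Sum>b\<in>(Basis::'a set). norm (H x0 b - H x0 b))) (nhds x0)"
    unfolding M_def by (intro tendsto_intros)
  then have "(M \<longlongrightarrow> 0) (nhds x0)" by simp
  then have "((\<lambda>z. M (fst z)) \<longlongrightarrow> 0) ?F" using fst by (rule filterlim_compose)
  then have Mc: "\<forall>\<^sub>F z in ?F. M (fst z) < c / 2"
    using c(1) by (intro order_tendstoD(2)[of _ 0]) auto
  have inb: "\<forall>\<^sub>F z in ?F. fst z \<in> ball x0 r"
    using fst eventually_nhds_in_open[OF open_ball x0] by (auto simp: filterlim_iff)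
  have "\<forall>\<^sub>F z in ?F. normalized_p_laplacian p (H (fst z)) (?n z) \<le> - (c / 2)"
    using c(2) Mc inb snd0
  proof eventually_elim
    case (elim z)
    have "normalized_p_laplacian p (H (fst z)) (?n z) - normalized_p_laplacian p (H x0) (?n z) \<le> M (fst z)"
      unfolding M_def
      by (rule normalized_p_laplacian_diff_le[OF lin[OF elim(3)] lin[OF x0] norm_regularized_direction_le_one[OF elim(4)]])
    then show ?case using elim(1,2) by (smt (verit) field_sum_of_halves)
  qed
  then obtain P Q where P: "\<forall>\<^sub>F x in nhds x0. P x" and Q: "\<forall>\<^sub>F t in at_right 0. Q t"
    and PQ: "\<And>x t. P x \<Longrightarrow> Q t \<Longrightarrow> normalized_p_laplacian p (H x) (?n (x, t)) \<le> - (c / 2)"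
    unfolding eventually_prod_filter by auto
  obtain r1 where r1: "0 < r1" "\<And>x. dist x x0 < r1 \<Longrightarrow> P x"
    using P unfolding eventually_nhds_metric by blast
  obtain t0 where t0: "0 < t0" "\<And>t. 0 < t \<Longrightarrow> t < t0 \<Longrightarrow> Q t"
    using Q unfolding eventually_at_right_field by auto
  show thesis
  proof (rule that)
    show "0 < min r r1" "min r r1 \<le> r" "0 < t0" "0 < c / 2" using r r1 t0 c by auto
    fix x t assume "x \<in> ball x0 (min r r1)" "0 < t" "t < t0"
    then show "normalized_p_laplacian p (H x) (q x /\<^sub>R sqrt (q x \<bullet> q x + t)) \<le> - (c / 2)"
      using PQ[of x t] r1(2)[of x] t0(2)[of t] by (simp add: dist_commute)
  qed
qed

text \<open>Adding \<open>k * (norm (x - x0))\<^sup>2\<close> to \<phi> makes the maximum strict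
  without changing value or gradient at \<open>x0\<close>. The Hessian grows by \<open>2 * k\<close>
  times the identity, which the strict inequality absorbs for small \<open>k\<close>.\<close>

lemma p_harmonic_viscosity_subsolution:
  fixes h \<phi> :: "'a::euclidean_space \<Rightarrow> real"
  assumes p: "1 < p" and D: "open D" "x0 \<in> D" and h: "p_harmonic p D h"
    and \<phi>: "strict_p_supersolution_at p \<phi> x0"
    and max: "\<forall>\<^sub>F x in nhds x0. h x - \<phi> x \<le> h x0 - \<phi> x0"
  shows False
proof -
  obtain q H r where r: "0 < r"
    and d\<phi>: "\<And>x. x \<in> ball x0 r \<Longrightarrow> (\<phi> has_derivative (\<lambda>v. q x \<bullet> v)) (at x)"
    and dq: "\<And>x. x \<in> ball x0 r \<Longrightarrow> (q has_derivative H x) (at x)"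
    and cH: "\<And>b. continuous_on (ball x0 r) (\<lambda>x. H x b)"
    and strict: "(\<exists>c>0. \<forall>n. norm n \<le> 1 \<longrightarrow> normalized_p_laplacian p (H x0) n \<le> - c) \<or>
      q x0 \<noteq> 0 \<and> normalized_p_laplacian p (H x0) (sgn (q x0)) < 0"
    using \<phi> unfolding strict_p_supersolution_at_def by blast
  \<comment> \<open>\<open>c * K\<close> bounds the increase of the operator when \<open>c\<close>
    times the identity is added, so \<open>k = c / (4 * K)\<close> spends half of a margin
    \<open>c\<close>.\<close>
  define K where "K = real DIM('a) + \<bar>p - 2\<bar>"
  have K: "0 < K" by (simp add: K_def add_pos_nonneg)
  have KL: "normalized_p_laplacian p (\<lambda>v. H x0 v + c *\<^sub>R v) n \<le> normalized_p_laplacian p (H x0) n + c * K"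
    if "0 \<le> c" "norm n \<le> 1" for c n
  proof -
    have "(norm n)\<^sup>2 \<le> 1" using that(2) by (simp add: power_le_one)
    then have "(p - 2) * (norm n)\<^sup>2 \<le> \<bar>p - 2\<bar> * 1"
      by (intro mult_mono) auto
    then show ?thesis
      using that(1) by (simp add: normalized_p_laplacian_add_scaleR K_def mult_left_mono)
  qed
  obtain k where k: "0 < k" and strict': "(\<exists>c>0. \<forall>n. norm n \<le> 1 \<longrightarrow> normalized_p_laplacian p (\<lambda>v. H x0 v + (2 * k) *\<^sub>R v) n \<le> - c) \<or>
      q x0 \<noteq> 0 \<and> normalized_p_laplacian p (\<lambda>v. H x0 v + (2 * k) *\<^sub>R v) (sgn (q x0)) < 0"
    using strict
  proof (elim disjE exE conjE)
    fix c assume c: "0 < c" "\<forall>n. norm n \<le> 1 \<longrightarrow> normalized_p_laplacian p (H x0) n \<le> - c"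
    have "normalized_p_laplacian p (\<lambda>v. H x0 v + (2 * (c / (4 * K))) *\<^sub>R v) n \<le> - (c / 2)" if "norm n \<le> 1" for n
      using KL[OF _ that, of "2 * (c / (4 * K))"] c K that by (force simp: field_simps)
    then show thesis using that[of "c / (4 * K)"] c(1) K by (metis divide_pos_pos half_gt_zero mult_pos_pos zero_less_numeral)
  next
    assume s: "q x0 \<noteq> 0" "normalized_p_laplacian p (H x0) (sgn (q x0)) < 0"
    define c where "c = - normalized_p_laplacian p (H x0) (sgn (q x0))"
    have c: "0 < c" using s by (simp add: c_def)
    have "normalized_p_laplacian p (\<lambda>v. H x0 v + (2 * (c / (4 * K))) *\<^sub>R v) (sgn (q x0)) < 0"
      using KL[of "2 * (c / (4 * K))" "sgn (q x0)"] c K s(1) by (simp add: norm_sgn c_def field_simps)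
    then show thesis using that[of "c / (4 * K)"] c K s(1) by simp
  qed
  define \<phi>' where "\<phi>' x = \<phi> x + k * ((x - x0) \<bullet> (x - x0))" for x
  define q' where "q' x = q x + (2 * k) *\<^sub>R (x - x0)" for x
  define H' where "H' x v = H x v + (2 * k) *\<^sub>R v" for x v
  have d\<phi>': "(\<phi>' has_derivative (\<lambda>v. q' x \<bullet> v)) (at x)" if "x \<in> ball x0 r" for x
    unfolding \<phi>'_def[abs_def] q'_def
    by (rule derivative_eq_intros d\<phi>[OF that] refl)+ (simp add: fun_eq_iff inner_add_left inner_diff_left inner_diff_right inner_commute algebra_simps)
  have dq': "(q' has_derivative H' x) (at x)" if "x \<in> ball x0 r" for x
    unfolding q'_def[abs_def] H'_def
    by (rule derivative_eq_intros dq[OF that] refl)+ auto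
  have cH': "continuous_on (ball x0 r) (\<lambda>x. H' x b)" for b
    unfolding H'_def by (intro continuous_intros cH)
  have s': "(\<exists>c>0. \<forall>n. norm n \<le> 1 \<longrightarrow> normalized_p_laplacian p (H' x0) n \<le> - c) \<or>
      q' x0 \<noteq> 0 \<and> normalized_p_laplacian p (H' x0) (sgn (q' x0)) < 0"
    using strict' by (simp add: H'_def[abs_def] q'_def)
  obtain r1 t0 c where r1: "0 < r1" "r1 \<le> r" and t0: "0 < t0" and c: "0 < c"
    and L: "\<And>x t. x \<in> ball x0 r1 \<Longrightarrow> 0 < t \<Longrightarrow> t < t0 \<Longrightarrow>
      normalized_p_laplacian p (H' x) (q' x /\<^sub>R sqrt (q' x \<bullet> q' x + t)) \<le> - c"
    using strict_supersolution_neighbourhood[OF r dq' cH' s'] by blast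
  obtain e where e: "0 < e" "\<And>x. dist x x0 < e \<Longrightarrow> h x - \<phi> x \<le> h x0 - \<phi> x0"
    using max unfolding eventually_nhds_metric by blast
  obtain a b where ab: "x0 \<in> box a b" "cbox a b \<subseteq> D"
    using open_contains_cbox[OF D] by metis
  obtain r2 where r2: "0 < r2" "cball x0 r2 \<subseteq> box a b"
    using open_contains_cball[of "box a b"] ab(1) open_box by blast
  define \<rho> where "\<rho> = min r2 (min (e / 2) (r1 / 2))"
  have \<rho>: "0 < \<rho>" "\<rho> < r1" "\<rho> < e" "\<rho> \<le> r2" using r2 e r1 by (auto simp: \<rho>_def)
  have b1: "x \<in> ball x0 r" if "x \<in> ball x0 r1" for x using that r1 by auto
  show False
  proof (rule p_harmonic_no_strict_touching[OF p D(1) h \<rho>(1,2) _ ab(2) d\<phi>'[OF b1] dq'[OF b1] _ L c t0 k])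
    show "cball x0 \<rho> \<subseteq> box a b" using r2(2) subset_cball[OF \<rho>(4), of x0] by blast
    show "continuous_on (ball x0 r1) (\<lambda>x. H' x b)" for b
      using cH' by (rule continuous_on_subset) (use r1 in auto)
    show "h x - \<phi>' x \<le> h x0 - \<phi>' x0 - k * (dist x0 x)\<^sup>2" if "x \<in> cball x0 \<rho>" for x
    proof -
      have "dist x0 x = norm (x - x0)" by (simp add: dist_norm norm_minus_commute)
      then have "(dist x0 x)\<^sup>2 = (x - x0) \<bullet> (x - x0)" by (simp only: power2_norm_eq_inner)
      moreover have "h x - \<phi> x \<le> h x0 - \<phi> x0"
        using that \<rho>(3) by (intro e(2)) (simp add: dist_commute)
      ultimately show ?thesis by (simp add: \<phi>'_def)
    qed
  qed
qed

text \<open>If comparison failed, \<open>h - v\<close> would have an interior maximum at some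
  \<open>x0\<close>; as \<phi> equals \<open>v\<close> there and lies above it nearby,
  \<open>h - \<phi>\<close> has a local maximum too, which is excluded for p-harmonic
  \<open>h\<close>. Touching from above is stable under minima, and that permits gluing.\<close>

lemma p_superharmonic_if_touched_above:
  fixes v :: "'a::euclidean_space \<Rightarrow> real"
  assumes p: "1 < p" and \<Omega>: "open \<Omega>" and v: "continuous_on \<Omega> v"
    and touch: "\<And>x0. x0 \<in> \<Omega> \<Longrightarrow> \<exists>\<phi>. \<phi> x0 = v x0 \<and> (\<forall>\<^sub>F x in nhds x0. v x \<le> \<phi> x) \<and>
      strict_p_supersolution_at p \<phi> x0"
  shows "p_superharmonic p \<Omega> (\<lambda>x. ereal (v x))"
  unfolding p_superharmonic_def
proof (intro conjI ballI allI impI)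
  fix x assume x: "x \<in> \<Omega>"
  have "(v \<longlongrightarrow> v x) (at x within \<Omega>)" using v x by (simp add: continuous_on)
  then have "((\<lambda>x. ereal (v x)) \<longlongrightarrow> ereal (v x)) (at x within \<Omega>)" by simp
  moreover have "at x within \<Omega> \<noteq> bot" using at_within_open[OF x \<Omega>] at_neq_bot by metis
  ultimately show "ereal (v x) \<le> Liminf (at x within \<Omega>) (\<lambda>x. ereal (v x))"
    by (metis lim_imp_Liminf order_refl)
next
  fix C assume "C \<in> components \<Omega>"
  then show "\<exists>x\<in>C. ereal (v x) \<noteq> \<infinity>" using in_components_nonempty by fastforce
next
  fix D h x
  assume A: "open D \<and> compact (closure D) \<and> closure D \<subseteq> \<Omega> \<and> continuous_on (closure D) h \<and>
    p_harmonic p D h \<and> (\<forall>x\<in>frontier D. ereal (h x) \<le> ereal (v x))" and x: "x \<in> D"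
  show "ereal (h x) \<le> ereal (v x)"
  proof (rule ccontr)
    assume "\<not> ereal (h x) \<le> ereal (v x)"
    then have gt: "0 < h x - v x" by simp
    have "continuous_on (closure D) (\<lambda>y. h y - v y)"
      using A v by (intro continuous_intros) (auto intro: continuous_on_subset)
    moreover have "closure D \<noteq> {}" using x closure_subset[of D] by blast
    ultimately obtain x0 where x0: "x0 \<in> closure D" "\<And>y. y \<in> closure D \<Longrightarrow> h y - v y \<le> h x0 - v x0"
      using continuous_attains_sup[of "closure D" "\<lambda>y. h y - v y"] A by blast
    have "h x - v x \<le> h x0 - v x0" using x0(2) x closure_subset[of D] by blast
    then have "x0 \<notin> frontier D" using gt A by force
    then have x0D: "x0 \<in> D" using x0(1) A by (simp add: frontier_def interior_open)
    then have "x0 \<in> \<Omega>" using A closure_subset[of D] by blast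
    from touch[OF this] obtain \<phi> where \<phi>: "\<phi> x0 = v x0" "\<forall>\<^sub>F x in nhds x0. v x \<le> \<phi> x"
      "strict_p_supersolution_at p \<phi> x0" by blast
    have "\<forall>\<^sub>F y in nhds x0. y \<in> D" using A x0D by (intro eventually_nhds_in_open) auto
    with \<phi>(2) have "\<forall>\<^sub>F y in nhds x0. h y - \<phi> y \<le> h x0 - \<phi> x0"
    proof eventually_elim
      case (elim y)
      then show ?case using x0(2)[of y] closure_subset[of D] \<phi>(1) by fastforce
    qed
    then show False
      using p_harmonic_viscosity_subsolution[OF p _ x0D _ \<phi>(3)] A by blast
  qed
qed auto

subsection \<open>Radial strict supersolutions\<close>

text \<open>Gradient and Hessian are explicit arguments, so that sums and multiples act on formulas
  into which the operator can be inserted.\<close>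

definition C2_data :: "'a::euclidean_space set \<Rightarrow> ('a \<Rightarrow> real) \<Rightarrow> ('a \<Rightarrow> 'a) \<Rightarrow> ('a \<Rightarrow> 'a \<Rightarrow> 'a) \<Rightarrow> bool" where
  "C2_data U \<phi> q H \<longleftrightarrow>
     (\<forall>x\<in>U. (\<phi> has_derivative (\<lambda>v. q x \<bullet> v)) (at x) \<and> (q has_derivative H x) (at x)) \<and>
     (\<forall>b. continuous_on U (\<lambda>x. H x b))"

lemma strict_p_supersolution_atI:
  assumes "open U" "x0 \<in> U" "C2_data U \<phi> q H"
    and "(\<exists>c>0. \<forall>n. norm n \<le> 1 \<longrightarrow> normalized_p_laplacian p (H x0) n \<le> - c) \<or>
      q x0 \<noteq> 0 \<and> normalized_p_laplacian p (H x0) (sgn (q x0)) < 0"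
  shows "strict_p_supersolution_at p \<phi> x0"
proof -
  obtain r where r: "0 < r" "ball x0 r \<subseteq> U"
    using assms(1,2) open_contains_ball by blast
  then show ?thesis
    using assms(3,4) unfolding strict_p_supersolution_at_def C2_data_def
    by (intro exI[of _ q] exI[of _ H] exI[of _ r]) (auto intro: continuous_on_subset)
qed

lemma C2_data_add:
  assumes "C2_data U \<phi>1 q1 H1" "C2_data U \<phi>2 q2 H2"
  shows "C2_data U (\<lambda>x. \<phi>1 x + \<phi>2 x) (\<lambda>x. q1 x + q2 x) (\<lambda>x v. H1 x v + H2 x v)"
proof -
  have "((\<lambda>x. \<phi>1 x + \<phi>2 x) has_derivative (\<lambda>v. (q1 x + q2 x) \<bullet> v)) (at x)" if "x \<in> U" for x
    using has_derivative_add[of \<phi>1 "\<lambda>v. q1 x \<bullet> v" "at x" \<phi>2 "\<lambda>v. q2 x \<bullet> v"] assms that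
    by (auto simp: C2_data_def inner_add_left)
  moreover have "((\<lambda>x. q1 x + q2 x) has_derivative (\<lambda>v. H1 x v + H2 x v)) (at x)" if "x \<in> U" for x
    using assms that unfolding C2_data_def by (intro has_derivative_add) auto
  moreover have "continuous_on U (\<lambda>x. H1 x b + H2 x b)" for b
    using assms unfolding C2_data_def by (intro continuous_on_add) auto
  ultimately show ?thesis unfolding C2_data_def by blast
qed

lemma C2_data_scale:
  assumes "C2_data U \<phi> q H"
  shows "C2_data U (\<lambda>x. c * \<phi> x) (\<lambda>x. c *\<^sub>R q x) (\<lambda>x v. c *\<^sub>R H x v)"
proof -
  have "((\<lambda>x. c * \<phi> x) has_derivative (\<lambda>v. (c *\<^sub>R q x) \<bullet> v)) (at x)" if "x \<in> U" for x
    using has_derivative_mult_right[of \<phi> "\<lambda>v. q x \<bullet> v" "at x" c] assms that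
    by (auto simp: C2_data_def)
  moreover have "((\<lambda>x. c *\<^sub>R q x) has_derivative (\<lambda>v. c *\<^sub>R H x v)) (at x)" if "x \<in> U" for x
    using assms that unfolding C2_data_def by (intro has_derivative_scaleR_right) auto
  moreover have "continuous_on U (\<lambda>x. c *\<^sub>R H x b)" for b
    using assms unfolding C2_data_def by (intro continuous_intros) auto
  ultimately show ?thesis unfolding C2_data_def by blast
qed

lemma normalized_p_laplacian_add:
  "normalized_p_laplacian p (\<lambda>v. H1 v + H2 v) n = normalized_p_laplacian p H1 n + normalized_p_laplacian p H2 n"
  by (simp add: normalized_p_laplacian_def inner_add_left inner_add_right sum.distrib distrib_left)

lemma normalized_p_laplacian_scale:
  "normalized_p_laplacian p (\<lambda>v. c *\<^sub>R H v) n = c * normalized_p_laplacian p H n"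
proof -
  have "(\<Sum>b\<in>Basis. (c *\<^sub>R H b) \<bullet> b) = c * (\<Sum>b\<in>Basis. H b \<bullet> b)"
    by (simp add: sum_distrib_left)
  then show ?thesis
    unfolding normalized_p_laplacian_def by (simp add: distrib_left mult.left_commute)
qed

text \<open>A positive factor scales the operator and preserves the gradient direction; this is what
  allows the barrier to be lifted and normalised at the very end.\<close>

lemma strict_p_supersolution_at_affine:
  assumes "strict_p_supersolution_at p \<phi> x0" "0 < m"
  shows "strict_p_supersolution_at p (\<lambda>x. m * (k + \<phi> x)) x0"
proof -
  obtain q H r where r: "0 < r"
    and d: "\<And>x. x \<in> ball x0 r \<Longrightarrow> (\<phi> has_derivative (\<lambda>v. q x \<bullet> v)) (at x)"
      "\<And>x. x \<in> ball x0 r \<Longrightarrow> (q has_derivative H x) (at x)"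
      "\<And>b. continuous_on (ball x0 r) (\<lambda>x. H x b)"
    and strict: "(\<exists>c>0. \<forall>n. norm n \<le> 1 \<longrightarrow> normalized_p_laplacian p (H x0) n \<le> - c) \<or>
      q x0 \<noteq> 0 \<and> normalized_p_laplacian p (H x0) (sgn (q x0)) < 0"
    using assms(1) unfolding strict_p_supersolution_at_def by blast
  have "((\<lambda>x. k + \<phi> x) has_derivative (\<lambda>v. q x \<bullet> v)) (at x)" if "x \<in> ball x0 r" for x
    using has_derivative_add[OF has_derivative_const d(1)[OF that]] by simp
  with d have "C2_data (ball x0 r) (\<lambda>x. k + \<phi> x) q H" unfolding C2_data_def by blast
  then have C: "C2_data (ball x0 r) (\<lambda>x. m * (k + \<phi> x)) (\<lambda>x. m *\<^sub>R q x) (\<lambda>x v. m *\<^sub>R H x v)"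
    by (rule C2_data_scale)
  have "(\<exists>c>0. \<forall>n. norm n \<le> 1 \<longrightarrow> normalized_p_laplacian p (\<lambda>v. m *\<^sub>R H x0 v) n \<le> - c) \<or>
      m *\<^sub>R q x0 \<noteq> 0 \<and> normalized_p_laplacian p (\<lambda>v. m *\<^sub>R H x0 v) (sgn (m *\<^sub>R q x0)) < 0"
    using strict
  proof (elim disjE exE conjE)
    fix c assume c: "0 < c" "\<forall>n. norm n \<le> 1 \<longrightarrow> normalized_p_laplacian p (H x0) n \<le> - c"
    have "normalized_p_laplacian p (\<lambda>v. m *\<^sub>R H x0 v) n \<le> - (m * c)" if "norm n \<le> 1" for n
      using mult_left_mono[of "normalized_p_laplacian p (H x0) n" "- c" m] c(2) that assms(2)
      by (simp add: normalized_p_laplacian_scale)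
    then show ?thesis using c(1) assms(2) mult_pos_pos by blast
  next
    assume "q x0 \<noteq> 0" "normalized_p_laplacian p (H x0) (sgn (q x0)) < 0"
    then show ?thesis using assms(2)
      by (simp add: normalized_p_laplacian_scale sgn_scaleR mult_pos_neg)
  qed
  then show ?thesis using strict_p_supersolution_atI[OF open_ball _ C] r by simp
qed

text \<open>Hessian of \<open>\<eta> (norm y)\<close> with tangential eigenvalue
  \<open>a = \<eta>' r / r\<close> and radial eigenvalue \<open>b = \<eta>'' r\<close>, where
  \<open>r = norm y\<close>.\<close>

definition radial_hessian :: "'a::euclidean_space \<Rightarrow> real \<Rightarrow> real \<Rightarrow> 'a \<Rightarrow> 'a" where
  "radial_hessian y a b v = a *\<^sub>R v + ((b - a) / (norm y)\<^sup>2 * (y \<bullet> v)) *\<^sub>R y"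

lemma C2_data_radial:
  fixes c :: "'a::euclidean_space"
  assumes "\<And>r. 0 < r \<Longrightarrow> (\<eta> has_real_derivative \<eta>' r) (at r)"
    "\<And>r. 0 < r \<Longrightarrow> (\<eta>' has_real_derivative \<eta>'' r) (at r)" "continuous_on {0<..} \<eta>''"
  shows "C2_data (- {c}) (\<lambda>x. \<eta> (norm (x - c))) (\<lambda>x. (\<eta>' (norm (x - c)) / norm (x - c)) *\<^sub>R (x - c))
    (\<lambda>x. radial_hessian (x - c) (\<eta>' (norm (x - c)) / norm (x - c)) (\<eta>'' (norm (x - c))))"
  unfolding C2_data_def
proof (intro conjI ballI allI)
  fix x assume "x \<in> - {c}"
  then have x: "x - c \<noteq> 0" "0 < norm (x - c)" by auto
  have dn: "((\<lambda>x. norm (x - c)) has_derivative (\<lambda>v. v \<bullet> sgn (x - c))) (at x)"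
  proof -
    have "((\<lambda>x. x - c) has_derivative (\<lambda>v. v)) (at x)" by (auto intro!: derivative_eq_intros)
    from has_derivative_compose[OF this has_derivative_norm[OF x(1)]] show ?thesis .
  qed
  have "((\<lambda>x. \<eta> (norm (x - c))) has_derivative (\<lambda>v. \<eta>' (norm (x - c)) * (v \<bullet> sgn (x - c)))) (at x)"
    using has_derivative_compose[OF dn assms(1)[OF x(2), unfolded has_field_derivative_def]] .
  then show "((\<lambda>x. \<eta> (norm (x - c))) has_derivative (\<lambda>v. (\<eta>' (norm (x - c)) / norm (x - c)) *\<^sub>R (x - c) \<bullet> v)) (at x)"
    by (rule has_derivative_eq_rhs) (simp add: fun_eq_iff sgn_div_norm inner_commute divide_inverse algebra_simps)
  define \<zeta> where "\<zeta> r = \<eta>' r / r" for r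
  have "(\<zeta> has_real_derivative (\<eta>'' (norm (x - c)) * norm (x - c) - \<eta>' (norm (x - c)) * 1) / (norm (x - c) * norm (x - c))) (at (norm (x - c)))"
    unfolding \<zeta>_def using x by (intro DERIV_divide assms(2) DERIV_ident) auto
  from has_derivative_compose[OF dn this[unfolded has_field_derivative_def]]
  have "((\<lambda>x. \<zeta> (norm (x - c))) has_derivative (\<lambda>v. (\<eta>'' (norm (x - c)) * norm (x - c) - \<eta>' (norm (x - c)) * 1) / (norm (x - c) * norm (x - c)) * (v \<bullet> sgn (x - c)))) (at x)" .
  moreover have "((\<lambda>x. x - c) has_derivative (\<lambda>v. v)) (at x)" by (auto intro!: derivative_eq_intros)
  ultimately have "((\<lambda>x. \<zeta> (norm (x - c)) *\<^sub>R (x - c)) has_derivative (\<lambda>v. \<zeta> (norm (x - c)) *\<^sub>R v +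
     ((\<eta>'' (norm (x - c)) * norm (x - c) - \<eta>' (norm (x - c)) * 1) / (norm (x - c) * norm (x - c)) * (v \<bullet> sgn (x - c))) *\<^sub>R (x - c))) (at x)"
    by (rule has_derivative_scaleR)
  then show "((\<lambda>x. (\<eta>' (norm (x - c)) / norm (x - c)) *\<^sub>R (x - c)) has_derivative
      radial_hessian (x - c) (\<eta>' (norm (x - c)) / norm (x - c)) (\<eta>'' (norm (x - c)))) (at x)"
    unfolding \<zeta>_def
  proof (rule has_derivative_eq_rhs)
    obtain r where r: "norm (x - c) = r" by blast
    show "(\<lambda>v. (\<eta>' (norm (x - c)) / norm (x - c)) *\<^sub>R v +
     ((\<eta>'' (norm (x - c)) * norm (x - c) - \<eta>' (norm (x - c)) * 1) / (norm (x - c) * norm (x - c)) * (v \<bullet> sgn (x - c))) *\<^sub>R (x - c))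
     = radial_hessian (x - c) (\<eta>' (norm (x - c)) / norm (x - c)) (\<eta>'' (norm (x - c)))"
    proof
      fix v
      have sg: "v \<bullet> sgn (x - c) = ((x - c) \<bullet> v) / r"
        unfolding sgn_div_norm r inner_scaleR_right inner_commute[of v] by (simp add: divide_inverse)
      have "(\<eta>'' r * r - \<eta>' r * 1) / (r * r) * (w / r) = (\<eta>'' r - \<eta>' r / r) / r\<^sup>2 * w" for w
        using x(2) unfolding r by (simp add: field_simps power2_eq_square)
      then show "(\<eta>' (norm (x - c)) / norm (x - c)) *\<^sub>R v +
         ((\<eta>'' (norm (x - c)) * norm (x - c) - \<eta>' (norm (x - c)) * 1) / (norm (x - c) * norm (x - c)) * (v \<bullet> sgn (x - c))) *\<^sub>R (x - c)
         = radial_hessian (x - c) (\<eta>' (norm (x - c)) / norm (x - c)) (\<eta>'' (norm (x - c))) v"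
        unfolding radial_hessian_def r sg by (simp only:)
    qed
  qed
next
  fix b :: 'a
  have n: "norm (x - c) \<in> {0<..}" if "x \<in> - {c}" for x using that by auto
  have c': "continuous_on {0<..} \<eta>'"
    by (rule has_derivative_imp_continuous_on[of _ _ "\<lambda>r. (*) (\<eta>'' r)"])
      (use assms(2) in \<open>auto simp: has_field_derivative_def\<close>)
  have "continuous_on (- {c}) (\<lambda>x. \<eta>' (norm (x - c)))" "continuous_on (- {c}) (\<lambda>x. \<eta>'' (norm (x - c)))"
    using n by (auto intro!: continuous_on_compose2[OF c'] continuous_on_compose2[OF assms(3)] continuous_intros)
  then show "continuous_on (- {c}) (\<lambda>x. radial_hessian (x - c) (\<eta>' (norm (x - c)) / norm (x - c)) (\<eta>'' (norm (x - c))) b)"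
    unfolding radial_hessian_def by (intro continuous_intros) auto
qed

lemma normalized_p_laplacian_radial:
  fixes y n :: "'a::euclidean_space"
  assumes "y \<noteq> 0"
  shows "normalized_p_laplacian p (radial_hessian y a b) n
    = b * (1 + (p - 2) * ((y \<bullet> n) / norm y)\<^sup>2) + a * (real DIM('a) - 1 + (p - 2) * ((norm n)\<^sup>2 - ((y \<bullet> n) / norm y)\<^sup>2))"
proof -
  define s where "s = (b - a) / (norm y)\<^sup>2"
  have s: "s * (norm y)\<^sup>2 = b - a" using assms by (simp add: s_def)
  have d: "(\<Sum>i\<in>(Basis :: 'a set). a * (i \<bullet> i)) = a * DIM('a)"
  proof -
    have "(\<Sum>i\<in>(Basis :: 'a set). a * (i \<bullet> i)) = (\<Sum>i\<in>(Basis :: 'a set). a)" by (rule sum.cong) auto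
    then show ?thesis by simp
  qed
  have "(\<Sum>i\<in>Basis. (a *\<^sub>R i + (s * (y \<bullet> i)) *\<^sub>R y) \<bullet> i) = a * DIM('a) + s * (\<Sum>i\<in>Basis. (y \<bullet> i) * (y \<bullet> i))"
    by (simp only: inner_add_left inner_scaleR_left sum.distrib d sum_distrib_left mult.assoc)
  also have "(\<Sum>i\<in>Basis. (y \<bullet> i) * (y \<bullet> i)) = (norm y)\<^sup>2"
    by (simp only: euclidean_inner[of y y, symmetric] power2_norm_eq_inner)
  finally have tr: "(\<Sum>i\<in>Basis. (a *\<^sub>R i + (s * (y \<bullet> i)) *\<^sub>R y) \<bullet> i) = a * DIM('a) + (b - a)"
    using s by simp
  have "n \<bullet> (a *\<^sub>R n + (s * (y \<bullet> n)) *\<^sub>R y) = a * (norm n)\<^sup>2 + s * (y \<bullet> n)\<^sup>2"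
    by (simp only: inner_add_right inner_scaleR_right power2_norm_eq_inner inner_commute[of n y])
      (simp add: power2_eq_square)
  also have "s * (y \<bullet> n)\<^sup>2 = (b - a) * ((y \<bullet> n) / norm y)\<^sup>2"
    using assms by (simp add: s_def power_divide)
  finally have qf: "n \<bullet> (a *\<^sub>R n + (s * (y \<bullet> n)) *\<^sub>R y) = a * (norm n)\<^sup>2 + (b - a) * ((y \<bullet> n) / norm y)\<^sup>2" .
  show ?thesis
    unfolding normalized_p_laplacian_def radial_hessian_def s_def[symmetric] tr qf
    by (simp add: algebra_simps)
qed

text \<open>A Pucci type bound, free of the direction: \<open>1 + (p - 2) * s\<close> with s between
  0 and 1 is a mean of 1 and \<open>p - 1\<close>. For \<open>a \<le> 0\<close> a single tangential
  direction, present in dimension at least 2, already supplies the last term.\<close>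

lemma normalized_p_laplacian_radial_le:
  fixes y n :: "'a::euclidean_space"
  assumes y: "y \<noteq> 0" and n: "norm n \<le> 1" and dim: "2 \<le> DIM('a)" and a: "a \<le> 0" and p: "1 < p"
  shows "normalized_p_laplacian p (radial_hessian y a b) n
    \<le> max (min 1 (p - 1) * b) (max 1 (p - 1) * b) + min 1 (p - 1) * a"
proof -
  define t where "t = ((y \<bullet> n) / norm y)\<^sup>2"
  define m where "m = (norm n)\<^sup>2"
  have "\<bar>y \<bullet> n\<bar> \<le> norm y * norm n" by (rule Cauchy_Schwarz_ineq2)
  then have "\<bar>(y \<bullet> n) / norm y\<bar> \<le> norm n" using y by (simp add: field_simps)
  then have "\<bar>(y \<bullet> n) / norm y\<bar>\<^sup>2 \<le> (norm n)\<^sup>2" by (intro power_mono) auto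
  then have t: "t \<le> m" by (simp only: t_def m_def power2_abs)
  moreover have "0 \<le> t" "m \<le> 1" using n by (simp_all add: t_def m_def power_le_one)
  ultimately have t: "0 \<le> t" "t \<le> m" "m \<le> 1" by auto
  have w: "min 1 (p - 1) \<le> 1 + (p - 2) * s" "1 + (p - 2) * s \<le> max 1 (p - 1)" if "0 \<le> s" "s \<le> 1" for s
  proof -
    have "1 + (p - 2) * s = (1 - s) * 1 + s * (p - 1)" by (simp add: algebra_simps)
    moreover have "(1 - s) * min 1 (p - 1) + s * min 1 (p - 1) \<le> (1 - s) * 1 + s * (p - 1)"
      "(1 - s) * 1 + s * (p - 1) \<le> (1 - s) * max 1 (p - 1) + s * max 1 (p - 1)"
      using that by (intro add_mono mult_left_mono; simp)+
    ultimately show "min 1 (p - 1) \<le> 1 + (p - 2) * s" "1 + (p - 2) * s \<le> max 1 (p - 1)"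
      by (simp_all add: algebra_simps)
  qed
  have "b * (1 + (p - 2) * t) \<le> max (min 1 (p - 1) * b) (max 1 (p - 1) * b)"
  proof (cases "0 \<le> b")
    case True
    have "b * (1 + (p - 2) * t) \<le> b * max 1 (p - 1)" using w(2)[of t] t True by (intro mult_left_mono) auto
    then show ?thesis by (simp add: mult.commute)
  next
    case False
    have "b * (1 + (p - 2) * t) \<le> b * min 1 (p - 1)" using w(1)[of t] t False by (intro mult_left_mono_neg) auto
    then show ?thesis by (simp add: mult.commute)
  qed
  moreover have "min 1 (p - 1) \<le> real DIM('a) - 1 + (p - 2) * (m - t)"
    using w(1)[of "m - t"] t dim by simp
  then have "a * (real DIM('a) - 1 + (p - 2) * (m - t)) \<le> a * min 1 (p - 1)"
    using a by (intro mult_left_mono_neg)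
  ultimately show ?thesis
    unfolding normalized_p_laplacian_radial[OF y] t_def[symmetric] m_def[symmetric] by (simp add: mult.commute)
qed

text \<open>Serves at the tip of the cone \<open>- m * norm x\<close>, which is not differentiable
  there but lies below this paraboloid inside the unit ball.\<close>

lemma strict_p_supersolution_paraboloid:
  fixes x0 :: "'a::euclidean_space"
  assumes "2 \<le> DIM('a)" "1 < p" "0 < m"
  shows "strict_p_supersolution_at p (\<lambda>x. - m * (x \<bullet> x)) (x0 :: 'a)"
proof (rule strict_p_supersolution_atI[of UNIV])
  show "C2_data UNIV (\<lambda>x::'a. - m * (x \<bullet> x)) (\<lambda>x. (- 2 * m) *\<^sub>R x) (\<lambda>x v. 0 + (- 2 * m) *\<^sub>R v)"
    unfolding C2_data_def
    by (auto intro!: derivative_eq_intros continuous_intros simp: fun_eq_iff inner_commute)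
  have "normalized_p_laplacian p (\<lambda>v. 0 + (- 2 * m) *\<^sub>R v) n \<le> - (2 * m * (real DIM('a) - 1))" if "norm n \<le> 1" for n :: 'a
  proof -
    have n2: "0 \<le> (norm n)\<^sup>2" "(norm n)\<^sup>2 \<le> 1" using that by (auto simp: power_le_one)
    have "0 \<le> (p - 1) * (norm n)\<^sup>2" using assms(2) n2 by simp
    then have "real DIM('a) - 1 \<le> real DIM('a) + (p - 2) * (norm n)\<^sup>2" using n2 by (simp add: algebra_simps)
    then have "2 * m * (real DIM('a) - 1) \<le> 2 * m * (real DIM('a) + (p - 2) * (norm n)\<^sup>2)"
      using assms(3) by (intro mult_left_mono) auto
    moreover have "normalized_p_laplacian p (\<lambda>v::'a. 0) n = 0" by (simp add: normalized_p_laplacian_def)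
    ultimately show ?thesis
      unfolding normalized_p_laplacian_add_scaleR by simp
  qed
  moreover have "0 < 2 * m * (real DIM('a) - 1)" using assms by simp
  ultimately show "(\<exists>c>0. \<forall>n. norm n \<le> 1 \<longrightarrow> normalized_p_laplacian p (\<lambda>v::'a. 0 + (- 2 * m) *\<^sub>R v) n \<le> - c) \<or>
      (- 2 * m) *\<^sub>R x0 \<noteq> 0 \<and> normalized_p_laplacian p (\<lambda>v::'a. 0 + (- 2 * m) *\<^sub>R v) (sgn ((- 2 * m) *\<^sub>R x0)) < 0"
    by blast
qed auto

text \<open>The radial second derivative vanishes; strictness comes from the tangential curvature
  \<open>- m / norm x\<close> alone, in every direction.\<close>

lemma strict_p_supersolution_cone:
  fixes x0 :: "'a::euclidean_space"
  assumes "2 \<le> DIM('a)" "1 < p" "0 < m" "x0 \<noteq> 0"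
  shows "strict_p_supersolution_at p (\<lambda>x. - m * norm x) (x0 :: 'a)"
proof (rule strict_p_supersolution_atI[of "- {0}"])
  have C: "C2_data (- {0::'a}) (\<lambda>x. (- m * norm (x - 0))) (\<lambda>x. (- m / norm (x - 0)) *\<^sub>R (x - 0))
    (\<lambda>x. radial_hessian (x - 0) (- m / norm (x - 0)) 0)"
    by (rule C2_data_radial) (auto intro!: derivative_eq_intros)
  then show "C2_data (- {0::'a}) (\<lambda>x. - m * norm x) (\<lambda>x. (- m / norm x) *\<^sub>R x) (\<lambda>x. radial_hessian x (- m / norm x) 0)"
    by simp
  have "normalized_p_laplacian p (radial_hessian x0 (- m / norm x0) 0) n \<le> - (min 1 (p - 1) * (m / norm x0))" if "norm n \<le> 1" for n
    using normalized_p_laplacian_radial_le[OF assms(4) that assms(1) _ assms(2), of "- m / norm x0" 0] assms by simp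
  moreover have "0 < min 1 (p - 1) * (m / norm x0)" using assms by simp
  ultimately show "(\<exists>c>0. \<forall>n. norm n \<le> 1 \<longrightarrow> normalized_p_laplacian p (radial_hessian x0 (- m / norm x0) 0) n \<le> - c) \<or>
      (- m / norm x0) *\<^sub>R x0 \<noteq> 0 \<and> normalized_p_laplacian p (radial_hessian x0 (- m / norm x0) 0) (sgn ((- m / norm x0) *\<^sub>R x0)) < 0"
    by blast
qed (use assms in auto)

text \<open>The power is p-harmonic off \<open>s\<close>, and the added cone makes it strict while
  the gradient stays radial. Since the direction is known exactly, the operator can be computed and
  the second alternative applies.\<close>

lemma strict_p_supersolution_fundamental:
  fixes x0 s :: "'a::euclidean_space" and p k :: real
  assumes dim: "2 \<le> DIM('a)" and p: "1 < p" "p < real DIM('a)" and k: "0 < k" and x0: "x0 \<noteq> s"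
  shows "strict_p_supersolution_at p (\<lambda>x. k * norm (x - s) powr (- ((real DIM('a) - p) / (p - 1))) - norm (x - s)) x0"
proof (rule strict_p_supersolution_atI[of "- {s}"])
  define \<gamma> where "\<gamma> = (real DIM('a) - p) / (p - 1)"
  have \<gamma>: "0 < \<gamma>" "(\<gamma> + 1) * (p - 1) = real DIM('a) - 1" using p by (auto simp: \<gamma>_def field_simps)
  define \<eta>' where "\<eta>' r = - k * \<gamma> * r powr (- \<gamma> - 1) - 1" for r
  define \<eta>'' where "\<eta>'' r = k * \<gamma> * (\<gamma> + 1) * r powr (- \<gamma> - 2)" for r
  show "C2_data (- {s}) (\<lambda>x. k * norm (x - s) powr (- ((real DIM('a) - p) / (p - 1))) - norm (x - s))
    (\<lambda>x. (\<eta>' (norm (x - s)) / norm (x - s)) *\<^sub>R (x - s))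
    (\<lambda>x. radial_hessian (x - s) (\<eta>' (norm (x - s)) / norm (x - s)) (\<eta>'' (norm (x - s))))"
    unfolding \<gamma>_def[symmetric]
  proof (rule C2_data_radial[where c = s and \<eta> = "\<lambda>r. k * r powr - \<gamma> - r" and \<eta>' = \<eta>' and \<eta>'' = \<eta>''])
    show "continuous_on {0<..} \<eta>''"
      unfolding \<eta>''_def by (intro continuous_intros) auto
  next
    fix r :: real assume r: "0 < r"
    show "((\<lambda>r. k * r powr - \<gamma> - r) has_real_derivative \<eta>' r) (at r)"
      using r by (auto intro!: derivative_eq_intros simp: \<eta>'_def)
    have "((\<lambda>r. - k * \<gamma> * r powr (- \<gamma> - 1) - 1) has_real_derivative - k * \<gamma> * ((- \<gamma> - 1) * r powr (- \<gamma> - 1 - 1)) - 0) (at r)"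
      by (intro DERIV_diff DERIV_cmult has_real_derivative_powr r DERIV_const)
    then show "(\<eta>' has_real_derivative \<eta>'' r) (at r)"
      by (simp add: \<eta>'_def[abs_def] \<eta>''_def algebra_simps)
  qed
  define r where "r = norm (x0 - s)"
  have r: "0 < r" using x0 by (simp add: r_def)
  have "0 \<le> k * \<gamma> * r powr (- \<gamma> - 1)" using k \<gamma> by simp
  then have neg: "\<eta>' r < 0" by (simp add: \<eta>'_def)
  define q where "q = (\<eta>' r / r) *\<^sub>R (x0 - s)"
  have q0: "q \<noteq> 0" using neg r x0 by (simp add: q_def)
  have ns: "norm (sgn q) = 1" using q0 by (simp add: norm_sgn)
  have "sgn q = - sgn (x0 - s)" using neg r by (simp add: q_def sgn_scaleR sgn_divide)
  then have "(x0 - s) \<bullet> sgn q / r = - 1"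
    using r by (simp add: sgn_div_norm r_def[symmetric] power2_norm_eq_inner[symmetric] power2_eq_square)
  then have "normalized_p_laplacian p (radial_hessian (x0 - s) (\<eta>' r / r) (\<eta>'' r)) (sgn q)
      = \<eta>'' r * (p - 1) + \<eta>' r / r * (real DIM('a) - 1)"
    using x0 ns by (simp add: normalized_p_laplacian_radial r_def[symmetric])
  \<comment> \<open>The singular terms cancel by
    \<open>(\<gamma> + 1) * (p - 1) = real DIM('a) - 1\<close>; only the cone contributes.\<close>
  also have "\<dots> = - ((real DIM('a) - 1) / r)"
  proof -
    have pw: "r powr (- \<gamma> - 1) / r = r powr (- \<gamma> - 2)"
      using r by (simp add: powr_diff power2_eq_square)
    have "\<eta>' r / r = - (k * \<gamma> * (r powr (- \<gamma> - 1) / r)) - 1 / r"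
      by (simp add: \<eta>'_def diff_divide_distrib)
    then have e1: "\<eta>' r / r = - (k * \<gamma> * r powr (- \<gamma> - 2)) - 1 / r"
      unfolding pw .
    have e2: "\<eta>'' r * (p - 1) = k * \<gamma> * r powr (- \<gamma> - 2) * (real DIM('a) - 1)"
      unfolding \<eta>''_def \<gamma>(2)[symmetric] by (simp add: mult_ac)
    show ?thesis unfolding e1 e2 by (simp add: algebra_simps diff_divide_distrib)
  qed
  also have "\<dots> < 0" using dim r by simp
  finally show "(\<exists>c>0. \<forall>n. norm n \<le> 1 \<longrightarrow> normalized_p_laplacian p (radial_hessian (x0 - s) (\<eta>' (norm (x0 - s)) / norm (x0 - s)) (\<eta>'' (norm (x0 - s)))) n \<le> - c) \<or>
    (\<eta>' (norm (x0 - s)) / norm (x0 - s)) *\<^sub>R (x0 - s) \<noteq> 0 \<and>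
    normalized_p_laplacian p (radial_hessian (x0 - s) (\<eta>' (norm (x0 - s)) / norm (x0 - s)) (\<eta>'' (norm (x0 - s))))
      (sgn ((\<eta>' (norm (x0 - s)) / norm (x0 - s)) *\<^sub>R (x0 - s))) < 0"
    using q0 unfolding r_def q_def by blast
qed (use x0 in auto)

subsection \<open>The barrier\<close>

locale punctured_sphere_barrier =
  fixes p \<delta> \<epsilon> :: real and S :: "'a::euclidean_space set"
  assumes dim: "2 \<le> DIM('a)" and p: "1 < p" "p < real DIM('a)"
    and \<delta>: "0 < \<delta>" "\<delta> < 1 / 2" and \<epsilon>: "0 < \<epsilon>" "\<epsilon> < \<delta> / 10"
    and S: "finite S" "S \<subseteq> sphere 0 1"
    and sep: "\<And>s t. s \<in> S \<Longrightarrow> t \<in> S \<Longrightarrow> s \<noteq> t \<Longrightarrow> \<epsilon> \<le> dist s t"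
begin

text \<open>\<open>lam\<close> and \<open>Lam\<close> are the ellipticity constants of the
  normalised operator: the extremes of \<open>1 + (p - 2) * s\<close> for s between 0 and 1.\<close>

definition "lam = min 1 (p - 1)"
definition "Lam = max 1 (p - 1)"
definition "bet = lam / (2 * Lam)"
text \<open>\<open>2 * N\<close> is the ratio \<open>R / r\<close> at which
  \<open>(R / r) powr bet = 2\<close>. Closer to the centre the bump has the right sign in every
  direction, so \<open>1 / r \<le> 2 * N / R\<close> wherever a correction is called for.\<close>

definition "N = 2 powr (1 / bet) / 2"
text \<open>A Lipschitz constant of \<open>base\<close>: \<open>psi\<close> contributes at most
  \<open>8 * N\<close>, the linear part less than 1.\<close>

definition "slope = 8 * N + 1"
text \<open>A quarter of the separation: within \<open>2 * R\<close> of one point of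
  \<open>S\<close> all other bumps vanish, which leaves room to extend the formula of a bump past
  its radius \<open>R\<close>.\<close>

definition "R = \<epsilon> / 4"
text \<open>\<open>r2\<close> is so small that between \<open>r1\<close> and \<open>r2\<close> the drop of \<open>f\<close> exceeds the oscillation of \<open>base\<close>;
  this makes \<open>core\<close> the smaller function at \<open>r1\<close> and \<open>shell\<close> the smaller one at \<open>r2\<close>.\<close>
definition "ratio = (4 * slope + 9) powr (- (1 / bet)) / 8"
definition "r2 = R * (8 * ratio)"
definition "r1 = r2 / 2"
definition "\<gamma> = (real DIM('a) - p) / (p - 1)"

text \<open>\<open>f' = 1 - (R / r) powr bet\<close>. The exponent \<open>bet\<close> is so small that this spherical bump, which flattens
  out at \<open>R\<close>, is nearly superharmonic for the linearisation in every gradient direction; only an error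
  \<open>lam * N / R\<close> has to be compensated by the curvature of \<open>base\<close>.\<close>
definition "f r = R powr bet * ((R powr (1 - bet) - r powr (1 - bet)) / (1 - bet)) - (R - r)"
definition "bump r = f (min r R)"
text \<open>Convex and C^1, with second derivative 2 on \<open>(0, 4 * R)\<close> and affine
  elsewhere. In \<open>base\<close> it puts curvature \<open>- 2 * (N / R)\<close> on the shell
  within \<open>2 * R\<close> of the unit sphere and slope \<open>- (\<delta> + 8 * N)\<close>
  beyond it.\<close>

definition "psi y = (if y \<le> 0 then 0 else if y \<le> 4 * R then y\<^sup>2 else 8 * R * y - 16 * R\<^sup>2)"
definition "base r = - \<delta> * r - N / R * psi (r - 1 + 2 * R)"
definition "shell x = base (norm x) + (\<Sum>s\<in>S. bump (norm (x - s)))" for x :: 'a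
definition "pole r = r2 * (r / r1) powr (- \<gamma>)"
text \<open>The additive constant is the size of \<open>shell\<close> at distance \<open>r2\<close>,
  plus a margin beating the variation of \<open>base\<close>. The final
  \<open>- norm (x - s)\<close> provides strictness.\<close>

definition "core s x = base 1 + f r2 + (slope + 2) * r2 + (pole (norm (x - s)) - norm (x - s))" for s x :: 'a
definition "near x = (SOME s. s \<in> S \<and> norm (x - s) < r2)" for x :: 'a
definition "barrier x = (if \<exists>s\<in>S. norm (x - s) < r2
   then if norm (x - near x) < r1 then core (near x) x else min (core (near x) x) (shell x)
   else shell x)" for x :: 'a

lemma lam: "0 < lam" "lam \<le> Lam" "0 < Lam" using p by (auto simp: lam_def Lam_def)

lemma bet: "0 < bet" "bet \<le> 1 / 2" "Lam * bet = lam / 2"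
proof -
  show "0 < bet" using lam by (simp add: bet_def)
  have "lam / (2 * Lam) \<le> Lam / (2 * Lam)" using lam by (intro divide_right_mono) auto
  also have "\<dots> = 1 / 2" using lam(3) by simp
  finally show "bet \<le> 1 / 2" by (simp only: bet_def)
  show "Lam * bet = lam / 2" using lam(3) by (simp add: bet_def)
qed

lemma N: "2 \<le> N"
proof -
  have "2 \<le> 1 / bet" using bet by (simp add: field_simps)
  then have "2 powr 2 \<le> (2::real) powr (1 / bet)" by (intro powr_mono) auto
  then show ?thesis by (simp add: N_def)
qed

lemma R: "0 < R" "R < \<delta> / 40" using \<epsilon> by (auto simp: R_def)

text \<open>The identity from which \<open>ratio\<close> is solved; up to \<open>r2\<close> it
  forces the derivative of \<open>f\<close> to be at most \<open>- (4 * slope + 8)\<close>.\<close>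

lemma r2_ratio: "(R / r2) powr bet = 4 * slope + 9"
proof -
  have "R / r2 = (4 * slope + 9) powr (1 / bet)"
    using R by (simp add: r2_def ratio_def powr_minus_divide)
  then have "(R / r2) powr bet = (4 * slope + 9) powr (1 / bet * bet)" by (simp only: powr_powr)
  moreover have "1 / bet * bet = 1" "0 < 4 * slope + 9" using bet(1) N by (simp_all add: slope_def)
  ultimately show ?thesis by (simp only: powr_one)
qed

lemma r2: "0 < r2" "9 * r2 \<le> R"
proof -
  have m: "1 \<le> 4 * slope + 9" using N by (simp add: slope_def)
  then show "0 < r2" using R by (simp add: r2_def ratio_def)
  have "(4 * slope + 9) powr 1 \<le> (4 * slope + 9) powr (1 / bet)"
    using bet m by (intro powr_mono) (auto simp: field_simps)
  moreover have "9 \<le> 4 * slope + 9" using N by (simp add: slope_def)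
  ultimately have "9 \<le> (4 * slope + 9) powr (1 / bet)" using m by simp
  then have "9 * r2 \<le> r2 * (4 * slope + 9) powr (1 / bet)"
    using \<open>0 < r2\<close> by simp
  also have "\<dots> = R" using m by (simp add: r2_def ratio_def powr_minus)
  finally show "9 * r2 \<le> R" .
qed

lemma r1: "0 < r1" "r1 < r2" using r2 by (auto simp: r1_def)

lemma \<gamma>: "0 < \<gamma>" using p by (simp add: \<gamma>_def)

lemma DERIV_f: "0 < r \<Longrightarrow> (f has_real_derivative 1 - (R / r) powr bet) (at r)"
proof -
  assume r: "0 < r"
  have "((\<lambda>r. R powr bet * ((R powr (1 - bet) - r powr (1 - bet)) / (1 - bet)) - (R - r)) has_real_derivative
     R powr bet * ((0 - (1 - bet) * r powr (1 - bet - 1)) / (1 - bet)) - (0 - 1)) (at r)"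
    by (intro DERIV_diff DERIV_cmult DERIV_cdivide has_real_derivative_powr r DERIV_const DERIV_ident)
  moreover have "R powr bet * ((0 - (1 - bet) * r powr (1 - bet - 1)) / (1 - bet)) - (0 - 1) = 1 - (R / r) powr bet"
    using bet(1,2) r R by (simp add: powr_minus_divide powr_divide)
  ultimately show ?thesis by (simp only: f_def[abs_def])
qed

lemma f_R: "f R = 0" by (simp add: f_def)

lemma f_nonneg: "0 < r \<Longrightarrow> 0 \<le> f r"
proof -
  assume r: "0 < r"
  show "0 \<le> f r"
  proof (cases "r \<le> R")
    case True
    have "f R \<le> f r"
    proof (rule DERIV_nonpos_imp_nonincreasing[OF True])
      fix x assume "r \<le> x" "x \<le> R"
      then have "(f has_real_derivative 1 - (R / x) powr bet) (at x)" "1 \<le> (R / x) powr bet"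
        using r bet(1) by (auto intro!: DERIV_f ge_one_powr_ge_zero)
      then show "\<exists>y. (f has_real_derivative y) (at x) \<and> y \<le> 0" by force
    qed
    then show ?thesis using f_R by simp
  next
    case False
    have "f R \<le> f r"
    proof (rule DERIV_nonneg_imp_nondecreasing[rotated, of R r f])
      show "R \<le> r" using False by simp
      fix x assume x: "R \<le> x" "x \<le> r"
      have "0 < x" using x R by linarith
      moreover have "(R / x) powr bet \<le> 1"
        using x R(1) bet(1) calculation by (intro powr_le1) simp_all
      ultimately show "\<exists>y. (f has_real_derivative y) (at x) \<and> 0 \<le> y"
        by (intro exI[of _ "1 - (R / x) powr bet"]) (simp add: DERIV_f)
    qed
    then show ?thesis using f_R by simp
  qed
qed

lemma f_le: "0 < r \<Longrightarrow> r \<le> R \<Longrightarrow> f r \<le> 2 * R"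
proof -
  assume r: "0 < r" "r \<le> R"
  have "f r \<le> R powr bet * (R powr (1 - bet) / (1 - bet))"
  proof -
    have "R powr bet * ((R powr (1 - bet) - r powr (1 - bet)) / (1 - bet)) \<le> R powr bet * (R powr (1 - bet) / (1 - bet))"
      using bet by (intro mult_left_mono divide_right_mono) auto
    then show ?thesis using r by (simp add: f_def)
  qed
  also have "\<dots> = R / (1 - bet)"
    using R powr_add[of R bet "1 - bet"] by simp
  also have "\<dots> \<le> 2 * R"
    using bet R mult_right_mono[of bet "1/2" R] by (simp add: field_simps)
  finally show ?thesis .
qed

lemma bump: "0 < r \<Longrightarrow> bump r \<le> f r" "0 < r \<Longrightarrow> 0 \<le> bump r" "R \<le> r \<Longrightarrow> bump r = 0"
  "r \<le> R \<Longrightarrow> bump r = f r"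
  using f_nonneg[of r] f_R by (cases "r \<le> R"; simp add: bump_def min_absorb1 min_absorb2)+

lemma f_drop: "f r2 \<le> f r1 - (4 * slope + 8) * r1"
proof -
  obtain z where z: "r1 < z" "z < r2" "f r2 - f r1 = (r2 - r1) * (1 - (R / z) powr bet)"
  proof -
    have "\<exists>z>r1. z < r2 \<and> f r2 - f r1 = (r2 - r1) * (1 - (R / z) powr bet)"
      by (rule MVT2[OF r1(2)]) (use r1(1) in \<open>intro DERIV_f, linarith\<close>)
    then show thesis using that by blast
  qed
  have "(R / r2) powr bet \<le> (R / z) powr bet"
    using z r1 r2 R bet(1) by (intro powr_mono2 divide_left_mono) auto
  then have "1 - (R / z) powr bet \<le> - (4 * slope + 8)" unfolding r2_ratio by simp
  then have "r1 * (1 - (R / z) powr bet) \<le> r1 * (- (4 * slope + 8))"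
    using r1 by (intro mult_left_mono) auto
  moreover have "r2 - r1 = r1" by (simp add: r1_def)
  ultimately show ?thesis using z(3) by (simp add: algebra_simps)
qed

lemma psi_upper: "psi y \<le> 8 * R * max y 0"
proof -
  consider "y \<le> 0" | "0 < y" "y \<le> 4 * R" | "4 * R < y" by linarith
  then show ?thesis
  proof cases
    case 2
    then have "y * y \<le> 4 * R * y" by (intro mult_right_mono) auto
    moreover have "0 \<le> R * y" using 2 R by simp
    ultimately show ?thesis using 2 by (simp add: psi_def power2_eq_square max_def)
  qed (use R in \<open>auto simp: psi_def max_def\<close>)
qed

lemma psi_lower: "0 \<le> psi y" "8 * R * y - 16 * R\<^sup>2 \<le> psi y" "y \<le> 4 * R \<Longrightarrow> 0 \<le> y \<Longrightarrow> psi y = y\<^sup>2" "4 * R \<le> y \<Longrightarrow> psi y = 8 * R * y - 16 * R\<^sup>2"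
proof -
  have sq: "8 * R * y - 16 * R\<^sup>2 \<le> y\<^sup>2"
    using zero_le_power2[of "y - 4 * R"] by (simp add: power2_diff power_mult_distrib algebra_simps)
  show "8 * R * y - 16 * R\<^sup>2 \<le> psi y"
  proof -
    consider "y \<le> 0" | "0 < y" "y \<le> 4 * R" | "4 * R < y" by linarith
    then show ?thesis
    proof cases
      case 1
      then have "psi y = 0" "R * y \<le> 0" using R by (simp_all add: psi_def mult_nonneg_nonpos)
      then show ?thesis using zero_le_power2[of R] by linarith
    qed (use sq R in \<open>simp_all add: psi_def\<close>)
  qed
  show "0 \<le> psi y"
    using R mult_left_mono[of "4 * R" y "8 * R"] zero_le_power2[of R]
    by (auto simp: psi_def power2_eq_square)
  show "y \<le> 4 * R \<Longrightarrow> 0 \<le> y \<Longrightarrow> psi y = y\<^sup>2" by (auto simp: psi_def)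
  show "4 * R \<le> y \<Longrightarrow> psi y = 8 * R * y - 16 * R\<^sup>2"
    using R by (auto simp: psi_def power2_eq_square)
qed

lemma psi_lipschitz: "x \<le> y \<Longrightarrow> psi x \<le> psi y \<and> psi y - psi x \<le> 8 * R * (y - x)"
proof -
  assume xy: "x \<le> y"
  define z where "z = (\<lambda>u. max 0 (min u (4 * R)))"
  \<comment> \<open>Clamping to \<open>[0, 4 * R]\<close> splits \<open>psi\<close> into a square
    and a linear tail, so that \<open>x\<close> and \<open>y\<close> may lie in different pieces
    without a case analysis.\<close>
  have rep: "psi u = (z u)\<^sup>2 + 8 * R * max 0 (u - 4 * R)" for u
    using R by (auto simp: psi_def z_def max_def min_def power2_eq_square algebra_simps)
  have z: "0 \<le> z x" "z x \<le> z y" "z y \<le> 4 * R" using xy R by (auto simp: z_def)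
  have "(z y)\<^sup>2 - (z x)\<^sup>2 = (z y + z x) * (z y - z x)" by (simp add: power2_eq_square algebra_simps)
  also have "\<dots> \<le> (8 * R) * (z y - z x)" using z by (intro mult_right_mono) auto
  finally have "psi y - psi x \<le> 8 * R * ((z y - z x) + (max 0 (y - 4 * R) - max 0 (x - 4 * R)))"
    unfolding rep by (simp add: algebra_simps)
  also have "\<dots> \<le> 8 * R * (y - x)"
    using xy R by (intro mult_left_mono) (auto simp: z_def max_def min_def)
  finally have u: "psi y - psi x \<le> 8 * R * (y - x)" .
  have "(z x)\<^sup>2 \<le> (z y)\<^sup>2" using z by (intro power_mono) auto
  moreover have "8 * R * max 0 (x - 4 * R) \<le> 8 * R * max 0 (y - 4 * R)"
    using xy R by (intro mult_left_mono) auto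
  ultimately show ?thesis using u unfolding rep by simp
qed

lemma base_lipschitz: "\<bar>base x - base y\<bar> \<le> slope * \<bar>x - y\<bar>"
proof -
  have *: "base y \<le> base x \<and> base x - base y \<le> slope * (y - x)" if "x \<le> y" for x y
  proof -
    have psi: "0 \<le> psi (y - 1 + 2 * R) - psi (x - 1 + 2 * R)" "psi (y - 1 + 2 * R) - psi (x - 1 + 2 * R) \<le> 8 * R * (y - x)"
      using psi_lipschitz[of "x - 1 + 2 * R" "y - 1 + 2 * R"] that by auto
    have NR: "0 \<le> N / R" using N R by simp
    have "N / R * (psi (y - 1 + 2 * R) - psi (x - 1 + 2 * R)) \<le> N / R * (8 * R * (y - x))"
      using psi(2) NR by (rule mult_left_mono)
    also have "\<dots> = 8 * N * (y - x)" using R by simp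
    finally have "N / R * (psi (y - 1 + 2 * R) - psi (x - 1 + 2 * R)) \<le> 8 * N * (y - x)" .
    moreover have "0 \<le> N / R * (psi (y - 1 + 2 * R) - psi (x - 1 + 2 * R))"
      using psi(1) NR by (rule mult_nonneg_nonneg[rotated])
    moreover have "base x - base y = \<delta> * (y - x) + N / R * (psi (y - 1 + 2 * R) - psi (x - 1 + 2 * R))"
      by (simp add: base_def algebra_simps)
    moreover have "0 \<le> \<delta> * (y - x)" "\<delta> * (y - x) \<le> 1 * (y - x)"
      using that \<delta> mult_right_mono[of \<delta> 1 "y - x"] by simp_all
    ultimately show ?thesis by (simp add: slope_def algebra_simps)
  qed
  show ?thesis using *[of x y] *[of y x] by (cases "x \<le> y") (auto simp: abs_if)
qed

text \<open>Up to radius \<open>1 + \<delta>\<close> the steep part of \<open>base\<close> acts over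
  a width of at most \<open>\<delta> + 2 * R \<le> 2 * \<delta>\<close>, which keeps the whole drop
  of order \<delta>.\<close>

lemma base_bounds: "0 \<le> r \<Longrightarrow> base r \<le> 0" "0 \<le> r \<Longrightarrow> r \<le> 1 + \<delta> \<Longrightarrow> - (16 * N + 2) * \<delta> \<le> base r"
proof -
  show "base r \<le> 0" if "0 \<le> r"
  proof -
    have "0 \<le> N / R * psi (r - 1 + 2 * R)" "0 \<le> \<delta> * r"
      using psi_lower(1)[of "r - 1 + 2 * R"] N R \<delta> that by simp_all
    then show ?thesis by (simp add: base_def)
  qed
  assume r: "0 \<le> r" "r \<le> 1 + \<delta>"
  have "psi (r - 1 + 2 * R) \<le> 8 * R * max (r - 1 + 2 * R) 0" by (rule psi_upper)
  also have "\<dots> \<le> 8 * R * (2 * \<delta>)" using r R \<delta> by (intro mult_left_mono) auto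
  finally have "N / R * psi (r - 1 + 2 * R) \<le> N / R * (8 * R * (2 * \<delta>))"
    using N R by (intro mult_left_mono) auto
  also have "\<dots> = 16 * N * \<delta>" using R by simp
  finally have "N / R * psi (r - 1 + 2 * R) \<le> 16 * N * \<delta>" .
  moreover have "\<delta> * r \<le> \<delta> * 2" using r \<delta> by (intro mult_left_mono) auto
  ultimately show "- (16 * N + 2) * \<delta> \<le> base r" by (simp add: base_def algebra_simps)
qed

lemma isCont_base: "isCont base r"
proof -
  have "slope-lipschitz_on UNIV base"
    using base_lipschitz N by (intro lipschitz_onI) (auto simp: dist_real_def slope_def)
  then have "continuous_on UNIV base" by (rule lipschitz_on_continuous_on)
  then show ?thesis by (simp add: continuous_on_eq_continuous_at)
qed

lemma far_from_others:
  assumes "s \<in> S" "t \<in> S" "s \<noteq> t" "norm (x - s) \<le> R"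
  shows "3 * R \<le> norm (x - t)"
proof -
  have "\<epsilon> \<le> dist s t" using sep assms by blast
  also have "\<dots> \<le> norm (x - s) + norm (x - t)"
    using dist_triangle3[of s t x] by (simp add: dist_norm)
  finally show ?thesis using assms(4) by (simp add: R_def)
qed

lemma shell_near: "s \<in> S \<Longrightarrow> norm (x - s) \<le> R \<Longrightarrow> shell x = base (norm x) + f (norm (x - s))"
proof -
  assume s: "s \<in> S" "norm (x - s) \<le> R"
  have "(\<Sum>t\<in>S. bump (norm (x - t))) = (\<Sum>t\<in>{s}. bump (norm (x - t)))"
  proof (rule sum.mono_neutral_right)
    show "\<forall>t\<in>S - {s}. bump (norm (x - t)) = 0"
      using far_from_others[OF s(1) _ _ s(2)] R by (force intro!: bump(3))
  qed (use S s in auto)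
  then show ?thesis using bump(4)[OF s(2)] by (simp add: shell_def)
qed

lemma shell_far: "(\<And>s. s \<in> S \<Longrightarrow> R \<le> norm (x - s)) \<Longrightarrow> shell x = base (norm x)"
  by (simp add: shell_def bump(3))

text \<open>Beyond \<open>R\<close> the bump is cut off while \<open>f\<close> rises again from its
  minimum 0, so \<open>f\<close> stays above it. This gives a smooth touching function at distance
  exactly \<open>R\<close>, where the bump is not twice differentiable.\<close>

lemma shell_le: "s \<in> S \<Longrightarrow> x \<noteq> s \<Longrightarrow> norm (x - s) < 2 * R \<Longrightarrow> shell x \<le> base (norm x) + f (norm (x - s))"
proof -
  assume s: "s \<in> S" "x \<noteq> s" "norm (x - s) < 2 * R"
  have "(\<Sum>t\<in>S. bump (norm (x - t))) = (\<Sum>t\<in>{s}. bump (norm (x - t)))"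
  proof (rule sum.mono_neutral_right)
    show "\<forall>t\<in>S - {s}. bump (norm (x - t)) = 0"
    proof
      fix t assume t: "t \<in> S - {s}"
      then have "\<epsilon> \<le> dist s t" using sep s by blast
      also have "\<dots> \<le> norm (x - s) + norm (x - t)"
        using dist_triangle3[of s t x] by (simp add: dist_norm)
      finally show "bump (norm (x - t)) = 0" using s(3) R_def \<epsilon>(1) by (intro bump(3)) linarith
    qed
  qed (use S s in auto)
  then show ?thesis using bump(1)[of "norm (x - s)"] s(2) by (simp add: shell_def)
qed

lemma base_le_shell: "x \<notin> S \<Longrightarrow> base (norm x) \<le> shell x"
proof -
  assume "x \<notin> S"
  then have "0 \<le> (\<Sum>s\<in>S. bump (norm (x - s)))" by (intro sum_nonneg bump(2)) auto
  then show ?thesis by (simp add: shell_def)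
qed

lemma norm_S: "s \<in> S \<Longrightarrow> \<bar>norm x - 1\<bar> \<le> norm (x - s)"
proof -
  assume "s \<in> S"
  then have "norm s = 1" using S by auto
  then show ?thesis using norm_triangle_ineq3[of x s] by simp
qed

lemma base_near: "s \<in> S \<Longrightarrow> \<bar>base (norm x) - base 1\<bar> \<le> slope * norm (x - s)"
proof -
  assume "s \<in> S"
  then have "slope * \<bar>norm x - 1\<bar> \<le> slope * norm (x - s)"
    using norm_S N by (intro mult_left_mono) (auto simp: slope_def)
  then show ?thesis using base_lipschitz[of "norm x" 1] by linarith
qed

lemma pole_pos: "0 < r \<Longrightarrow> 0 < pole r" using r1 r2 by (simp add: pole_def)

lemma pole_r1: "pole r1 = r2" using r1 by (simp add: pole_def)

lemma pole_mono: "0 < r \<Longrightarrow> r \<le> r' \<Longrightarrow> pole r' \<le> pole r"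
proof -
  assume "0 < r" "r \<le> r'"
  then have "(r' / r1) powr (- \<gamma>) \<le> (r / r1) powr (- \<gamma>)"
    using r1(1) \<gamma> by (intro powr_mono2') (simp_all add: divide_right_mono)
  then show ?thesis using r2(1) by (simp add: pole_def)
qed

text \<open>In units of \<open>r1 = r2 / 2\<close>, \<open>core\<close> exceeds
  \<open>base 1 + f r2\<close> by \<open>2 * slope + 5\<close>, whereas \<open>shell\<close> exceeds
  it by at least \<open>3 * slope + 8\<close> thanks to the drop of \<open>f\<close>.\<close>

lemma core_less_shell: "s \<in> S \<Longrightarrow> norm (x - s) = r1 \<Longrightarrow> core s x < shell x"
proof -
  assume s: "s \<in> S" "norm (x - s) = r1"
  have "shell x = base (norm x) + f r1" using shell_near[OF s(1), of x] s r1 r2 by simp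
  moreover have "base 1 - slope * r1 \<le> base (norm x)" using base_near[OF s(1), of x] unfolding s(2) by linarith
  moreover have "core s x = base 1 + f r2 + (slope + 2) * r2 + (r2 - r1)"
    by (simp add: core_def s pole_r1)
  moreover have "r2 = 2 * r1" by (simp add: r1_def)
  moreover have "0 \<le> slope * r1" using r1(1) N by (simp add: slope_def)
  ultimately show ?thesis using f_drop r1(1) by (simp add: algebra_simps)
qed

text \<open>The margin \<open>(slope + 2) * r2\<close> covers the variation
  \<open>slope * r2\<close> of \<open>base\<close> and the term \<open>- r2\<close>; the pole is
  positive.\<close>

lemma shell_less_core: "s \<in> S \<Longrightarrow> norm (x - s) = r2 \<Longrightarrow> shell x < core s x"
proof -
  assume s: "s \<in> S" "norm (x - s) = r2"
  have "shell x = base (norm x) + f r2" using shell_near[OF s(1), of x] s r1 r2 by simp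
  moreover have "base (norm x) \<le> base 1 + slope * r2" using base_near[OF s(1), of x] unfolding s(2) by linarith
  moreover have "core s x = base 1 + f r2 + (slope + 2) * r2 + (pole r2 - r2)"
    by (simp add: core_def s)
  ultimately show ?thesis using pole_pos[OF r2(1)] r2(1) by (simp add: algebra_simps)
qed

lemma near_eq: "s \<in> S \<Longrightarrow> norm (x - s) < r2 \<Longrightarrow> near x = s"
proof -
  assume s: "s \<in> S" "norm (x - s) < r2"
  have "near x \<in> S \<and> norm (x - near x) < r2"
    unfolding near_def by (rule someI[of _ s]) (use s in blast)
  then show ?thesis using far_from_others[of s "near x" x] s r2 R by force
qed

lemma barrier_eq:
  "s \<in> S \<Longrightarrow> norm (x - s) < r1 \<Longrightarrow> barrier x = core s x"
  "s \<in> S \<Longrightarrow> r1 \<le> norm (x - s) \<Longrightarrow> norm (x - s) < r2 \<Longrightarrow> barrier x = min (core s x) (shell x)"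
  "(\<And>s. s \<in> S \<Longrightarrow> r2 \<le> norm (x - s)) \<Longrightarrow> barrier x = shell x"
proof -
  show "barrier x = core s x" if "s \<in> S" "norm (x - s) < r1"
  proof -
    have "norm (x - s) < r2" using that r1 by simp
    then show ?thesis using near_eq[OF that(1)] that by (auto simp: barrier_def)
  qed
  show "barrier x = min (core s x) (shell x)" if "s \<in> S" "r1 \<le> norm (x - s)" "norm (x - s) < r2"
    using near_eq[OF that(1,3)] that by (auto simp: barrier_def)
  show "barrier x = shell x" if "\<And>s. s \<in> S \<Longrightarrow> r2 \<le> norm (x - s)"
    using that by (force simp: barrier_def)
qed

end

section \<open>Gluing and strict superharmonicity of the barrier\<close>

context punctured_sphere_barrier
begin

lemma isCont_f: "0 < r \<Longrightarrow> isCont f r"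
  using DERIV_f DERIV_isCont by blast

lemma isCont_shell: "x \<notin> S \<Longrightarrow> isCont shell x"
proof -
  assume x: "x \<notin> S"
  have "isCont (\<lambda>x. bump (norm (x - s))) x" if "s \<in> S" for s
  proof -
    have "0 < min (norm (x - s)) R" using x that R by auto
    then show ?thesis
      unfolding bump_def by (intro isCont_o2[OF _ isCont_f] continuous_intros)
  qed
  moreover have "isCont (\<lambda>x. base (norm x)) x"
    by (intro isCont_o2[OF _ isCont_base] continuous_intros)
  ultimately show ?thesis unfolding shell_def[abs_def] by (intro continuous_intros)
qed

lemma isCont_pole: "0 < r \<Longrightarrow> isCont pole r"
  unfolding pole_def[abs_def] using r1 by (intro continuous_intros) auto

lemma isCont_core: "x \<noteq> s \<Longrightarrow> isCont (core s) x"
  unfolding core_def[abs_def]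
  by (intro continuous_intros isCont_o2[OF _ isCont_pole]) auto

lemma eventually_norm_less: "norm (x0 - s) < c \<Longrightarrow> \<forall>\<^sub>F x in nhds x0. norm (x - s) < c"
  and eventually_norm_greater: "c < norm (x0 - s) \<Longrightarrow> \<forall>\<^sub>F x in nhds x0. c < norm (x - s)"
  for x0 s :: 'a
proof -
  have "((\<lambda>x. norm (x - s)) \<longlongrightarrow> norm (x0 - s)) (nhds x0)"
    by (intro tendsto_norm tendsto_diff filterlim_ident tendsto_const)
  then show "norm (x0 - s) < c \<Longrightarrow> \<forall>\<^sub>F x in nhds x0. norm (x - s) < c"
    "c < norm (x0 - s) \<Longrightarrow> \<forall>\<^sub>F x in nhds x0. c < norm (x - s)"
    using order_tendstoD by blast+
qed

lemma isCont_eventually_less: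
  fixes u v :: "'a \<Rightarrow> real"
  assumes "isCont u x0" "isCont v x0" "u x0 < v x0"
  shows "\<forall>\<^sub>F x in nhds x0. u x < v x"
proof -
  have "isCont (\<lambda>x. v x - u x) x0" using assms by (intro continuous_intros)
  then have "((\<lambda>x. v x - u x) \<longlongrightarrow> v x0 - u x0) (nhds x0)"
    using tendsto_at_iff_tendsto_nhds[of "\<lambda>x. v x - u x" x0] by (simp add: continuous_at)
  then have "\<forall>\<^sub>F x in nhds x0. 0 < v x - u x"
    using assms(3) by (intro order_tendstoD(1)) auto
  then show ?thesis by simp
qed

text \<open>The strict inequalities on the spheres of radius \<open>r1\<close> and \<open>r2\<close>
  persist nearby by continuity. Across the first the barrier is locally \<open>core\<close>, across
  the second locally \<open>shell\<close>, so the case distinctions in its definition create no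
  seams.\<close>

lemma barrier_local:
  assumes x0: "x0 \<notin> S"
  shows "(\<exists>s\<in>S. \<forall>\<^sub>F x in nhds x0. barrier x = core s x) \<or>
    (\<exists>s\<in>S. \<forall>\<^sub>F x in nhds x0. barrier x = min (core s x) (shell x)) \<or>
    (\<forall>\<^sub>F x in nhds x0. barrier x = shell x)"
proof (cases "\<exists>s\<in>S. norm (x0 - s) < r2")
  case True
  then obtain s where s: "s \<in> S" "norm (x0 - s) < r2" by blast
  have ne: "x0 \<noteq> s" using s x0 by blast
  note ev2 = eventually_norm_less[OF s(2)]
  consider "norm (x0 - s) < r1" | "norm (x0 - s) = r1" | "r1 < norm (x0 - s)" by linarith
  then show ?thesis
  proof cases
    case 1
    have "\<forall>\<^sub>F x in nhds x0. barrier x = core s x"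
      using eventually_norm_less[OF 1] by eventually_elim (rule barrier_eq(1)[OF s(1)])
    then show ?thesis using s(1) by blast
  next
    case 2
    have "\<forall>\<^sub>F x in nhds x0. core s x < shell x"
      by (rule isCont_eventually_less[OF isCont_core[OF ne] isCont_shell[OF x0] core_less_shell[OF s(1) 2]])
    then have "\<forall>\<^sub>F x in nhds x0. barrier x = core s x"
      using ev2
    proof eventually_elim
      case (elim x)
      then show ?case
        using barrier_eq(1,2)[OF s(1), of x] by (cases "norm (x - s) < r1") auto
    qed
    then show ?thesis using s(1) by blast
  next
    case 3
    have "\<forall>\<^sub>F x in nhds x0. barrier x = min (core s x) (shell x)"
      using eventually_norm_greater[OF 3] ev2 by eventually_elim (rule barrier_eq(2)[OF s(1)], auto)
    then show ?thesis using s(1) by blast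
  qed
next
  case False
  have "\<forall>\<^sub>F x in nhds x0. r2 \<le> norm (x - s) \<or> r1 \<le> norm (x - s) \<and> shell x < core s x" if s: "s \<in> S" for s
  proof (cases "norm (x0 - s) = r2")
    case True
    then have "r1 < norm (x0 - s)" using r1 by simp
    moreover have "x0 \<noteq> s" using s x0 by blast
    ultimately have "\<forall>\<^sub>F x in nhds x0. r1 < norm (x - s)" "\<forall>\<^sub>F x in nhds x0. shell x < core s x"
      using isCont_eventually_less[OF isCont_shell[OF x0] isCont_core shell_less_core[OF s True]]
      by (auto intro: eventually_norm_greater)
    then show ?thesis by eventually_elim auto
  next
    case n: False
    then have "r2 < norm (x0 - s)" using False s by force
    then show ?thesis using eventually_norm_greater by (force elim: eventually_mono)
  qed
  then have "\<forall>\<^sub>F x in nhds x0. \<forall>s\<in>S. r2 \<le> norm (x - s) \<or> r1 \<le> norm (x - s) \<and> shell x < core s x"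
    using S(1) by (simp add: eventually_ball_finite)
  then have "\<forall>\<^sub>F x in nhds x0. barrier x = shell x"
  proof eventually_elim
    case (elim x)
    show ?case
    proof (cases "\<exists>s\<in>S. norm (x - s) < r2")
      case True
      then obtain s where s: "s \<in> S" "norm (x - s) < r2" by blast
      then have "r1 \<le> norm (x - s)" "shell x < core s x" using elim by force+
      then show ?thesis using barrier_eq(2)[OF s(1) _ s(2)] by simp
    next
      case False
      then show ?thesis by (intro barrier_eq(3)) force
    qed
  qed
  then show ?thesis by blast
qed

lemma isCont_barrier:
  assumes x0: "x0 \<notin> S"
  shows "isCont barrier x0"
proof -
  have ne: "x0 \<noteq> s" if "s \<in> S" for s using that x0 by blast
  show ?thesis
    using barrier_local[OF x0]
  proof (elim disjE bexE)
    fix s assume s: "s \<in> S" "\<forall>\<^sub>F x in nhds x0. barrier x = core s x"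
    then show ?thesis using isCont_core[OF ne[OF s(1)]] isCont_cong[OF s(2)] by blast
  next
    fix s assume s: "s \<in> S" "\<forall>\<^sub>F x in nhds x0. barrier x = min (core s x) (shell x)"
    have "isCont (\<lambda>x. min (core s x) (shell x)) x0"
      by (intro continuous_min isCont_core ne s isCont_shell x0)
    then show ?thesis using isCont_cong[OF s(2)] by blast
  next
    assume ev: "\<forall>\<^sub>F x in nhds x0. barrier x = shell x"
    show ?thesis using isCont_shell[OF x0] isCont_cong[OF ev] by blast
  qed
qed

lemma strict_core: "x0 \<noteq> s \<Longrightarrow> strict_p_supersolution_at p (core s) x0"
proof -
  assume x0: "x0 \<noteq> s"
  define c where "c = base 1 + f r2 + (slope + 2) * r2"
  have "pole r = r2 * r1 powr \<gamma> * r powr - \<gamma>" if "0 \<le> r" for r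
    using that r1(1) by (simp add: pole_def powr_divide powr_minus_divide[of r1])
  then have "core s = (\<lambda>x. 1 * (c + (r2 * r1 powr \<gamma> * norm (x - s) powr - \<gamma> - norm (x - s))))"
    by (simp add: core_def[abs_def] c_def)
  moreover have "strict_p_supersolution_at p (\<lambda>x. 1 * (c + (r2 * r1 powr \<gamma> * norm (x - s) powr - \<gamma> - norm (x - s)))) x0"
    using strict_p_supersolution_at_affine[OF strict_p_supersolution_fundamental[OF dim p _ x0], of "r2 * r1 powr \<gamma>" 1 c]
      r1 r2 by (simp add: \<gamma>_def)
  ultimately show ?thesis by simp
qed

definition "f_deriv r = 1 - (R / r) powr bet"
definition "f_deriv2 r = bet * (R / r) powr bet / r"

lemma C2_data_f:
  "C2_data (- {s}) (\<lambda>x::'a. f (norm (x - s))) (\<lambda>x. (f_deriv (norm (x - s)) / norm (x - s)) *\<^sub>R (x - s))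
    (\<lambda>x. radial_hessian (x - s) (f_deriv (norm (x - s)) / norm (x - s))
      (f_deriv2 (norm (x - s))))"
proof (rule C2_data_radial[where c = s and \<eta> = f and \<eta>' = f_deriv and \<eta>'' = f_deriv2])
  show "continuous_on {0<..} f_deriv2"
    unfolding f_deriv2_def[abs_def] using R by (intro continuous_intros) auto
next
  fix r :: real assume r: "0 < r"
  show "(f has_real_derivative f_deriv r) (at r)" unfolding f_deriv_def by (rule DERIV_f[OF r])
  have eq: "(R / y) powr bet = R powr bet * y powr - bet" if "0 < y" for y
    using that R by (simp add: powr_divide powr_minus_divide)
  have "((\<lambda>y. 1 - R powr bet * y powr - bet) has_real_derivative 0 - R powr bet * (- bet * r powr (- bet - 1))) (at r)"
    by (intro DERIV_diff DERIV_const DERIV_cmult has_real_derivative_powr r)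
  moreover have "0 - R powr bet * (- bet * r powr (- bet - 1)) = bet * (R / r) powr bet / r"
    using r by (simp add: eq powr_diff)
  ultimately have "((\<lambda>y. 1 - R powr bet * y powr - bet) has_real_derivative bet * (R / r) powr bet / r) (at r)"
    by simp
  then show "(f_deriv has_real_derivative f_deriv2 r) (at r)"
    unfolding f_deriv_def[abs_def] f_deriv2_def
    by (rule has_field_derivative_transform_within_open[of _ _ _ "{0<..}"]) (use r eq in auto)
qed

text \<open>Put \<open>w = (R / r) powr bet\<close>. As \<open>Lam * bet = lam / 2\<close>, the
  worst radial term uses up half of the tangential gain and \<open>lam * ((1 - w / 2) / r)\<close>
  remains. This is nonpositive for \<open>w \<ge> 2\<close>; otherwise
  \<open>1 / r \<le> 2 * N / R\<close>.\<close>

lemma f_laplacian_le: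
  fixes y n :: 'a
  assumes y: "y \<noteq> 0" "norm y \<le> R" and n: "norm n \<le> 1"
  shows "normalized_p_laplacian p (radial_hessian y (f_deriv (norm y) / norm y)
    (f_deriv2 (norm y))) n \<le> lam * (N / R)"
proof -
  define r where "r = norm y"
  define w where "w = (R / r) powr bet"
  have r: "0 < r" "r \<le> R" using y by (auto simp: r_def)
  have w: "1 \<le> w" using r bet(1) by (auto simp: w_def intro!: ge_one_powr_ge_zero)
  have neg: "(1 - w) / r \<le> 0" using w r by (simp add: divide_nonpos_pos)
  have b: "0 \<le> bet * w / r" using w r bet(1) by simp
  have "normalized_p_laplacian p (radial_hessian y ((1 - w) / r) (bet * w / r)) n
      \<le> max (lam * (bet * w / r)) (Lam * (bet * w / r)) + lam * ((1 - w) / r)"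
    using normalized_p_laplacian_radial_le[OF y(1) n dim neg p(1)] by (simp only: lam_def Lam_def)
  also have "max (lam * (bet * w / r)) (Lam * (bet * w / r)) = Lam * (bet * w / r)"
    using lam(2) b by (intro max_absorb2 mult_right_mono)
  also have "Lam * (bet * w / r) = lam / 2 * (w / r)" using bet(3) by (metis mult.assoc times_divide_eq_right)
  also have "lam / 2 * (w / r) + lam * ((1 - w) / r) = lam * ((1 - w / 2) / r)"
    using r by (simp add: field_simps)
  also have "\<dots> \<le> lam * (N / R)"
  proof (rule mult_left_mono)
    show "(1 - w / 2) / r \<le> N / R"
    proof (cases "2 \<le> w")
      case True
      then have "(1 - w / 2) / r \<le> 0" using r by (simp add: divide_nonpos_pos)
      also have "0 \<le> N / R" using N R by simp
      finally show ?thesis .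
    next
      case False
      have "R / r = w powr (1 / bet)" using r R bet(1) by (simp add: w_def powr_powr)
      also have "\<dots> \<le> 2 powr (1 / bet)" using False w bet(1) by (intro powr_mono2) auto
      finally have "R / r \<le> 2 * N" by (simp add: N_def)
      then have "1 / r \<le> 2 * N / R" using R r by (simp add: field_simps)
      moreover have "(1 - w / 2) / r \<le> (1 / 2) / r" using w r by (intro divide_right_mono) auto
      ultimately show ?thesis by simp
    qed
  qed (use lam in simp)
  finally show ?thesis unfolding f_deriv_def f_deriv2_def w_def r_def .
qed

definition "cap_deriv r = - \<delta> - 2 * (N / R) * (r - 1 + 2 * R)"
text \<open>The formula of \<open>base\<close> on the shell, continued smoothly past both ends of
  it.\<close>

definition "cap r = - \<delta> * r - N / R * (r - 1 + 2 * R)\<^sup>2"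

lemma C2_data_cap:
  "C2_data (- {0}) (\<lambda>x::'a. cap (norm x)) (\<lambda>x. (cap_deriv (norm x) / norm x) *\<^sub>R x)
    (\<lambda>x. radial_hessian x (cap_deriv (norm x) / norm x) (- 2 * (N / R)))"
proof -
  have "C2_data (- {0}) (\<lambda>x::'a. cap (norm (x - 0))) (\<lambda>x. (cap_deriv (norm (x - 0)) / norm (x - 0)) *\<^sub>R (x - 0))
    (\<lambda>x. radial_hessian (x - 0) (cap_deriv (norm (x - 0)) / norm (x - 0)) (- 2 * (N / R)))"
    by (rule C2_data_radial[where c = 0 and \<eta> = cap and \<eta>' = cap_deriv and \<eta>'' = "\<lambda>r. - 2 * (N / R)"])
      (use R in \<open>auto simp: cap_def[abs_def] cap_deriv_def[abs_def] intro!: derivative_eq_intros continuous_intros\<close>)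
  then show ?thesis by simp
qed

text \<open>The tangential part has the right sign because \<open>cap\<close> decreases; the radial
  curvature alone yields twice what a bump can spoil.\<close>

lemma cap_laplacian_le:
  fixes y n :: 'a
  assumes y: "y \<noteq> 0" "1 - 2 * R < norm y" and n: "norm n \<le> 1"
  shows "normalized_p_laplacian p (radial_hessian y (cap_deriv (norm y) / norm y) (- 2 * (N / R))) n
    \<le> - 2 * (lam * (N / R))"
proof -
  have NR: "0 \<le> N / R" using N R by simp
  define a where "a = cap_deriv (norm y) / norm y"
  have "0 \<le> 2 * (N / R) * (norm y - 1 + 2 * R)" using NR y(2) by (intro mult_nonneg_nonneg) auto
  then have a: "a \<le> 0" unfolding a_def cap_deriv_def using \<delta>(1) y(1) by (intro divide_nonpos_pos) auto
  have "normalized_p_laplacian p (radial_hessian y a (- 2 * (N / R))) n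
      \<le> max (lam * (- 2 * (N / R))) (Lam * (- 2 * (N / R))) + lam * a"
    using normalized_p_laplacian_radial_le[OF y(1) n dim a p(1)] by (simp only: lam_def Lam_def)
  also have "max (lam * (- 2 * (N / R))) (Lam * (- 2 * (N / R))) = lam * (- 2 * (N / R))"
    using lam(2) NR by (intro max_absorb1 mult_right_mono_neg) auto
  also have "lam * a \<le> 0" using lam(1) a by (intro mult_nonneg_nonpos) auto
  finally show ?thesis unfolding a_def by (simp add: mult_ac)
qed

lemma strict_cap:
  fixes x0 :: 'a
  assumes "x0 \<noteq> 0" "1 - 2 * R < norm x0"
  shows "strict_p_supersolution_at p (\<lambda>x. cap (norm x)) x0"
proof (rule strict_p_supersolution_atI[OF _ _ C2_data_cap])
  have "0 < 2 * (lam * (N / R))" using lam N R by simp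
  then show "(\<exists>c>0. \<forall>n. norm n \<le> 1 \<longrightarrow> normalized_p_laplacian p (radial_hessian x0 (cap_deriv (norm x0) / norm x0) (- 2 * (N / R))) n \<le> - c) \<or>
    (cap_deriv (norm x0) / norm x0) *\<^sub>R x0 \<noteq> 0 \<and>
    normalized_p_laplacian p (radial_hessian x0 (cap_deriv (norm x0) / norm x0) (- 2 * (N / R)))
      (sgn ((cap_deriv (norm x0) / norm x0) *\<^sub>R x0)) < 0"
    using cap_laplacian_le[OF assms] by (intro disjI1 exI[of _ "2 * (lam * (N / R))"]) simp
qed (use assms in auto)

text \<open>The gradients of \<open>cap\<close> and \<open>f\<close> are unrelated, but both
  operator bounds hold for every \<open>n\<close> in the unit ball and the operator is additive in
  the Hessian. Half of the negativity of \<open>cap\<close> survives.\<close>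

lemma strict_cap_add_f:
  fixes x0 s :: 'a
  assumes x0: "x0 \<noteq> 0" "1 - 2 * R < norm x0" "x0 \<noteq> s" "norm (x0 - s) \<le> R"
  shows "strict_p_supersolution_at p (\<lambda>x. cap (norm x) + f (norm (x - s))) x0"
proof (rule strict_p_supersolution_atI[of "- {0, s}"])
  let ?q = "\<lambda>x. (cap_deriv (norm x) / norm x) *\<^sub>R x + (f_deriv (norm (x - s)) / norm (x - s)) *\<^sub>R (x - s)"
  let ?H = "\<lambda>x v. radial_hessian x (cap_deriv (norm x) / norm x) (- 2 * (N / R)) v +
    radial_hessian (x - s) (f_deriv (norm (x - s)) / norm (x - s)) (f_deriv2 (norm (x - s))) v"
  show "C2_data (- {0, s}) (\<lambda>x. cap (norm x) + f (norm (x - s))) ?q ?H"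
  proof (rule C2_data_add)
    show "C2_data (- {0, s}) (\<lambda>x::'a. cap (norm x)) (\<lambda>x. (cap_deriv (norm x) / norm x) *\<^sub>R x)
      (\<lambda>x. radial_hessian x (cap_deriv (norm x) / norm x) (- 2 * (N / R)))"
      using C2_data_cap unfolding C2_data_def by (auto intro: continuous_on_subset)
    show "C2_data (- {0, s}) (\<lambda>x::'a. f (norm (x - s))) (\<lambda>x. (f_deriv (norm (x - s)) / norm (x - s)) *\<^sub>R (x - s))
      (\<lambda>x. radial_hessian (x - s) (f_deriv (norm (x - s)) / norm (x - s)) (f_deriv2 (norm (x - s))))"
      using C2_data_f[of s] unfolding C2_data_def by (auto intro: continuous_on_subset)
  qed
  have "normalized_p_laplacian p (?H x0) n \<le> - (lam * (N / R))" if n: "norm n \<le> 1" for n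
  proof -
    have "x0 - s \<noteq> 0" using x0 by simp
    from add_mono[OF cap_laplacian_le[OF x0(1,2) n] f_laplacian_le[OF this x0(4) n]]
    show ?thesis unfolding normalized_p_laplacian_add by (simp add: mult_ac)
  qed
  moreover have "0 < lam * (N / R)" using lam N R by simp
  ultimately show "(\<exists>c>0. \<forall>n. norm n \<le> 1 \<longrightarrow> normalized_p_laplacian p (?H x0) n \<le> - c) \<or>
      ?q x0 \<noteq> 0 \<and> normalized_p_laplacian p (?H x0) (sgn (?q x0)) < 0" by blast
qed (use x0 in auto)

lemma shell_far_sphere: "R \<le> \<bar>norm x - 1\<bar> \<Longrightarrow> shell x = base (norm x)"
  using norm_S[of _ x] by (intro shell_far) force

text \<open>By convexity \<open>psi\<close> lies above both of its affine pieces, so the cones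
  continuing \<open>base\<close> inside and outside the shell dominate it everywhere and touch it
  even at the seams, where \<open>base\<close> is not twice differentiable. No bump reaches those
  two regions.\<close>

lemma shell_touch:
  assumes x0: "x0 \<notin> S"
  shows "\<exists>\<phi>. \<phi> x0 = shell x0 \<and> (\<forall>\<^sub>F x in nhds x0. shell x \<le> \<phi> x) \<and> strict_p_supersolution_at p \<phi> x0"
proof -
  have R1: "2 * R < 1" using R \<delta> by simp
  note less = eventually_norm_less[of _ 0, simplified] and greater = eventually_norm_greater[of _ _ 0, simplified]
  have NR: "0 \<le> N / R" using N R by simp
  have base_cone: "base r \<le> - \<delta> * r" for r
    using mult_nonneg_nonneg[OF NR psi_lower(1)] by (simp add: base_def)
  consider "x0 = 0" | "x0 \<noteq> 0" "norm x0 \<le> 1 - 2 * R" | "1 - 2 * R < norm x0" "norm x0 < 1 + 2 * R" | "1 + 2 * R \<le> norm x0"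
    by linarith
  then show ?thesis
  proof cases
    case 1
    have "\<forall>\<^sub>F x in nhds x0. norm x < 1 - R" using 1 R1 R by (intro less) auto
    then have "\<forall>\<^sub>F x in nhds x0. shell x \<le> - \<delta> * (x \<bullet> x)"
    proof eventually_elim
      case (elim x)
      have "norm x * norm x \<le> norm x * 1" using elim R by (intro mult_left_mono) auto
      then have "\<delta> * (x \<bullet> x) \<le> \<delta> * norm x"
        using \<delta> by (intro mult_left_mono) (auto simp: power2_norm_eq_inner[symmetric] power2_eq_square)
      then show ?case using base_cone[of "norm x"] shell_far_sphere[of x] elim by simp
    qed
    moreover have "shell x0 = 0"
      using 1 R R1 shell_far_sphere[of x0] by (simp add: base_def psi_def)
    ultimately show ?thesis
      using 1 strict_p_supersolution_paraboloid[OF dim p(1) \<delta>(1)] by (intro exI[of _ "\<lambda>x. - \<delta> * (x \<bullet> x)"]) simp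
  next
    case 2
    have "\<forall>\<^sub>F x in nhds x0. norm x < 1 - R" using 2 R by (intro less) auto
    then have "\<forall>\<^sub>F x in nhds x0. shell x \<le> - \<delta> * norm x"
    proof eventually_elim
      case (elim x)
      then show ?case using base_cone[of "norm x"] shell_far_sphere[of x] by simp
    qed
    moreover have "shell x0 = - \<delta> * norm x0"
      using 2 R R1 shell_far_sphere[of x0] by (simp add: base_def psi_def)
    ultimately show ?thesis
      using strict_p_supersolution_cone[OF dim p(1) \<delta>(1) 2(1)] by (intro exI[of _ "\<lambda>x. - \<delta> * norm x"]) simp
  next
    case 4
    \<comment> \<open>The affine tail of \<open>psi\<close> inserted into \<open>base\<close>,
      written as a constant plus a cone; the factor 1 fits the rule for affine changes.\<close>
    let ?\<phi> = "\<lambda>x::'a. 1 * (8 * N + - (\<delta> + 8 * N) * norm x)"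
    have eq: "- \<delta> * r - N / R * (8 * R * (r - 1 + 2 * R) - 16 * R\<^sup>2) = 1 * (8 * N + - (\<delta> + 8 * N) * r)" for r
      using R by (simp add: field_simps power2_eq_square)
    have "\<forall>\<^sub>F x in nhds x0. 1 + R < norm x" using 4 R by (intro greater) auto
    then have "\<forall>\<^sub>F x in nhds x0. shell x \<le> ?\<phi> x"
    proof eventually_elim
      case (elim x)
      have "N / R * (8 * R * (norm x - 1 + 2 * R) - 16 * R\<^sup>2) \<le> N / R * psi (norm x - 1 + 2 * R)"
        using NR psi_lower(2) by (intro mult_left_mono)
      then show ?case unfolding eq[symmetric] using shell_far_sphere[of x] elim by (simp add: base_def)
    qed
    moreover have "?\<phi> x0 = shell x0"
      unfolding eq[symmetric] using 4 R shell_far_sphere[of x0] psi_lower(4)[of "norm x0 - 1 + 2 * R"] by (simp add: base_def)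
    moreover have "x0 \<noteq> 0" using 4 R by auto
    then have "strict_p_supersolution_at p ?\<phi> x0"
      using strict_p_supersolution_cone[OF dim p(1), of "\<delta> + 8 * N" x0] 4 \<delta> N R
      by (intro strict_p_supersolution_at_affine) auto
    ultimately show ?thesis by (intro exI[of _ ?\<phi>]) blast
  next
    case 3
    have x00: "x0 \<noteq> 0" using 3 R1 by auto
    have cap: "base r = cap r" if "1 - 2 * R < r" "r < 1 + 2 * R" for r
      using psi_lower(3)[of "r - 1 + 2 * R"] that by (simp add: base_def cap_def)
    have ev: "\<forall>\<^sub>F x in nhds x0. 1 - 2 * R < norm x" "\<forall>\<^sub>F x in nhds x0. norm x < 1 + 2 * R"
      using 3 by (auto intro: less greater)
    show ?thesis
    proof (cases "\<exists>s\<in>S. norm (x0 - s) \<le> R")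
      case True
      then obtain s where s: "s \<in> S" "norm (x0 - s) \<le> R" by blast
      have ne: "x0 \<noteq> s" using s x0 by blast
      have "\<forall>\<^sub>F x in nhds x0. x \<noteq> s" using ne by (rule t1_space_nhds)
      moreover have "\<forall>\<^sub>F x in nhds x0. norm (x - s) < 2 * R" using s R by (intro eventually_norm_less) auto
      ultimately have "\<forall>\<^sub>F x in nhds x0. shell x \<le> cap (norm x) + f (norm (x - s))"
        using ev
      proof eventually_elim
        case (elim x)
        then show ?case using shell_le[OF s(1)] cap[of "norm x"] by metis
      qed
      moreover have "shell x0 = cap (norm x0) + f (norm (x0 - s))"
        using shell_near[OF s] cap 3 by simp
      ultimately show ?thesis
        using strict_cap_add_f[OF x00 3(1) ne s(2)] by (intro exI[of _ "\<lambda>x. cap (norm x) + f (norm (x - s))"]) simp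
    next
      case False
      have "\<forall>\<^sub>F x in nhds x0. \<forall>s\<in>S. R < norm (x - s)"
        using False S(1) by (intro eventually_ball_finite) (simp_all add: not_le eventually_norm_greater)
      then have "\<forall>\<^sub>F x in nhds x0. shell x \<le> cap (norm x)"
        using ev
      proof eventually_elim
        case (elim x)
        then have "shell x = base (norm x)" by (intro shell_far) force
        then show ?case using cap elim by simp
      qed
      moreover have "shell x0 = cap (norm x0)"
        using False 3 cap shell_far[of x0] by force
      ultimately show ?thesis
        using strict_cap[OF x00 3(1)] by (intro exI[of _ "\<lambda>x. cap (norm x)"]) simp
    qed
  qed
qed

text \<open>At a minimum of two functions it suffices to touch the one that attains the
  minimum.\<close>

lemma barrier_touch:
  assumes x0: "x0 \<notin> S"
  shows "\<exists>\<phi>. \<phi> x0 = barrier x0 \<and> (\<forall>\<^sub>F x in nhds x0. barrier x \<le> \<phi> x) \<and> strict_p_supersolution_at p \<phi> x0"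
  using barrier_local[OF x0]
proof (elim disjE bexE)
  fix s assume s: "s \<in> S" and ev: "\<forall>\<^sub>F x in nhds x0. barrier x = core s x"
  have "barrier x0 = core s x0" using ev eventually_nhds_x_imp_x by fast
  moreover have "\<forall>\<^sub>F x in nhds x0. barrier x \<le> core s x" using ev by eventually_elim simp
  moreover have "x0 \<noteq> s" using s x0 by blast
  ultimately show ?thesis using strict_core by (intro exI[of _ "core s"]) simp
next
  fix s assume s: "s \<in> S" and ev: "\<forall>\<^sub>F x in nhds x0. barrier x = min (core s x) (shell x)"
  have eq: "barrier x0 = min (core s x0) (shell x0)" using eventually_nhds_x_imp_x[OF ev] .
  show ?thesis
  proof (cases "core s x0 \<le> shell x0")
    case True
    have "\<forall>\<^sub>F x in nhds x0. barrier x \<le> core s x" using ev by eventually_elim simp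
    moreover have "x0 \<noteq> s" using s x0 by blast
    ultimately show ?thesis using strict_core True eq by (intro exI[of _ "core s"]) simp
  next
    case False
    obtain \<phi> where \<phi>: "\<phi> x0 = shell x0" "\<forall>\<^sub>F x in nhds x0. shell x \<le> \<phi> x" "strict_p_supersolution_at p \<phi> x0"
      using shell_touch[OF x0] by blast
    have "\<forall>\<^sub>F x in nhds x0. barrier x \<le> \<phi> x" using ev \<phi>(2) by eventually_elim simp
    then show ?thesis using \<phi> False eq by (intro exI[of _ \<phi>]) simp
  qed
next
  assume ev: "\<forall>\<^sub>F x in nhds x0. barrier x = shell x"
  obtain \<phi> where \<phi>: "\<phi> x0 = shell x0" "\<forall>\<^sub>F x in nhds x0. shell x \<le> \<phi> x" "strict_p_supersolution_at p \<phi> x0"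
    using shell_touch[OF x0] by blast
  have "\<forall>\<^sub>F x in nhds x0. barrier x \<le> \<phi> x" using ev \<phi>(2) by eventually_elim simp
  moreover have "barrier x0 = shell x0" using eventually_nhds_x_imp_x[OF ev] .
  ultimately show ?thesis using \<phi> by (intro exI[of _ \<phi>]) simp
qed

end

section \<open>Boundary values and size of the barrier\<close>

context punctured_sphere_barrier
begin

text \<open>Compensates the lower bound \<open>- (16 * N + 2) * \<delta>\<close> of
  \<open>base\<close> and leaves \<open>2 * \<delta>\<close>, half of which pays for
  \<open>- norm (x - s)\<close> in \<open>core\<close>.\<close>

definition "lift = (16 * N + 4) * \<delta>"

lemma S_notin_Omega_dom: "0 < \<alpha> \<Longrightarrow> x \<in> Omega_dom \<delta> \<epsilon> S \<alpha> \<Longrightarrow> x \<notin> S"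
  using \<epsilon>(1) by (auto simp: Omega_dom_def)

lemma shell_lower: "x \<notin> S \<Longrightarrow> norm x \<le> 1 + \<delta> \<Longrightarrow> 2 * \<delta> \<le> lift + shell x"
  using base_bounds(2)[of "norm x"] base_le_shell[of x] by (simp add: lift_def algebra_simps)

lemma core_lower: "norm (x - s) < r2 \<Longrightarrow> \<delta> + pole (norm (x - s)) \<le> lift + core s x"
proof -
  assume x: "norm (x - s) < r2"
  have "- (16 * N + 2) * \<delta> \<le> base 1" using base_bounds(2)[of 1] \<delta> by simp
  moreover have "0 \<le> f r2" using f_nonneg[OF r2(1)] .
  moreover have "0 \<le> (slope + 2) * r2" using r2(1) N by (simp add: slope_def)
  moreover have "norm (x - s) \<le> \<delta>" using x r2 R by linarith
  ultimately show ?thesis unfolding core_def lift_def by (simp add: algebra_simps)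
qed

text \<open>Inside radius \<open>r1\<close> the pole is a summand of the barrier; from
  \<open>r1\<close> on it has dropped to at most \<open>r2 \<le> \<delta>\<close>, below the lifted
  barrier anyway. Boundary values at the holes thus reduce to the pole.\<close>

lemma barrier_lower:
  assumes x: "x \<notin> S" "norm x \<le> 1 + \<delta>"
  shows "\<delta> \<le> lift + barrier x" and "s \<in> S \<Longrightarrow> pole (norm (x - s)) \<le> lift + barrier x"
proof -
  have pos: "0 < norm (x - t)" if "t \<in> S" for t using that x by auto
  have sh: "2 * \<delta> \<le> lift + shell x" by (rule shell_lower[OF x])
  have main: "\<delta> \<le> lift + barrier x \<and> (\<forall>s\<in>S. norm (x - s) < r1 \<longrightarrow> pole (norm (x - s)) \<le> lift + barrier x)"
  proof (cases "\<exists>t\<in>S. norm (x - t) < r2")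
    case True
    then obtain t where t: "t \<in> S" "norm (x - t) < r2" by blast
    have c: "\<delta> + pole (norm (x - t)) \<le> lift + core t x" by (rule core_lower[OF t(2)])
    have p0: "0 < pole (norm (x - t))" by (rule pole_pos[OF pos[OF t(1)]])
    have uniq: "s = t" if "s \<in> S" "norm (x - s) < r1" for s
      using near_eq[OF t] near_eq[OF that(1), of x] that(2) r1 by simp
    show ?thesis
    proof (cases "norm (x - t) < r1")
      case True
      then have "barrier x = core t x" by (rule barrier_eq(1)[OF t(1)])
      then show ?thesis using c p0 uniq \<delta> by force
    next
      case False
      then have "barrier x = min (core t x) (shell x)" by (intro barrier_eq(2)[OF t(1) _ t(2)]) simp
      moreover have "\<not> norm (x - s) < r1" if "s \<in> S" for s using uniq[OF that] False by blast
      ultimately show ?thesis using c p0 sh \<delta> by (auto simp: min_def)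
    qed
  next
    case False
    then have "barrier x = shell x" by (intro barrier_eq(3)) force
    moreover have "\<not> norm (x - s) < r1" if "s \<in> S" for s using False that r1 by force
    ultimately show ?thesis using sh \<delta> by auto
  qed
  then show "\<delta> \<le> lift + barrier x" by blast
  assume s: "s \<in> S"
  show "pole (norm (x - s)) \<le> lift + barrier x"
  proof (cases "norm (x - s) < r1")
    case False
    then have "pole (norm (x - s)) \<le> r2" using pole_mono[of r1 "norm (x - s)"] r1 pole_r1 by simp
    also have "r2 \<le> \<delta>" using r2 R by linarith
    finally show ?thesis using main by simp
  qed (use main s in blast)
qed

text \<open>Holes of relative radius 1/10 contain the balls of radius \<open>r2\<close>, so only
  \<open>shell\<close> is seen there, and it involves neither the pole nor \<alpha>.\<close>

lemma barrier_upper: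
  assumes x: "x \<in> Omega_dom \<delta> \<epsilon> S (1 / 10)"
  shows "lift + barrier x \<le> (16 * N + 5) * \<delta>"
proof -
  have far: "\<epsilon> / 10 < norm (x - s)" if "s \<in> S" for s
    using x that by (auto simp: Omega_dom_def dist_norm norm_minus_commute)
  have r2': "r2 < \<epsilon> / 10" using r2 \<epsilon>(1) by (simp add: R_def)
  have b: "barrier x = shell x" using far r2' by (intro barrier_eq(3)) force
  have "shell x \<le> 2 * R"
  proof (cases "\<exists>s\<in>S. norm (x - s) \<le> R")
    case True
    then obtain s where s: "s \<in> S" "norm (x - s) \<le> R" by blast
    have "0 < norm (x - s)" using far[OF s(1)] \<epsilon>(1) by linarith
    then have "f (norm (x - s)) \<le> 2 * R" using s(2) by (rule f_le)
    moreover have "base (norm x) \<le> 0" by (rule base_bounds(1)) simp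
    ultimately show ?thesis using shell_near[OF s] by linarith
  next
    case False
    then have "shell x = base (norm x)" by (intro shell_far) force
    then show ?thesis using base_bounds(1)[of "norm x"] R by simp
  qed
  then show ?thesis using b R by (simp add: lift_def algebra_simps)
qed

text \<open>Both \<open>r1\<close> and \<open>r2\<close> are \<epsilon> times constants depending on
  \<open>p\<close>. This scaling is the origin of the threshold
  \<open>\<tau>1 * \<epsilon> powr (1 / \<gamma>)\<close> for \<alpha>.\<close>

lemma pole_at_hole:
  assumes \<alpha>: "0 < \<alpha>"
  shows "pole (\<alpha> * \<epsilon>) = \<epsilon> * (2 * ratio * ratio powr \<gamma>) * \<alpha> powr - \<gamma>"
proof -
  have rp: "0 < ratio" using r2(1) R by (simp add: r2_def zero_less_mult_iff)
  have r1': "r1 = \<epsilon> * ratio" "r2 = \<epsilon> * (2 * ratio)" by (simp_all add: r1_def r2_def R_def)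
  have "\<alpha> * \<epsilon> / r1 = \<alpha> / ratio" using \<epsilon>(1) by (simp add: r1')
  then have "(\<alpha> * \<epsilon> / r1) powr - \<gamma> = ratio powr \<gamma> * \<alpha> powr - \<gamma>"
    using \<alpha> rp by (simp add: powr_divide powr_minus_divide)
  then show ?thesis by (simp add: pole_def r1'(2))
qed

lemma Omega_dom: "open (Omega_dom \<delta> \<epsilon> S \<alpha>)" "bounded (Omega_dom \<delta> \<epsilon> S \<alpha>)"
proof -
  have "closed (\<Union>s\<in>S. cball s (\<alpha> * \<epsilon>))" using S(1) by (intro closed_UN) auto
  then show "open (Omega_dom \<delta> \<epsilon> S \<alpha>)" unfolding Omega_dom_def by (intro open_Diff) auto
  show "bounded (Omega_dom \<delta> \<epsilon> S \<alpha>)"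
    unfolding Omega_dom_def by (rule bounded_subset[OF bounded_ball]) auto
qed

lemma barrier_in_upper_class:
  assumes \<alpha>: "0 < \<alpha>" and m: "0 < m" "1 \<le> m * pole (\<alpha> * \<epsilon>)"
  shows "(\<lambda>x. ereal (m * (lift + barrier x))) \<in>
    upper_class p (Omega_dom \<delta> \<epsilon> S \<alpha>) (\<lambda>x. if x \<in> (\<Union>s\<in>S. cball s (\<alpha> * \<epsilon>)) then 1 else 0)"
proof -
  let ?\<Omega> = "Omega_dom \<delta> \<epsilon> S \<alpha>" and ?v = "\<lambda>x. m * (lift + barrier x)"
  have notS: "x \<notin> S" if "x \<in> ?\<Omega>" for x by (rule S_notin_Omega_dom[OF \<alpha> that])
  have nrm: "norm x \<le> 1 + \<delta>" if "x \<in> ?\<Omega>" for x using that by (simp add: Omega_dom_def)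
  have nonneg: "0 \<le> ?v x" if "x \<in> ?\<Omega>" for x
    using barrier_lower(1)[OF notS[OF that] nrm[OF that]] \<delta> m(1) by simp
  have cont: "continuous_on ?\<Omega> ?v"
  proof (rule continuous_at_imp_continuous_on, rule ballI)
    fix x assume "x \<in> ?\<Omega>"
    then show "isCont ?v x" using isCont_barrier notS by (intro continuous_intros) auto
  qed
  have "p_superharmonic p ?\<Omega> (\<lambda>x. ereal (?v x))"
  proof (rule p_superharmonic_if_touched_above[OF p(1) Omega_dom(1) cont])
    fix x0 assume "x0 \<in> ?\<Omega>"
    from barrier_touch[OF notS[OF this]] obtain \<phi> where \<phi>: "\<phi> x0 = barrier x0"
      "\<forall>\<^sub>F x in nhds x0. barrier x \<le> \<phi> x" "strict_p_supersolution_at p \<phi> x0" by blast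
    have "\<forall>\<^sub>F x in nhds x0. ?v x \<le> m * (lift + \<phi> x)"
      using \<phi>(2) by eventually_elim (use m(1) in simp)
    then show "\<exists>\<phi>. \<phi> x0 = ?v x0 \<and> (\<forall>\<^sub>F x in nhds x0. ?v x \<le> \<phi> x) \<and> strict_p_supersolution_at p \<phi> x0"
      using \<phi>(1) strict_p_supersolution_at_affine[OF \<phi>(3) m(1), of lift]
      by (intro exI[of _ "\<lambda>x. m * (lift + \<phi> x)"]) simp
  qed
  moreover have "\<exists>M::real. \<forall>x\<in>?\<Omega>. ereal M \<le> ereal (?v x)"
    using nonneg by (intro exI[of _ 0]) simp
  moreover have "ereal (if \<xi> \<in> (\<Union>s\<in>S. cball s (\<alpha> * \<epsilon>)) then 1 else 0) \<le> Liminf (at \<xi> within ?\<Omega>) (\<lambda>x. ereal (?v x))"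
    if \<xi>: "\<xi> \<in> frontier ?\<Omega>" for \<xi>
  proof (cases "\<xi> \<in> (\<Union>s\<in>S. cball s (\<alpha> * \<epsilon>))")
    case False
    have "\<forall>\<^sub>F x in at \<xi> within ?\<Omega>. x \<in> ?\<Omega>" by (simp add: eventually_at_filter)
    then have "\<forall>\<^sub>F x in at \<xi> within ?\<Omega>. 0 \<le> ereal (?v x)"
      by eventually_elim (use nonneg in simp)
    then show ?thesis using False by (simp add: Liminf_bounded zero_ereal_def)
  next
    case True
    then obtain s where s: "s \<in> S" "norm (\<xi> - s) \<le> \<alpha> * \<epsilon>"
      by (auto simp: dist_norm norm_minus_commute)
    \<comment> \<open>A frontier point lies outside the open hole. Avoiding the centre matters:
      continuity of \<open>pole\<close> is known at positive radii only, and \<open>pole 0\<close>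
      is the default value 0.\<close>
    have pos: "0 < norm (\<xi> - s)"
    proof -
      have "closure ?\<Omega> \<subseteq> - ball s (\<alpha> * \<epsilon>)"
        using s(1) by (intro closure_minimal) (auto simp: Omega_dom_def)
      then have "\<xi> \<notin> ball s (\<alpha> * \<epsilon>)" using \<xi> by (auto simp: frontier_def)
      then show ?thesis using \<alpha> \<epsilon>(1) by auto
    qed
    have "isCont (\<lambda>x. m * pole (norm (x - s))) \<xi>"
      by (intro continuous_intros isCont_o2[OF _ isCont_pole] pos)
    from continuous_at_imp_continuous_within[OF this, of ?\<Omega>]
    have T: "((\<lambda>x. ereal (m * pole (norm (x - s)))) \<longlongrightarrow> ereal (m * pole (norm (\<xi> - s)))) (at \<xi> within ?\<Omega>)"
      unfolding continuous_within by (rule tendsto_ereal)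
    have one: "1 \<le> m * pole (norm (\<xi> - s))"
    proof -
      have "m * pole (\<alpha> * \<epsilon>) \<le> m * pole (norm (\<xi> - s))"
        using pole_mono[OF pos s(2)] m(1) by (intro mult_left_mono) auto
      then show ?thesis using m(2) by simp
    qed
    have lim: "\<forall>\<^sub>F x in at \<xi> within ?\<Omega>. y < ereal (m * pole (norm (x - s)))" if "y < 1" for y
    proof (rule order_tendstoD(1)[OF T])
      have "1 \<le> ereal (m * pole (norm (\<xi> - s)))" using one by (simp add: one_ereal_def)
      with that show "y < ereal (m * pole (norm (\<xi> - s)))" by (rule less_le_trans)
    qed
    have "1 \<le> Liminf (at \<xi> within ?\<Omega>) (\<lambda>x. ereal (?v x))"
      unfolding le_Liminf_iff
    proof (intro allI impI)
      fix y :: ereal assume "y < 1"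
      have "\<forall>\<^sub>F x in at \<xi> within ?\<Omega>. x \<in> ?\<Omega>" by (simp add: eventually_at_filter)
      then show "\<forall>\<^sub>F x in at \<xi> within ?\<Omega>. y < ereal (?v x)"
        using lim[OF \<open>y < 1\<close>]
      proof eventually_elim
        case (elim x)
        have "m * pole (norm (x - s)) \<le> ?v x"
          using barrier_lower(2)[OF notS[OF elim(1)] nrm[OF elim(1)] s(1)] m(1) by (intro mult_left_mono) auto
        then show ?case using elim(2) by (meson ereal_less_eq(3) less_le_trans)
      qed
    qed
    then show ?thesis using True by (simp add: one_ereal_def)
  qed
  ultimately show ?thesis unfolding upper_class_def by blast
qed

lemma perron_le:
  assumes \<alpha>: "0 < \<alpha>" "\<alpha> powr \<gamma> \<le> t * \<epsilon>" and z: "z \<in> Omega_dom \<delta> \<epsilon> S (1 / 10)" "z \<in> Omega_dom \<delta> \<epsilon> S \<alpha>"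
  shows "\<bar>perron p (Omega_dom \<delta> \<epsilon> S \<alpha>) (\<lambda>x. if x \<in> (\<Union>s\<in>S. cball s (\<alpha> * \<epsilon>)) then 1 else 0) z\<bar>
    \<le> ereal ((16 * N + 5) / (2 * ratio * ratio powr \<gamma>) * t * \<delta>)"
proof -
  define D where "D = 2 * ratio * ratio powr \<gamma>"
  have rp: "0 < ratio" using r2(1) R by (simp add: r2_def zero_less_mult_iff)
  have D: "0 < D" using rp by (simp add: D_def)
  have "0 < \<alpha> powr \<gamma>" using \<alpha>(1) by simp
  then have "0 < t * \<epsilon>" using \<alpha>(2) by linarith
  then have t: "0 < t" using \<epsilon>(1) by (simp add: zero_less_mult_iff)
  let ?\<Omega> = "Omega_dom \<delta> \<epsilon> S \<alpha>" and ?b = "\<lambda>x. if x \<in> (\<Union>s\<in>S. cball s (\<alpha> * \<epsilon>)) then 1 else (0::real)"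
  \<comment> \<open>The multiplier \<open>t / D\<close> cancels the constant in the pole at the
    hole, and what remains is at least 1 by the assumption on \<alpha>.\<close>
  have "t / D * pole (\<alpha> * \<epsilon>) = t * \<epsilon> / \<alpha> powr \<gamma>"
    unfolding pole_at_hole[OF \<alpha>(1)] D_def[symmetric] using D by (simp add: powr_minus_divide)
  also have "1 \<le> \<dots>" using \<alpha> by simp
  finally have "(\<lambda>x. ereal (t / D * (lift + barrier x))) \<in> upper_class p ?\<Omega> ?b"
    using t D by (intro barrier_in_upper_class[OF \<alpha>(1)]) auto
  then have "perron p ?\<Omega> ?b z \<le> ereal (t / D * (lift + barrier z))"
    unfolding perron_def by (intro Inf_lower) auto
  also have "\<dots> \<le> ereal (t / D * ((16 * N + 5) * \<delta>))"
    using barrier_upper[OF z(1)] t D by (simp add: mult_left_mono divide_right_mono)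
  also have "t / D * ((16 * N + 5) * \<delta>) = (16 * N + 5) / D * t * \<delta>" by simp
  finally have up: "perron p ?\<Omega> ?b z \<le> ereal ((16 * N + 5) / D * t * \<delta>)" .
  have "0 \<le> perron p ?\<Omega> ?b z"
    unfolding perron_def
  proof (rule Inf_greatest)
    fix w assume "w \<in> {u z |u. u \<in> upper_class p ?\<Omega> ?b}"
    then obtain u where u: "u \<in> upper_class p ?\<Omega> ?b" "w = u z" by blast
    have "0 \<le> u z" by (rule upper_class_nonneg[OF Omega_dom _ u(1) z(2)]) simp
    then show "0 \<le> w" using u(2) by simp
  qed
  then show ?thesis using up by (simp add: D_def)
qed

end

theorem theorem5p1:
  fixes p :: real
  assumes "DIM('a::euclidean_space) \<ge> 2" and "1 < p" and "p < real DIM('a)"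
  shows "\<exists>C>0. \<forall>(\<delta>::real) (\<epsilon>::real) (\<tau>1::real) (\<alpha>::real) (S::'a set).
     (let \<gamma> = (real DIM('a) - p) / (p - 1) in
       0 < \<delta> \<and> \<delta> < min (1/2) (1 / (2 * \<gamma>)) \<and> 0 < \<epsilon> \<and> \<epsilon> < \<delta> / 10 \<and> 0 < \<tau>1 \<and>
       0 < \<alpha> \<and> \<alpha> < min (1/80) (\<tau>1 * \<epsilon> powr (1 / \<gamma>)) \<and>
       finite S \<and> S \<subseteq> sphere 0 1 \<and> (\<forall>s\<in>S. \<forall>t\<in>S. s \<noteq> t \<longrightarrow> \<epsilon> \<le> dist s t)
     \<longrightarrow> (\<forall>z\<in>Omega_dom \<delta> \<epsilon> S (1/10).
           \<bar>perron p (Omega_dom \<delta> \<epsilon> S \<alpha>)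
               (\<lambda>x. if x \<in> (\<Union>s\<in>S. cball s (\<alpha> * \<epsilon>)) then 1 else 0) z\<bar>
           \<le> ereal (C * \<tau>1 powr \<gamma> * \<delta>)))"
proof -
  define g where "g = (real DIM('a) - p) / (p - 1)"
  have g: "0 < g" using assms by (simp add: g_def)
  \<comment> \<open>\<open>N\<close> and \<open>ratio\<close> depend on \<open>p\<close> alone and
    \<open>g\<close> on \<open>p\<close> and the dimension, so the constant is fixed before
    \<delta>, \<epsilon>, \<tau>1, \<alpha> and \<open>S\<close>.\<close>
  define C where "C = (16 * punctured_sphere_barrier.N p + 5) /
    (2 * punctured_sphere_barrier.ratio p * punctured_sphere_barrier.ratio p powr g)"
  have bound: "\<bar>perron p (Omega_dom \<delta> \<epsilon> S \<alpha>) (\<lambda>x. if x \<in> (\<Union>s\<in>S. cball s (\<alpha> * \<epsilon>)) then 1 else 0) z\<bar>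
      \<le> ereal (C * \<tau> powr g * \<delta>)"
    if h: "0 < \<delta>" "\<delta> < 1 / 2" "0 < \<epsilon>" "\<epsilon> < \<delta> / 10" "0 < \<tau>" "0 < \<alpha>" "\<alpha> < 1 / 80" "\<alpha> < \<tau> * \<epsilon> powr (1 / g)"
      "finite S" "S \<subseteq> sphere 0 1" "\<forall>s\<in>S. \<forall>t\<in>S. s \<noteq> t \<longrightarrow> \<epsilon> \<le> dist s t"
      and z: "z \<in> Omega_dom \<delta> \<epsilon> S (1 / 10)"
    for \<delta> \<epsilon> \<tau> \<alpha> and S :: "'a set" and z
  proof -
    interpret punctured_sphere_barrier p \<delta> \<epsilon> S
      by unfold_locales (use assms h in auto)
    have "\<alpha> powr g \<le> (\<tau> * \<epsilon> powr (1 / g)) powr g"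
      using h g by (intro powr_mono2) auto
    also have "\<dots> = \<tau> powr g * \<epsilon>"
      using h g by (simp add: powr_mult powr_powr)
    finally have "\<alpha> powr g \<le> \<tau> powr g * \<epsilon>" .
    \<comment> \<open>Smaller holes mean a larger domain: points off the holes of relative radius
      1/10 lie where the Perron solution is defined.\<close>
    moreover have "\<alpha> * \<epsilon> \<le> 1 / 10 * \<epsilon>" using h by (intro mult_right_mono) auto
    then have "z \<in> Omega_dom \<delta> \<epsilon> S \<alpha>" using z by (fastforce simp: Omega_dom_def)
    ultimately show ?thesis
      using perron_le[OF h(6) _ z] unfolding C_def g_def \<gamma>_def by blast
  qed
  have "0 < C"
  proof -
    \<comment> \<open>Any admissible parameters serve here, even the empty set: only positivity of
      quantities determined by \<open>p\<close> is read off.\<close>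
    interpret punctured_sphere_barrier p "1 / 4" "1 / 100" "{} :: 'a set"
      by unfold_locales (use assms in auto)
    have "0 < ratio" using N by (simp add: ratio_def slope_def)
    then show ?thesis using N by (simp add: C_def)
  qed
  then show ?thesis
    unfolding Let_def g_def[symmetric]
  proof (intro exI[of _ C] conjI allI impI ballI)
    fix \<delta> \<epsilon> \<tau> \<alpha> and S :: "'a set" and z
    assume h: "0 < \<delta> \<and> \<delta> < min (1/2) (1 / (2 * g)) \<and> 0 < \<epsilon> \<and> \<epsilon> < \<delta> / 10 \<and> 0 < \<tau> \<and>
       0 < \<alpha> \<and> \<alpha> < min (1/80) (\<tau> * \<epsilon> powr (1 / g)) \<and>
       finite S \<and> S \<subseteq> sphere 0 1 \<and> (\<forall>s\<in>S. \<forall>t\<in>S. s \<noteq> t \<longrightarrow> \<epsilon> \<le> dist s t)"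
      and z: "z \<in> Omega_dom \<delta> \<epsilon> S (1/10)"
    show "\<bar>perron p (Omega_dom \<delta> \<epsilon> S \<alpha>) (\<lambda>x. if x \<in> (\<Union>s\<in>S. cball s (\<alpha> * \<epsilon>)) then 1 else 0) z\<bar>
        \<le> ereal (C * \<tau> powr g * \<delta>)"
      using h by (intro bound z) auto
  qed
qed

end
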